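(* Let $N\ge1$, let $A=(a_1,\dots,a_N)\in\mathbb{R}^N$ with $a_1<\dots<a_N$, let $P,Q\in\mathbb{R}^N$ and $T>0$, and let $\mathcal{Z}=(Z_t)_{t\in[0,T]}$ be a global minimizer of the functional $\Lambda'$ defined in the context. Then $\mathcal{Z}$ is continuous and there exist times $$0=t_0<t_1<\dots<t_p=T$$ such that for each $i=1,\dots,p$, $\mathcal{Z}$ is smooth on $[t_{i-1},t_i]$ and $t\mapsto\pi(Z_t)$ is constant on $(t_{i-1},t_i)$.
   Context: For $X=(x_1,\dots,x_N)\in\mathbb{R}^N$ and a permutation $\sigma\in\mathfrak{S}_N$, $X^\sigma:=(x_{\sigma(1)},\dots,x_{\sigma(N)})$. Let $f(X):=\max_{\sigma\in\mathfrak{S}_N}X\cdot A^\sigma$ for $X\in\mathbb{R}^N$ (a convex function), and let $\overline{\nabla} f(X)$ be its extended gradient, i.e. the element of minimal Euclidean norm of the subdifferential $\partial f(X)$. The functional $\Lambda'$ is defined on curves $\mathcal{Z}=(Z_t)_{t\in[0,T]}\in C^0([0,T];\mathbb{R}^N)$ by $$\Lambda'(\mathcal{Z})=\int_0^T\left\{|\dot Z_t|^2+|Z_t-\overline{\nabla} f(Z_t)|^2\right\}dt$$ if $\mathcal{Z}\in H^1([0,T];\mathbb{R}^N)$, $Z_0\in\{P^\sigma:\sigma\in\mathfrak{S}_N\}$ and $Z_T\in\{Q^\sigma:\sigma\in\mathfrak{S}_N\}$, and $\Lambda'(\mathcal{Z})=+\infty$ otherwise. For $X\in\mathbb{R}^N$,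 $\pi(X)$ is the partition of $\{1,\dots,N\}$ induced by the equivalence relation $i\sim j\Leftrightarrow x_i=x_j$. *)

theory Defs
  imports "HOL-Analysis.Analysis"
begin

definition perm_vec :: "real ^ 'n \<Rightarrow> ('n \<Rightarrow> 'n) \<Rightarrow> real ^ 'n" where
  "perm_vec X \<sigma> = (\<chi> i. X $ \<sigma> i)"

definition f_max :: "real ^ 'n \<Rightarrow> real ^ 'n \<Rightarrow> real" where
  "f_max A X = Max ((\<lambda>\<sigma>. X \<bullet> perm_vec A \<sigma>) ` {\<sigma>. \<sigma> permutes UNIV})"

definition subdifferential :: "('a::real_inner \<Rightarrow> real) \<Rightarrow> 'a \<Rightarrow> 'a set" where
  "subdifferential f x = {p. \<forall>y. f x + p \<bullet> (y - x) \<le> f y}"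

(* If the subdifferential is nonempty (it is always closed and convex), the minimiser is unique. *)
definition ext_grad :: "('a::euclidean_space \<Rightarrow> real) \<Rightarrow> 'a \<Rightarrow> 'a" where
  "ext_grad f x = arg_min_on norm (subdifferential f x)"

definition level_partition :: "real ^ 'n \<Rightarrow> 'n set set" where
  "level_partition X = UNIV // {(i, j). X $ i = X $ j}"

definition L2_on :: "real set \<Rightarrow> (real \<Rightarrow> 'a::euclidean_space) \<Rightarrow> bool" where
  "L2_on I u \<longleftrightarrow> set_borel_measurable lborel I u \<and> set_integrable lborel I (\<lambda>t. (norm (u t))\<^sup>2)"

definition test_fun :: "real set \<Rightarrow> (real \<Rightarrow> real) \<Rightarrow> bool" where
  "test_fun I \<phi> \<longleftrightarrow> \<phi> C1_differentiable_on UNIV \<and>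
     compact (closure {t. \<phi> t \<noteq> 0}) \<and> closure {t. \<phi> t \<noteq> 0} \<subseteq> I"

definition has_L2_weak_deriv ::
    "real set \<Rightarrow> (real \<Rightarrow> 'a::euclidean_space) \<Rightarrow> (real \<Rightarrow> 'a) \<Rightarrow> bool" where
  "has_L2_weak_deriv I u v \<longleftrightarrow> L2_on I v \<and>
     (\<forall>\<phi>. test_fun I \<phi> \<longrightarrow>
        (LINT t:I|lborel. deriv \<phi> t *\<^sub>R u t) = - (LINT t:I|lborel. \<phi> t *\<^sub>R v t))"

definition H1_on :: "real set \<Rightarrow> (real \<Rightarrow> 'a::euclidean_space) \<Rightarrow> bool" where
  "H1_on I u \<longleftrightarrow> L2_on I u \<and> (\<exists>v. has_L2_weak_deriv I u v)"

(* On an open interval the weak derivative is unique up to null sets, so the choice is irrelevant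
   under an integral. *)
definition weak_deriv :: "real set \<Rightarrow> (real \<Rightarrow> 'a::euclidean_space) \<Rightarrow> real \<Rightarrow> 'a" where
  "weak_deriv I u = (SOME v. has_L2_weak_deriv I u v)"

(* Curves on {0..T} are total functions; every notion below only uses their values on {0..T}. *)
definition Lambda' ::
    "real ^ 'n \<Rightarrow> real ^ 'n \<Rightarrow> real ^ 'n \<Rightarrow> real \<Rightarrow> (real \<Rightarrow> real ^ 'n) \<Rightarrow> ennreal" where
  "Lambda' A P Q T Z =
    (if H1_on {0<..<T} Z
        \<and> Z 0 \<in> {perm_vec P \<sigma> | \<sigma>. \<sigma> permutes UNIV}
        \<and> Z T \<in> {perm_vec Q \<sigma> | \<sigma>. \<sigma> permutes UNIV}
     then \<integral>\<^sup>+t\<in>{0<..<T}. ennreal ((norm (weak_deriv {0<..<T} Z t))\<^sup>2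
            + (norm (Z t - ext_grad (f_max A) (Z t)))\<^sup>2) \<partial>lborel
     else \<infinity>)"

definition global_minimizer ::
    "real ^ 'n \<Rightarrow> real ^ 'n \<Rightarrow> real ^ 'n \<Rightarrow> real \<Rightarrow> (real \<Rightarrow> real ^ 'n) \<Rightarrow> bool" where
  "global_minimizer A P Q T Z \<longleftrightarrow> continuous_on {0..T} Z \<and>
     (\<forall>W. continuous_on {0..T} W \<longrightarrow> Lambda' A P Q T Z \<le> Lambda' A P Q T W)"

(* Derivatives of all orders on S, taken within S (one-sided at the endpoints of an interval). *)
definition smooth_on :: "real set \<Rightarrow> (real \<Rightarrow> 'a::real_normed_vector) \<Rightarrow> bool" where
  "smooth_on S u \<longleftrightarrow> (\<exists>D :: nat \<Rightarrow> real \<Rightarrow> 'a. (\<forall>t\<in>S. D 0 t = u t) \<and>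
     (\<forall>k. \<forall>t\<in>S. (D k has_vector_derivative D (Suc k) t) (at t within S)))"

end

theory Submission
  imports Defs
begin

text \<open>
  Let \<open>g x\<close> be the extended gradient of the convex function \<open>f\<close> at \<open>x\<close>. It is the barycentre of the
  vertices \<open>A\<^sup>\<sigma>\<close> over the permutations \<open>\<sigma>\<close> that sort \<open>x\<close> (lemma \<open>ext_grad_eq\<close>). It is constant on ties of
  \<open>x\<close> and strictly increasing otherwise, so that \<open>g x\<close> and the order of the coordinates of \<open>x\<close>, ties
  included, determine each other. Two things follow. The map \<open>g\<close> has finitely many values, and on a
  time interval on which \<open>g (Z t)\<close> is a constant \<open>c\<close> the partition is constant and \<open>Z\<close> is a critical
  point of the quadratic functional \<open>\<integral> |Z'|\<^sup>2 + |Z - c|\<^sup>2\<close> in a linear space, so that \<open>Z'' = Z - c\<close> and \<open>Z\<close> is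
  smooth up to the end points (lemma \<open>smooth_where_order_constant\<close>).

  It remains to show that \<open>g (Z t)\<close> jumps finitely often. The interval \<open>[0,T]\<close> is compact, so it is
  enough that \<open>g (Z t)\<close> is constant just after and just before every time, and reversing time leaves
  only the first claim. Put the time at \<open>0\<close> and let \<open>y t = Z t - Z 0\<close>. Near \<open>Z 0\<close> the order of
  \<open>Z 0 + y\<close> depends on the direction of \<open>y\<close> only, so \<open>y\<close> minimizes \<open>\<integral> |y'|\<^sup>2 + |y - G y|\<^sup>2\<close> for a field \<open>G\<close>
  with finitely many values and \<open>G (c y) = G y\<close> for \<open>c > 0\<close>. Up to \<open>O(|y|)\<close> the potential is
  \<open>W y = |G y|\<^sup>2\<close>. The central lemma \<open>minimizer_germ\<close> shows that \<open>G (y t)\<close> is constant just after \<open>0\<close>: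

  \<^item> Let \<open>m\<close> be the smallest value that \<open>W (y t)\<close> takes at arbitrarily small times. If \<open>W (y \<tau>) = m\<close>, then
    comparison with the chord from \<open>0\<close> to \<open>y \<tau>\<close> bounds by \<open>O(\<tau>\<^bsup>3/2\<^esup>)\<close> both the integral of \<open>W (y t) - m\<close> and
    the squared \<open>L\<^sup>2\<close> distance of the velocity from that of the chord. The first bound shows that such
    times meet every interval \<open>[s, 5 s]\<close> near \<open>0\<close>, and with the second bound \<open>y t / t\<close> has a limit \<open>\<theta>\<close>.

  \<^item> \<open>W \<theta> \<ge> m\<close>. Otherwise it would be cheaper to follow the ray of \<open>\<theta>\<close> until \<open>\<tau>/2\<close> and then to go
    straight to \<open>y \<tau>\<close>.

  \<^item> Directions near \<open>\<theta>\<close> break ties of \<open>\<theta>\<close> but do not reverse its order. For those \<open>W \<ge> W \<theta>\<close>, with equality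
    only if the order is that of \<open>\<theta>\<close>. So a small \<open>\<delta>\<close> with \<open>W (y \<delta>) = m\<close> has \<open>y \<delta>\<close> in the linear space
    of the ties of \<open>\<theta>\<close>, and the orthogonal projection to that space maps \<open>y\<close> on \<open>[0,\<delta>]\<close> to a
    curve with the same end points. It lowers the action unless it leaves \<open>y\<close> unchanged, because \<open>G \<theta>\<close>
    is the projection of every \<open>G q\<close> with \<open>q\<close> near \<open>\<theta>\<close>.

  Minimizers of class \<open>H\<^sup>1\<close> are handled as integrals of square integrable velocities. Integration by
  parts and the lemma of du Bois-Reymond translate between these and weak derivatives.\<close>

section \<open>Extended gradient of the maximum over permutations\<close>

definition order_refines :: "real ^ 'n \<Rightarrow> real ^ 'n \<Rightarrow> bool" where
  "order_refines y x \<longleftrightarrow> (\<forall>i j. x $ i < x $ j \<longrightarrow> y $ i < y $ j)"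

definition sorting_perms :: "real ^ 'n::{finite,linorder} \<Rightarrow> ('n \<Rightarrow> 'n) set" where
  "sorting_perms x = {\<sigma>. \<sigma> permutes UNIV \<and> (\<forall>i j. x $ i < x $ j \<longrightarrow> \<sigma> i < \<sigma> j)}"

text \<open>The linear span of the configurations with the same ties as \<open>x\<close>.\<close>
definition level_space :: "real ^ 'n \<Rightarrow> (real ^ 'n) set" where
  "level_space x = {v. \<forall>i j. x $ i = x $ j \<longrightarrow> v $ i = v $ j}"

text \<open>For strictly increasing \<open>A\<close> this is the element of least norm in the subdifferential of \<open>f\<close> at \<open>x\<close>,
  see \<open>ext_grad_eq\<close> below.\<close>
definition barycenter :: "real ^ 'n::{finite,linorder} \<Rightarrow> real ^ 'n::{finite,linorder} \<Rightarrow> real ^ 'n::{finite,linorder}" where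
  "barycenter A x = (1 / real (card (sorting_perms x))) *\<^sub>R (\<Sum>\<sigma>\<in>sorting_perms x. perm_vec A \<sigma>)"

lemma finite_perms: "finite {\<sigma>::'n::finite \<Rightarrow> 'n. \<sigma> permutes UNIV}"
  by (rule finite_permutations) simp

lemma finite_sorting_perms [simp]: "finite (sorting_perms (x::real^'n::{finite,linorder}))"
  unfolding sorting_perms_def by (rule finite_subset[OF _ finite_perms]) auto

lemma order_refines_sorting_perms: "order_refines y x \<Longrightarrow> sorting_perms y \<subseteq> sorting_perms x"
  unfolding order_refines_def sorting_perms_def by blast

lemma level_spaceD: "v \<in> level_space x \<Longrightarrow> x $ i = x $ j \<Longrightarrow> v $ i = v $ j"
  unfolding level_space_def by blast

lemma subspace_level_space:
  fixes x :: "real^'n"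
  shows "subspace (level_space x)"
  unfolding subspace_def level_space_def
proof (intro conjI ballI allI; simp only: mem_Collect_eq; intro allI impI)
  fix u v :: "real^'n" and i j :: 'n
  assume "\<forall>i j. x $ i = x $ j \<longrightarrow> u $ i = u $ j" "\<forall>i j. x $ i = x $ j \<longrightarrow> v $ i = v $ j"
    and ij: "x $ i = x $ j"
  then have "u $ i = u $ j" "v $ i = v $ j" by blast+
  then show "(u + v) $ i = (u + v) $ j" by simp
next
  fix c and u :: "real^'n" and i j :: 'n
  assume "\<forall>i j. x $ i = x $ j \<longrightarrow> u $ i = u $ j" and ij: "x $ i = x $ j"
  then have "u $ i = u $ j" by blast
  then show "(c *\<^sub>R u) $ i = (c *\<^sub>R u) $ j" by simp
qed simp

lemma level_space_self: "x \<in> level_space x"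
  unfolding level_space_def by auto

lemma order_refines_refl: "order_refines x x"
  by (simp add: order_refines_def)

lemma order_refines_level_space: "order_refines y x \<Longrightarrow> level_space x \<subseteq> level_space y"
  unfolding order_refines_def level_space_def
  by (smt (verit, ccfv_threshold) mem_Collect_eq subsetI)

lemma open_order_refines: "open {y::real^'n. order_refines y x}"
proof -
  have "open {y::real^'n. x $ i < x $ j \<longrightarrow> y $ i < y $ j}" for i j
    by (cases "x $ i < x $ j")
        (simp_all add: open_Collect_less[OF continuous_on_component[OF continuous_on_id] continuous_on_component[OF continuous_on_id]])
  then have "open (\<Inter>i. \<Inter>j. {y::real^'n. x $ i < x $ j \<longrightarrow> y $ i < y $ j})"
    by (intro open_INT ballI) auto
  moreover have "(\<Inter>i. \<Inter>j. {y::real^'n. x $ i < x $ j \<longrightarrow> y $ i < y $ j}) = {y. order_refines y x}"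
    unfolding order_refines_def by blast
  ultimately show ?thesis by simp
qed

lemma order_refines_near:
  fixes x :: "real^'n"
  shows "\<exists>\<rho>>0. \<forall>y\<in>ball x \<rho>. order_refines y x"
proof -
  have "x \<in> {y. order_refines y x}" by (simp add: order_refines_refl)
  from openE[OF open_order_refines this] show ?thesis by (metis mem_Collect_eq subsetD)
qed

text \<open>Two down-sets of a linear order are nested, so equal cardinality makes them equal.\<close>
lemma down_sets_eq:
  fixes S S' :: "'n::{finite,linorder} set"
  assumes "\<And>k l. l \<in> S \<Longrightarrow> k < l \<Longrightarrow> k \<in> S" "\<And>k l. l \<in> S' \<Longrightarrow> k < l \<Longrightarrow> k \<in> S'"
    and "card S = card S'"
  shows "S = S'"
proof -
  have "S \<subseteq> S' \<or> S' \<subseteq> S" using assms(1,2) by (metis linorder_neqE subsetI)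
  then show ?thesis using assms(3) by (metis card_subset_eq finite)
qed

text \<open>A permutation that sorts \<open>x\<close> maps each of the sets \<open>{x < c}\<close> and \<open>{x \<le> c}\<close> onto a down-set, and the
  down-set is determined by its cardinality. So all sorting permutations assign the same set of ranks to
  the level set of \<open>c\<close>.\<close>
lemma sorting_perms_image:
  fixes x :: "real^'n::{finite,linorder}"
  assumes s: "\<sigma> \<in> sorting_perms x" and t: "\<tau> \<in> sorting_perms x"
  shows "\<sigma> ` {i. x $ i = c} = \<tau> ` {i. x $ i = c}"
proof -
  have down: "k \<in> \<sigma> ` {i. R (x $ i)}"
    if s: "\<sigma> \<in> sorting_perms x" and l: "l \<in> \<sigma> ` {i. R (x $ i)}" and "k < l" and R: "\<And>a b. a \<le> b \<Longrightarrow> R b \<Longrightarrow> R a"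
    for \<sigma> k l and R :: "real \<Rightarrow> bool"
  proof -
    obtain i where i: "l = \<sigma> i" "R (x $ i)" using l by auto
    have p: "\<sigma> permutes UNIV" using s by (auto simp: sorting_perms_def)
    obtain j where j: "k = \<sigma> j" using p by (metis permutes_surj surjD)
    have "x $ i < x $ j \<longrightarrow> \<sigma> i < \<sigma> j" using s unfolding sorting_perms_def by blast
    then have "\<not> x $ i < x $ j" using i(1) j \<open>k < l\<close> by (meson order_less_asym)
    then have "R (x $ j)" using R i by (meson not_less)
    then show ?thesis using j by auto
  qed
  have inj: "inj \<sigma>" "inj \<tau>" using s t by (auto simp: sorting_perms_def permutes_inj)
  have eq: "\<sigma> ` {i. R (x $ i)} = \<tau> ` {i. R (x $ i)}"
    if R: "\<And>a b. a \<le> b \<Longrightarrow> R b \<Longrightarrow> R a" for R :: "real \<Rightarrow> bool"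
  proof (rule down_sets_eq)
    show "k \<in> \<sigma> ` {i. R (x $ i)}" if "l \<in> \<sigma> ` {i. R (x $ i)}" "k < l" for k l
      using down[where R = R, OF s that R] .
    show "k \<in> \<tau> ` {i. R (x $ i)}" if "l \<in> \<tau> ` {i. R (x $ i)}" "k < l" for k l
      using down[where R = R, OF t that R] .
    show "card (\<sigma> ` {i. R (x $ i)}) = card (\<tau> ` {i. R (x $ i)})"
      using inj by (metis card_image inj_on_subset subset_UNIV)
  qed
  have d: "{i. x $ i = c} = {i. x $ i \<le> c} - {i. x $ i < c}" by auto
  have "\<sigma> ` {i. x $ i = c} = \<sigma> ` {i. x $ i \<le> c} - \<sigma> ` {i. x $ i < c}"
    unfolding d by (rule image_set_diff[OF inj(1)])
  moreover have "\<tau> ` {i. x $ i = c} = \<tau> ` {i. x $ i \<le> c} - \<tau> ` {i. x $ i < c}"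
    unfolding d by (rule image_set_diff[OF inj(2)])
  ultimately show ?thesis using eq[of "\<lambda>a. a \<le> c"] eq[of "\<lambda>a. a < c"] by auto
qed

text \<open>A vector that is constant on the ties of \<open>x\<close> only sees the sums of \<open>A\<^sup>\<sigma>\<close> over level sets of \<open>x\<close>, which are
  sums of \<open>A\<close> over the same ranks for all sorting \<open>\<sigma>\<close>.\<close>
lemma inner_level_space_sorting_perms:
  fixes x v A :: "real^'n::{finite,linorder}"
  assumes s: "\<sigma> \<in> sorting_perms x" and t: "\<tau> \<in> sorting_perms x" and v: "v \<in> level_space x"
  shows "v \<bullet> perm_vec A \<sigma> = v \<bullet> perm_vec A \<tau>"
proof -
  have split: "v \<bullet> perm_vec A \<sigma> =
      (\<Sum>c\<in>range (($) x). (\<Sum>i | x $ i = c. v $ i * A $ \<sigma> i))" for \<sigma>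
    unfolding inner_vec_def perm_vec_def
    by (simp add: sum.group[of UNIV "range (($) x)" "($) x" "\<lambda>i. v $ i * A $ \<sigma> i", simplified])
  have "(\<Sum>i | x $ i = c. v $ i * A $ \<sigma> i) = (\<Sum>i | x $ i = c. v $ i * A $ \<tau> i)"
    if c: "c \<in> range (($) x)" for c
  proof -
    obtain k where k: "c = x $ k" using c by auto
    have vk: "v $ i = v $ k" if "x $ i = c" for i using v that k unfolding level_space_def by blast
    have im: "(\<Sum>i | x $ i = c. A $ \<sigma> i) = (\<Sum>l\<in>\<sigma> ` {i. x $ i = c}. A $ l)"
      if "\<sigma> \<in> sorting_perms x" for \<sigma>
    proof -
      have "inj_on \<sigma> {i. x $ i = c}"
        using that by (auto simp: sorting_perms_def dest: permutes_inj intro: inj_on_subset)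
      then show ?thesis by (simp add: sum.reindex)
    qed
    have "(\<Sum>i | x $ i = c. v $ i * A $ \<sigma> i) = v $ k * (\<Sum>i | x $ i = c. A $ \<sigma> i)"
      by (simp add: sum_distrib_left vk)
    also have "\<dots> = v $ k * (\<Sum>i | x $ i = c. A $ \<tau> i)"
      using im[OF s] im[OF t] sorting_perms_image[OF s t, of c] by simp
    also have "\<dots> = (\<Sum>i | x $ i = c. v $ i * A $ \<tau> i)"
      by (simp add: sum_distrib_left vk)
    finally show ?thesis .
  qed
  then show ?thesis unfolding split by (rule sum.cong[OF refl])
qed

locale increasing_vector =
  fixes A :: "real ^ 'n::{finite,linorder}"
  assumes strict_mono_A: "strict_mono (\<lambda>i. A $ i)"
begin

abbreviation g :: "(real, 'n) vec \<Rightarrow> (real, 'n) vec" where "g \<equiv> barycenter A"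

text \<open>The rearrangement argument: exchanging the ranks of a wrongly ordered pair increases the inner
  product.\<close>
lemma maximizer_sorts:
  assumes p: "\<sigma> permutes UNIV" and m: "\<And>\<tau>. \<tau> permutes UNIV \<Longrightarrow> x \<bullet> perm_vec A \<tau> \<le> x \<bullet> perm_vec A \<sigma>"
  shows "\<sigma> \<in> sorting_perms x"
proof -
  have "\<sigma> i < \<sigma> j" if ij: "x $ i < x $ j" for i j
  proof (rule ccontr)
    assume "\<not> \<sigma> i < \<sigma> j"
    moreover have "i \<noteq> j" using ij by auto
    ultimately have lt: "\<sigma> j < \<sigma> i" using p by (metis linorder_neqE permutes_inj injD)
    let ?t = "\<sigma> \<circ> Transposition.transpose i j"
    have "?t permutes UNIV" using p by (simp add: permutes_compose permutes_swap_id)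
    then have le: "x \<bullet> perm_vec A ?t \<le> x \<bullet> perm_vec A \<sigma>" by (rule m)
    have "x \<bullet> perm_vec A ?t - x \<bullet> perm_vec A \<sigma> = (\<Sum>k\<in>UNIV. x $ k * (A $ ?t k - A $ \<sigma> k))"
      by (simp add: inner_vec_def perm_vec_def sum_subtractf algebra_simps)
    also have "\<dots> = (\<Sum>k\<in>{i,j}. x $ k * (A $ ?t k - A $ \<sigma> k))"
      by (rule sum.mono_neutral_right) (auto simp: Transposition.transpose_def)
    also have "\<dots> = (x $ j - x $ i) * (A $ \<sigma> i - A $ \<sigma> j)"
      using \<open>i \<noteq> j\<close> by (simp add: algebra_simps)
    also have "\<dots> > 0" using ij lt strict_mono_A by (simp add: strict_mono_def)
    finally show False using le by simp
  qed
  then show ?thesis using p by (simp add: sorting_perms_def)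
qed

lemma ex_maximizer:
  fixes x :: "(real, 'n) vec"
  obtains \<sigma> where "\<sigma> permutes UNIV" "f_max A x = x \<bullet> perm_vec A \<sigma>"
    "\<And>\<tau>. \<tau> permutes UNIV \<Longrightarrow> x \<bullet> perm_vec A \<tau> \<le> x \<bullet> perm_vec A \<sigma>"
proof -
  let ?S = "(\<lambda>\<sigma>::'n \<Rightarrow> 'n. x \<bullet> perm_vec A \<sigma>) ` {\<sigma>. \<sigma> permutes UNIV}"
  have f: "finite ?S" using finite_perms by auto
  have ne: "?S \<noteq> {}" using permutes_id by blast
  from Max_in[OF f ne] obtain \<sigma> where "\<sigma> permutes UNIV" "f_max A x = x \<bullet> perm_vec A \<sigma>"
    unfolding f_max_def by auto
  moreover have "x \<bullet> perm_vec A \<tau> \<le> f_max A x" if "\<tau> permutes UNIV" for \<tau>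
    unfolding f_max_def by (rule Max_ge[OF f]) (use that in auto)
  ultimately show ?thesis using that by metis
qed

lemma sorting_perms_nonempty: "sorting_perms (x :: (real, 'n) vec) \<noteq> {}"
  using ex_maximizer[of x] maximizer_sorts[of _ x] by (metis empty_iff)

lemma inner_barycenter:
  assumes "order_refines y x" "\<sigma> \<in> sorting_perms x" "v \<in> level_space x"
  shows "v \<bullet> g y = v \<bullet> perm_vec A \<sigma>"
proof -
  have c: "card (sorting_perms y) > 0" using sorting_perms_nonempty[of y] by (simp add: card_gt_0_iff)
  have "v \<bullet> perm_vec A \<tau> = v \<bullet> perm_vec A \<sigma>" if "\<tau> \<in> sorting_perms y" for \<tau>
    using inner_level_space_sorting_perms[OF _ assms(2,3)] that order_refines_sorting_perms[OF assms(1)]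
    by blast
  moreover have "sorting_perms y \<noteq> {}" using c by auto
  ultimately have "v \<bullet> g y = (1 / real (card (sorting_perms y))) * (\<Sum>\<tau>\<in>sorting_perms y. v \<bullet> perm_vec A \<sigma>)"
    unfolding barycenter_def by (simp add: inner_sum_right)
  then show ?thesis using c \<open>sorting_perms y \<noteq> {}\<close> by simp
qed

text \<open>This is what makes projections useful: breaking ties of \<open>x\<close> changes \<open>g\<close> only orthogonally to the
  level space of \<open>x\<close>.\<close>
lemma inner_barycenter_refines:
  assumes "order_refines y x" "v \<in> level_space x"
  shows "v \<bullet> g y = v \<bullet> g x"
proof -
  obtain \<sigma> where "\<sigma> \<in> sorting_perms x" using sorting_perms_nonempty by blast
  then show ?thesis using inner_barycenter order_refines_refl assms by metis
qed

lemma f_max_eq: "f_max A x = x \<bullet> g x"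
proof -
  obtain \<sigma> where s: "\<sigma> permutes UNIV" "f_max A x = x \<bullet> perm_vec A \<sigma>"
    "\<And>\<tau>. \<tau> permutes UNIV \<Longrightarrow> x \<bullet> perm_vec A \<tau> \<le> x \<bullet> perm_vec A \<sigma>"
    using ex_maximizer by blast
  then show ?thesis
    using inner_barycenter[OF order_refines_refl maximizer_sorts[OF s(1,3)] level_space_self] by simp
qed

lemma barycenter_strict:
  assumes "x $ i < x $ j" shows "g x $ i < g x $ j"
proof -
  have c: "card (sorting_perms x) > 0" using sorting_perms_nonempty[of x] by (simp add: card_gt_0_iff)
  have "(\<Sum>\<sigma>\<in>sorting_perms x. A $ \<sigma> i) < (\<Sum>\<sigma>\<in>sorting_perms x. A $ \<sigma> j)"
    by (rule sum_strict_mono)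
      (use sorting_perms_nonempty[of x] assms strict_mono_A in \<open>auto simp: sorting_perms_def strict_mono_def\<close>)
  then show ?thesis using c by (simp add: barycenter_def perm_vec_def divide_strict_right_mono)
qed

text \<open>Composition with the transposition of two tied indices permutes the sorting permutations.\<close>
lemma barycenter_level: "g x \<in> level_space x"
proof -
  have "g x $ i = g x $ j" if ij: "x $ i = x $ j" for i j
  proof -
    let ?\<tau> = "Transposition.transpose i j"
    have xt: "x $ ?\<tau> k = x $ k" for k using ij by (auto simp: Transposition.transpose_def)
    have mem: "\<sigma> \<circ> ?\<tau> \<in> sorting_perms x" if "\<sigma> \<in> sorting_perms x" for \<sigma>
      using that xt unfolding sorting_perms_def by (auto simp: permutes_compose permutes_swap_id)
    have "(\<Sum>\<sigma>\<in>sorting_perms x. A $ \<sigma> i) = (\<Sum>\<sigma>\<in>sorting_perms x. A $ \<sigma> j)"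
      by (rule sum.reindex_bij_witness[of _ "\<lambda>\<sigma>. \<sigma> \<circ> ?\<tau>" "\<lambda>\<sigma>. \<sigma> \<circ> ?\<tau>"]) (auto simp: mem comp_assoc)
    then show ?thesis by (simp add: barycenter_def perm_vec_def)
  qed
  then show ?thesis unfolding level_space_def by blast
qed

text \<open>The value of \<open>g\<close> encodes the order of the coordinates, so all statements about strata of equal order
  can be made in terms of \<open>g\<close>.\<close>
lemma barycenter_less_iff: "g x $ i < g x $ j \<longleftrightarrow> x $ i < x $ j"
proof -
  have "x $ i = x $ j \<Longrightarrow> g x $ i = g x $ j" using barycenter_level[of x] unfolding level_space_def by blast
  then show ?thesis using barycenter_strict[of x] by (metis linorder_cases order_less_asym order_less_irrefl)
qed

lemma barycenter_eq_iff: "g x = g y \<longleftrightarrow> (\<forall>i j. x $ i < x $ j \<longleftrightarrow> y $ i < y $ j)"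
proof
  assume "g x = g y" then show "\<forall>i j. x $ i < x $ j \<longleftrightarrow> y $ i < y $ j"
    using barycenter_less_iff by metis
next
  assume "\<forall>i j. x $ i < x $ j \<longleftrightarrow> y $ i < y $ j"
  then have "sorting_perms x = sorting_perms y" by (auto simp: sorting_perms_def)
  then show "g x = g y" by (simp add: barycenter_def)
qed

lemma barycenter_eqI:
  assumes "order_refines y x" "y \<in> level_space x" shows "g y = g x"
  unfolding barycenter_eq_iff
proof (intro allI)
  fix i j
  show "y $ i < y $ j \<longleftrightarrow> x $ i < x $ j"
  proof (cases "x $ i" "x $ j" rule: linorder_cases)
    case less
    then show ?thesis using assms(1) by (simp add: order_refines_def)
  next
    case equal
    then show ?thesis using level_spaceD[OF assms(2) equal] by simp
  next
    case greater
    then have "y $ j < y $ i" using assms(1) by (simp add: order_refines_def)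
    then show ?thesis using greater by simp
  qed
qed

lemma barycenter_eq_level_space:
  assumes "g x = g y" shows "level_space x = level_space y"
proof -
  have "\<forall>i j. x $ i < x $ j \<longleftrightarrow> y $ i < y $ j" using assms barycenter_eq_iff[of x y] by blast
  then have "order_refines x y" "order_refines y x" unfolding order_refines_def by blast+
  then show ?thesis using order_refines_level_space by blast
qed

lemma finite_range_barycenter: "finite (range g)"
proof -
  have "range g \<subseteq> (\<lambda>S. (1 / real (card S)) *\<^sub>R (\<Sum>\<sigma>\<in>S. perm_vec A \<sigma>)) ` Pow {\<sigma>. \<sigma> permutes UNIV}"
    by (auto simp: barycenter_def sorting_perms_def)
  then show ?thesis by (rule finite_subset) (use finite_perms in auto)
qed

lemma borel_measurable_barycenter [measurable]: "g \<in> borel_measurable borel"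
proof -
  have e: "g x = (1 / (\<Sum>\<sigma> | \<sigma> permutes UNIV. of_bool (\<sigma> \<in> sorting_perms x))) *\<^sub>R
      (\<Sum>\<sigma> | \<sigma> permutes UNIV. of_bool (\<sigma> \<in> sorting_perms x) *\<^sub>R perm_vec A \<sigma>)" for x
  proof -
    have i: "{\<sigma>. \<sigma> permutes UNIV} \<inter> {\<sigma>. \<sigma> \<in> sorting_perms x} = sorting_perms x"
      by (auto simp: sorting_perms_def)
    have "(\<Sum>\<sigma> | \<sigma> permutes UNIV. of_bool (\<sigma> \<in> sorting_perms x) *\<^sub>R perm_vec A \<sigma>)
      = (\<Sum>\<sigma>\<in>sorting_perms x. perm_vec A \<sigma>)"
      using i finite_perms by (auto simp: sum.If_cases of_bool_def if_distrib[of "\<lambda>c. c *\<^sub>R _"])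
    moreover have "(\<Sum>\<sigma> | \<sigma> permutes UNIV. of_bool (\<sigma> \<in> sorting_perms x)) = real (card (sorting_perms x))"
      using i finite_perms by (simp add: sum.If_cases of_bool_def)
    ultimately show ?thesis by (simp add: barycenter_def)
  qed
  have [measurable]: "Measurable.pred borel (\<lambda>x::(real, 'n) vec. \<sigma> \<in> sorting_perms x)" for \<sigma>
    unfolding sorting_perms_def mem_Collect_eq by measurable
  show ?thesis unfolding e[abs_def] of_bool_def by measurable
qed

lemma barycenter_small_perturbation:
  assumes v: "v \<in> level_space x"
  shows "\<exists>\<epsilon>>0. \<forall>h. \<bar>h\<bar> < \<epsilon> \<longrightarrow> g (x + h *\<^sub>R v) = g x"
proof -
  obtain \<rho> where r: "\<rho> > 0" "\<And>y. y \<in> ball x \<rho> \<Longrightarrow> order_refines y x" using order_refines_near[of x] by auto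
  have "g (x + h *\<^sub>R v) = g x" if "\<bar>h\<bar> < \<rho> / (norm v + 1)" for h
  proof -
    have "\<bar>h\<bar> * norm v \<le> \<bar>h\<bar> * (norm v + 1)" by (simp add: mult_left_mono)
    also have "\<dots> < \<rho>" using that by (simp add: pos_less_divide_eq add_nonneg_pos)
    finally have "x + h *\<^sub>R v \<in> ball x \<rho>" by (simp add: dist_norm)
    then have o: "order_refines (x + h *\<^sub>R v) x" using r by auto
    have "x + h *\<^sub>R v \<in> level_space x"
      by (intro subspace_add[OF subspace_level_space] subspace_scale[OF subspace_level_space] v level_space_self)
    then show ?thesis using barycenter_eqI o by blast
  qed
  then show ?thesis using r(1) by (intro exI[of _ "\<rho> / (norm v + 1)"]) (auto simp: add_nonneg_pos)
qed

lemma barycenter_subdifferential: "g x \<in> subdifferential (f_max A) x"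
proof -
  have "y \<bullet> g x \<le> f_max A y" for y
  proof -
    have c: "card (sorting_perms x) > 0" using sorting_perms_nonempty[of x] by (simp add: card_gt_0_iff)
    obtain \<sigma> where s: "f_max A y = y \<bullet> perm_vec A \<sigma>"
    "\<And>\<tau>. \<tau> permutes UNIV \<Longrightarrow> y \<bullet> perm_vec A \<tau> \<le> y \<bullet> perm_vec A \<sigma>"
      using ex_maximizer by blast
    have "(\<Sum>\<tau>\<in>sorting_perms x. y \<bullet> perm_vec A \<tau>) \<le> (\<Sum>\<tau>\<in>sorting_perms x. f_max A y)"
      by (rule sum_mono) (use s in \<open>auto simp: sorting_perms_def\<close>)
    then show ?thesis using c by (simp add: barycenter_def inner_sum_right pos_divide_le_eq mult.commute)
  qed
  then show ?thesis unfolding subdifferential_def f_max_eq[of x]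
    by (auto simp: inner_diff_right inner_commute)
qed

text \<open>Small multiples of \<open>g x\<close> of either sign can be added to \<open>x\<close> without changing its order, so \<open>f\<close> is
  linear in the direction \<open>g x\<close> and all subgradients agree there.\<close>
lemma subdifferential_inner_barycenter:
  assumes p: "p \<in> subdifferential (f_max A) x" shows "p \<bullet> g x = g x \<bullet> g x"
proof -
  obtain \<epsilon> where e: "\<epsilon> > 0" "\<And>h. \<bar>h\<bar> < \<epsilon> \<Longrightarrow> g (x + h *\<^sub>R g x) = g x"
    using barycenter_small_perturbation[OF barycenter_level] by blast
  have *: "h * (p \<bullet> g x) \<le> h * (g x \<bullet> g x)" if "\<bar>h\<bar> < \<epsilon>" for h
  proof -
    have "f_max A x + p \<bullet> (h *\<^sub>R g x) \<le> f_max A (x + h *\<^sub>R g x)"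
      using p unfolding subdifferential_def by (auto dest: spec[of _ "x + h *\<^sub>R g x"])
    then show ?thesis using e(2)[OF that] by (simp add: f_max_eq inner_add_left)
  qed
  show ?thesis using *[of "\<epsilon>/2"] *[of "-\<epsilon>/2"] e(1) by (simp add: divide_simps)
qed

text \<open>By the preceding lemma every subgradient \<open>p\<close> satisfies \<open>|p|\<^sup>2 = |g x|\<^sup>2 + |p - g x|\<^sup>2\<close>.\<close>
lemma ext_grad_eq: "ext_grad (f_max A) x = g x"
proof -
  let ?S = "subdifferential (f_max A) x"
  have pyth: "(norm p)\<^sup>2 = (norm (g x))\<^sup>2 + (norm (p - g x))\<^sup>2" if "p \<in> ?S" for p
    using subdifferential_inner_barycenter[OF that]
    by (simp add: power2_norm_eq_inner inner_diff inner_commute)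
  have "is_arg_min norm (\<lambda>p. p \<in> ?S) p \<longleftrightarrow> p = g x" for p
  proof
    assume a: "is_arg_min norm (\<lambda>p. p \<in> ?S) p"
    then have "p \<in> ?S" "\<not> norm (g x) < norm p"
      using barycenter_subdifferential unfolding is_arg_min_def by auto
    then have "(norm p)\<^sup>2 \<le> (norm (g x))\<^sup>2" by (simp add: power_mono)
    then show "p = g x" using pyth[OF \<open>p \<in> ?S\<close>] by (simp add: power2_less_eq_zero_iff)
  next
    assume "p = g x"
    moreover have "norm (g x) \<le> norm q" if "q \<in> ?S" for q
    proof (rule power2_le_imp_le)
      show "(norm (g x))\<^sup>2 \<le> (norm q)\<^sup>2"
        unfolding pyth[OF that] by simp
    qed simp
    ultimately show "is_arg_min norm (\<lambda>p. p \<in> ?S) p"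
      using barycenter_subdifferential unfolding is_arg_min_def by (auto simp: not_less)
  qed
  then have "is_arg_min norm (\<lambda>p. p \<in> ?S) = (\<lambda>p. p = g x)" by blast
  then show ?thesis unfolding ext_grad_def arg_min_on_def arg_min_def by simp
qed

lemma barycenter_eq_level_partition:
  assumes "g x = g y" shows "level_partition x = level_partition y"
proof -
  have "\<forall>i j. x $ i < x $ j \<longleftrightarrow> y $ i < y $ j" using assms barycenter_eq_iff[of x y] by blast
  moreover have "z $ i = z $ j \<longleftrightarrow> \<not> z $ i < z $ j \<and> \<not> z $ j < z $ i" for z :: "(real, 'n) vec" and i j
    by auto
  ultimately have "x $ i = x $ j \<longleftrightarrow> y $ i = y $ j" for i j by blast
  then show ?thesis unfolding level_partition_def by presburger
qed

end

section \<open>Curves with square integrable velocity\<close>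

definition square_integrable :: "real \<Rightarrow> real \<Rightarrow> (real \<Rightarrow> 'a::euclidean_space) \<Rightarrow> bool" where
  "square_integrable a b v \<longleftrightarrow>
     v \<in> borel_measurable borel \<and> set_integrable lborel {a..b} (\<lambda>t. (norm (v t))\<^sup>2)"

lemma set_integrable_le:
  fixes f :: "real \<Rightarrow> 'a::euclidean_space" and h :: "real \<Rightarrow> real"
  assumes h: "set_integrable lborel {a..b} h" and f: "f \<in> borel_measurable borel"
    and le: "\<And>t. t \<in> {a..b} \<Longrightarrow> norm (f t) \<le> h t"
  shows "set_integrable lborel {a..b} f"
proof (rule set_integrable_bound[OF h])
  show "set_borel_measurable lborel {a..b} f"
    unfolding set_borel_measurable_def using f by measurable
  show "AE x in lborel. x \<in> {a..b} \<longrightarrow> norm (f x) \<le> norm (h x)"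
    using le by (intro AE_I2 impI) (simp, metis abs_ge_self order_trans)
qed

lemma set_integrable_const: "set_integrable lborel {a..b::real} (\<lambda>t. c::real)"
  unfolding set_integrable_def by (intro integrable_scaleR_left integrable_real_indicator) (auto simp: emeasure_lborel_Icc_eq)

lemma square_integrable_measurable: "square_integrable a b v \<Longrightarrow> v \<in> borel_measurable borel"
  by (simp add: square_integrable_def)

lemma square_integrable_sq: "square_integrable a b v \<Longrightarrow> set_integrable lborel {a..b} (\<lambda>t. (norm (v t))\<^sup>2)"
  by (simp add: square_integrable_def)

lemma square_integrable_inner:
  assumes v: "square_integrable a b v" and w: "square_integrable a b w"
  shows "set_integrable lborel {a..b} (\<lambda>t. v t \<bullet> w t)"
proof (rule set_integrable_le)
  show "set_integrable lborel {a..b} (\<lambda>t. (norm (v t))\<^sup>2 + (norm (w t))\<^sup>2)"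
    using v w by (intro set_integral_add) (auto simp: square_integrable_def)
  show "(\<lambda>t. v t \<bullet> w t) \<in> borel_measurable borel"
    using v w unfolding square_integrable_def by (auto intro: borel_measurable_inner)
  fix t
  have "\<bar>v t \<bullet> w t\<bar> \<le> norm (v t) * norm (w t)" by (rule Cauchy_Schwarz_ineq2)
  also have "\<dots> \<le> (norm (v t))\<^sup>2 + (norm (w t))\<^sup>2"
    using sum_squares_bound[of "norm (v t)" "norm (w t)"] mult_nonneg_nonneg[OF norm_ge_zero[of "v t"] norm_ge_zero[of "w t"]]
    by linarith
  finally show "norm (v t \<bullet> w t) \<le> (norm (v t))\<^sup>2 + (norm (w t))\<^sup>2" by simp
qed

lemma square_integrable_imp_integrable:
  assumes v: "square_integrable a b v" shows "set_integrable lborel {a..b} v"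
proof (rule set_integrable_le)
  show "set_integrable lborel {a..b} (\<lambda>t. 1 + (norm (v t))\<^sup>2)"
    using v by (intro set_integral_add set_integrable_const) (auto simp: square_integrable_def)
  fix t
  have "2 * norm (v t) \<le> (norm (v t))\<^sup>2 + 1" using sum_squares_bound[of "norm (v t)" 1] by simp
  then show "norm (v t) \<le> 1 + (norm (v t))\<^sup>2" using norm_ge_zero[of "v t"] by linarith
qed (use v in \<open>simp add: square_integrable_def\<close>)

lemma square_integrable_subinterval:
  assumes "square_integrable a b v" "a \<le> c" "d \<le> b" shows "square_integrable c d v"
  using assms unfolding square_integrable_def by (auto intro: set_integrable_subset)

lemma square_integrable_bounded:
  assumes "v \<in> borel_measurable borel" "\<And>t. t \<in> {a..b} \<Longrightarrow> norm (v t) \<le> B"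
  shows "square_integrable a b v"
  unfolding square_integrable_def
proof
  show "set_integrable lborel {a..b} (\<lambda>t. (norm (v t))\<^sup>2)"
  proof (rule set_integrable_le[OF set_integrable_const[of a b "B\<^sup>2"]])
    show "norm ((norm (v t))\<^sup>2) \<le> B\<^sup>2" if "t \<in> {a..b}" for t
      using assms(2)[OF that] by (simp add: power_mono)
  qed (use assms in measurable)
qed (rule assms)

lemma square_integrable_const: "square_integrable a b (\<lambda>t. e)"
  by (rule square_integrable_bounded) auto

lemma square_integrable_add:
  assumes v: "square_integrable a b v" and w: "square_integrable a b w"
  shows "square_integrable a b (\<lambda>t. v t + w t)"
proof -
  have "set_integrable lborel {a..b} (\<lambda>t. (norm (v t))\<^sup>2 + (norm (w t))\<^sup>2 + 2 * (v t \<bullet> w t))"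
    using v w by (intro set_integral_add set_integrable_mult_right square_integrable_inner)
      (auto simp: square_integrable_def)
  then show ?thesis using v w unfolding square_integrable_def
    by (auto simp: power2_norm_eq_inner inner_add_left inner_add_right inner_commute algebra_simps)
qed

lemma square_integrable_linear:
  fixes f :: "'a::euclidean_space \<Rightarrow> 'b::euclidean_space"
  assumes f: "bounded_linear f" and v: "square_integrable a b v"
  shows "square_integrable a b (\<lambda>t. f (v t))"
proof -
  obtain K where K: "\<And>x. norm (f x) \<le> norm x * K" using bounded_linear.bounded[OF f] by blast
  have [measurable]: "f \<in> borel_measurable borel"
    by (intro borel_measurable_continuous_onI linear_continuous_on f)
  have [measurable]: "v \<in> borel_measurable borel" using v by (simp add: square_integrable_def)
  show ?thesis unfolding square_integrable_def
  proof
    show "set_integrable lborel {a..b} (\<lambda>t. (norm (f (v t)))\<^sup>2)"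
    proof (rule set_integrable_le)
      show "set_integrable lborel {a..b} (\<lambda>t. K\<^sup>2 * (norm (v t))\<^sup>2)"
        using v by (intro set_integrable_mult_right) (auto simp: square_integrable_def)
      show "norm ((norm (f (v t)))\<^sup>2) \<le> K\<^sup>2 * (norm (v t))\<^sup>2" for t
        using power_mono[OF K[of "v t"], of 2] by (simp add: power_mult_distrib mult.commute)
    qed measurable
  qed measurable
qed

lemma square_integrable_diff:
  assumes v: "square_integrable a b v" and w: "square_integrable a b w"
  shows "square_integrable a b (\<lambda>t. v t - w t)"
  using square_integrable_add[OF v square_integrable_linear[OF bounded_linear_minus[OF bounded_linear_ident] w]] by simp

lemma square_integrable_If:
  assumes v: "square_integrable a c v" and w: "square_integrable c b w"
  shows "square_integrable a b (\<lambda>t. if t \<le> c then v t else w t)"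
proof -
  have [measurable]: "v \<in> borel_measurable borel" "w \<in> borel_measurable borel"
    using v w by (auto simp: square_integrable_def)
  let ?h = "\<lambda>t. indicator {a..c} t *\<^sub>R (norm (v t))\<^sup>2 + indicator {c..b} t *\<^sub>R (norm (w t))\<^sup>2"
  have "integrable lborel ?h"
    using v w unfolding square_integrable_def set_integrable_def by (intro Bochner_Integration.integrable_add) auto
  then have h: "set_integrable lborel {a..b} ?h"
    unfolding set_integrable_def by (rule integrable_mult_indicator[rotated]) simp
  show ?thesis unfolding square_integrable_def
  proof
    show "set_integrable lborel {a..b} (\<lambda>t. (norm (if t \<le> c then v t else w t))\<^sup>2)"
      by (rule set_integrable_le[OF h]) (auto simp: indicator_def)
  qed measurable
qed

lemma set_integrable_integrable_on:
  fixes f :: "real \<Rightarrow> 'a::euclidean_space"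
  assumes "set_integrable lborel {a..b} f" "a \<le> c" "d \<le> b"
  shows "f integrable_on {c..d}"
proof -
  have "set_integrable lborel {c..d} f"
    by (rule set_integrable_subset[OF assms(1)]) (use assms in auto)
  then show ?thesis by (rule set_borel_integral_eq_integral)
qed

lemma square_integrable_integrable_on:
  assumes "square_integrable a b v"
  shows "v integrable_on {a..b}" "(\<lambda>t. (norm (v t))\<^sup>2) integrable_on {a..b}"
  using set_integrable_integrable_on[OF square_integrable_imp_integrable[OF assms], of a b]
    set_integrable_integrable_on[OF square_integrable_sq[OF assms], of a b] by auto

text \<open>The variance identity. For \<open>e\<close> the mean of \<open>v\<close> it measures how much a curve with velocity \<open>v\<close> costs
  more than its chord.\<close>
lemma integral_norm_diff_const:
  assumes v: "square_integrable a b v" and ab: "a \<le> b"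
  shows "integral {a..b} (\<lambda>t. (norm (v t - e))\<^sup>2) =
    integral {a..b} (\<lambda>t. (norm (v t))\<^sup>2) - 2 * (integral {a..b} v \<bullet> e) + (b - a) * (norm e)\<^sup>2"
proof -
  note i = square_integrable_integrable_on[OF v]
  have ie: "((\<lambda>t. v t \<bullet> e) has_integral integral {a..b} v \<bullet> e) {a..b}"
    using has_integral_linear[OF integrable_integral[OF i(1)] bounded_linear_inner_left[of e]]
    by (simp add: o_def)
  have c: "((\<lambda>t. (norm e)\<^sup>2) has_integral (b - a) * (norm e)\<^sup>2) {a..b}"
    using has_integral_const_real[of "(norm e)\<^sup>2" a b] ab by simp
  have "((\<lambda>t. (norm (v t))\<^sup>2 - 2 * (v t \<bullet> e) + (norm e)\<^sup>2) has_integral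
      integral {a..b} (\<lambda>t. (norm (v t))\<^sup>2) - 2 * (integral {a..b} v \<bullet> e) + (b - a) * (norm e)\<^sup>2) {a..b}"
    by (intro has_integral_add has_integral_diff has_integral_mult_right integrable_integral i ie c)
  moreover have "(norm (v t - e))\<^sup>2 = (norm (v t))\<^sup>2 - 2 * (v t \<bullet> e) + (norm e)\<^sup>2" for t
    by (simp add: power2_norm_eq_inner inner_diff_left inner_diff_right inner_commute)
  ultimately show ?thesis by (simp add: integral_unique)
qed

lemma norm_integral_sq_le:
  assumes v: "square_integrable a b v" and ab: "a \<le> b"
  shows "(norm (integral {a..b} v))\<^sup>2 \<le> (b - a) * integral {a..b} (\<lambda>t. (norm (v t))\<^sup>2)"
proof (cases "a = b")
  case False
  define m where "m = (1 / (b - a)) *\<^sub>R integral {a..b} v"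
  have ne: "b - a > 0" using False ab by simp
  have I: "integral {a..b} v = (b - a) *\<^sub>R m" using ne by (simp add: m_def)
  have "0 \<le> integral {a..b} (\<lambda>t. (norm (v t - m))\<^sup>2)"
    by (rule integral_nonneg) (auto intro!: square_integrable_integrable_on square_integrable_diff v square_integrable_const)
  then have "(b - a) * (norm m)\<^sup>2 \<le> integral {a..b} (\<lambda>t. (norm (v t))\<^sup>2)"
    unfolding integral_norm_diff_const[OF v ab] I by (simp add: power2_norm_eq_inner)
  then have "(b - a) * ((b - a) * (norm m)\<^sup>2) \<le> (b - a) * integral {a..b} (\<lambda>t. (norm (v t))\<^sup>2)"
    using ne by (simp add: mult_left_mono)
  moreover have "norm (integral {a..b} v) = (b - a) * norm m" unfolding I using ne by simp
  ultimately show ?thesis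
    by (simp only: power_mult_distrib) (simp add: power2_eq_square[of "b - a"] mult.assoc)
qed simp

text \<open>A curve of class \<open>H\<^sup>1\<close> together with a square integrable velocity. Keeping the velocity as an explicit
  argument makes competitors easy to build: only sums, linear images and concatenations are needed.\<close>
definition h1_path :: "real \<Rightarrow> real \<Rightarrow> (real \<Rightarrow> 'a::euclidean_space) \<Rightarrow> (real \<Rightarrow> 'a) \<Rightarrow> bool" where
  "h1_path a b z v \<longleftrightarrow> square_integrable a b v \<and> (\<forall>t\<in>{a..b}. z t = z a + integral {a..t} v)"

lemma h1_path_square_integrable: "h1_path a b z v \<Longrightarrow> square_integrable a b v"
  unfolding h1_path_def by blast

lemma h1_pathD: "h1_path a b z v \<Longrightarrow> a \<le> t \<Longrightarrow> t \<le> b \<Longrightarrow> z t = z a + integral {a..t} v"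
  unfolding h1_path_def by (meson atLeastAtMost_iff)

lemma h1_pathI:
  "square_integrable a b v \<Longrightarrow> (\<And>t. a \<le> t \<Longrightarrow> t \<le> b \<Longrightarrow> z t = z a + integral {a..t} v) \<Longrightarrow> h1_path a b z v"
  unfolding h1_path_def by (meson atLeastAtMost_iff)

lemma h1_path_diff:
  assumes h: "h1_path a b z v" and st: "a \<le> s" "s \<le> t" "t \<le> b"
  shows "z t - z s = integral {s..t} v"
proof -
  have "v integrable_on {a..t}"
    using set_integrable_integrable_on[OF square_integrable_imp_integrable[OF h1_path_square_integrable[OF h]], of a t] st by auto
  then have "integral {a..s} v + integral {s..t} v = integral {a..t} v"
    using st by (intro Henstock_Kurzweil_Integration.integral_combine) auto
  then show ?thesis using h1_pathD[OF h, of t] h1_pathD[OF h, of s] st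
    by (simp add: algebra_simps)
qed

lemma h1_path_subinterval:
  assumes h: "h1_path a b z v" and "a \<le> c" "d \<le> b" shows "h1_path c d z v"
proof -
  show ?thesis
  proof (rule h1_pathI)
    show "square_integrable c d v"
      using square_integrable_subinterval[OF h1_path_square_integrable[OF h]] assms by blast
    fix t assume "c \<le> t" "t \<le> d"
    then show "z t = z c + integral {c..t} v"
      using h1_path_diff[OF h, of c t, symmetric] assms by simp
  qed
qed

lemma h1_path_continuous:
  assumes h: "h1_path a b z v" shows "continuous_on {a..b} z"
proof -
  have "continuous_on {a..b} (\<lambda>t. z a + integral {a..t} v)"
    by (intro continuous_intros indefinite_integral_continuous_1 square_integrable_integrable_on(1) h1_path_square_integrable[OF h])
  then show ?thesis by (rule continuous_on_eq) (metis h1_pathD[OF h] atLeastAtMost_iff)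
qed

text \<open>The Cauchy-Schwarz estimate, which makes such curves Hoelder continuous with exponent \<open>1/2\<close>.\<close>
lemma h1_path_increment:
  assumes h: "h1_path a b z v" and st: "a \<le> s" "s \<le> t" "t \<le> b"
  shows "(norm (z t - z s))\<^sup>2 \<le> (t - s) * integral {s..t} (\<lambda>t. (norm (v t))\<^sup>2)"
  unfolding h1_path_diff[OF assms]
  by (rule norm_integral_sq_le) (use square_integrable_subinterval[OF h1_path_square_integrable[OF h]] st in auto)

lemma h1_path_linear:
  fixes f :: "'a::euclidean_space \<Rightarrow> 'b::euclidean_space"
  assumes f: "bounded_linear f" and h: "h1_path a b z v"
  shows "h1_path a b (\<lambda>t. f (z t)) (\<lambda>t. f (v t))"
  unfolding h1_path_def
proof (intro conjI ballI)
  show "square_integrable a b (\<lambda>t. f (v t))"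
    by (rule square_integrable_linear[OF f h1_path_square_integrable[OF h]])
  fix t assume t: "t \<in> {a..b}"
  have i: "v integrable_on {a..t}"
    using set_integrable_integrable_on[OF square_integrable_imp_integrable[OF h1_path_square_integrable[OF h]], of a t] t by auto
  have "f (z t) = f (z a) + f (integral {a..t} v)"
    using arg_cong[OF h1_pathD[OF h, of t], of f] t by (simp add: linear_simps(1)[OF f])
  also have "f (integral {a..t} v) = integral {a..t} (\<lambda>t. f (v t))"
    using integral_linear[OF i f] by (simp add: o_def)
  finally show "f (z t) = f (z a) + integral {a..t} (\<lambda>t. f (v t))" .
qed

lemma h1_path_add:
  assumes h: "h1_path a b z v" and k: "h1_path a b z' v'"
  shows "h1_path a b (\<lambda>t. z t + z' t) (\<lambda>t. v t + v' t)"
  unfolding h1_path_def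
proof (intro conjI ballI)
  show "square_integrable a b (\<lambda>t. v t + v' t)"
    by (intro square_integrable_add h1_path_square_integrable[OF h] h1_path_square_integrable[OF k])
  fix t assume t: "t \<in> {a..b}"
  have "v integrable_on {a..t}" "v' integrable_on {a..t}"
    using set_integrable_integrable_on[OF square_integrable_imp_integrable[OF h1_path_square_integrable[OF h]], of a t]
    set_integrable_integrable_on[OF square_integrable_imp_integrable[OF h1_path_square_integrable[OF k]], of a t] t by auto
  then have "integral {a..t} (\<lambda>t. v t + v' t) = integral {a..t} v + integral {a..t} v'"
    by (rule integral_add)
  then show "z t + z' t = z a + z' a + integral {a..t} (\<lambda>t. v t + v' t)"
    using h1_pathD[OF h, of t] h1_pathD[OF k, of t] t by simp
qed

lemma h1_path_affine: "h1_path a b (\<lambda>t. p + (t - a) *\<^sub>R e) (\<lambda>t. e)"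
  by (rule h1_pathI) (auto simp: square_integrable_const)

lemma h1_path_If:
  assumes h: "h1_path a c z v" and k: "h1_path c b z' v'" and eq: "z c = z' c" and ab: "a \<le> c" "c \<le> b"
  shows "h1_path a b (\<lambda>t. if t \<le> c then z t else z' t) (\<lambda>t. if t \<le> c then v t else v' t)"
    (is "h1_path a b ?z ?v")
proof -
  have si: "square_integrable a b ?v"
    by (intro square_integrable_If h1_path_square_integrable[OF h] h1_path_square_integrable[OF k])
  have "?z t = ?z a + integral {a..t} ?v" if t: "a \<le> t" "t \<le> b" for t
  proof (cases "t \<le> c")
    case True
    then have "integral {a..t} ?v = integral {a..t} v" by (intro integral_cong) auto
    then show ?thesis using h1_pathD[OF h, of t] t True ab by simp
  next
    case False
    have i: "?v integrable_on {a..t}"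
      using set_integrable_integrable_on[OF square_integrable_imp_integrable[OF si], of a t] t by auto
    have "integral {a..t} ?v = integral {a..c} ?v + integral {c..t} ?v"
      using ab False i by (intro Henstock_Kurzweil_Integration.integral_combine[symmetric]) auto
    also have "integral {a..c} ?v = integral {a..c} v" by (intro integral_cong) auto
    also have "integral {c..t} ?v = integral {c..t} v'" by (rule integral_spike[of "{c}"]) auto
    also have "integral {a..c} v = z c - z a" using h1_path_diff[OF h, of a c] ab by simp
    also have "integral {c..t} v' = z' t - z' c" using h1_path_diff[OF k, of c t] False t by simp
    finally show ?thesis using False ab eq by simp
  qed
  then show ?thesis using si by (rule h1_pathI[rotated])
qed

section \<open>Weak derivatives of continuous curves\<close>

lemma test_funD:
  assumes "test_fun {a<..<b} \<phi>"
  shows "(\<phi> has_vector_derivative deriv \<phi> t) (at t)" "continuous_on UNIV (deriv \<phi>)"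
    and "t \<notin> {a<..<b} \<Longrightarrow> \<phi> t = 0" "t \<notin> {a<..<b} \<Longrightarrow> deriv \<phi> t = 0"
proof -
  obtain D where D: "\<And>x. (\<phi> has_vector_derivative D x) (at x)" "continuous_on UNIV D"
    using assms unfolding test_fun_def C1_differentiable_on_def by auto
  have eq: "deriv \<phi> = D"
    using D(1) by (intro ext DERIV_imp_deriv) (simp add: has_real_derivative_iff_has_vector_derivative)
  show "(\<phi> has_vector_derivative deriv \<phi> t) (at t)" "continuous_on UNIV (deriv \<phi>)"
    using D unfolding eq by auto
  assume t: "t \<notin> {a<..<b}"
  define S where "S = - closure {t. \<phi> t \<noteq> 0}"
  have tS: "t \<in> S" using t assms unfolding test_fun_def S_def by blast
  have z: "\<phi> s = 0" if "s \<in> S" for s using that closure_subset[of "{t. \<phi> t \<noteq> 0}"] unfolding S_def by blast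
  then show "\<phi> t = 0" using tS by blast
  have "((\<lambda>_. 0) has_vector_derivative D t) (at t)"
    by (rule has_vector_derivative_transform_within_open[OF D(1) _ tS z]) (simp add: S_def open_Compl)
  then have "D t = 0" using vector_derivative_unique_at[OF _ has_vector_derivative_const] by blast
  then show "deriv \<phi> t = 0" unfolding eq .
qed

lemma test_fun_continuous: "test_fun {a<..<b} \<phi> \<Longrightarrow> continuous_on UNIV \<phi>"
  using test_funD(1) by (meson continuous_at_imp_continuous_on has_vector_derivative_continuous)

lemma test_fun_h1_path:
  assumes \<phi>: "test_fun {a<..<b} \<phi>"
  shows "h1_path c d \<phi> (deriv \<phi>)"
proof (rule h1_pathI)
  have cont: "continuous_on UNIV (deriv \<phi>)" using \<phi> by (rule test_funD)
  have "bounded (deriv \<phi> ` {c..d})"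
    by (rule compact_imp_bounded[OF compact_continuous_image[OF continuous_on_subset[OF cont subset_UNIV] compact_Icc]])
  then obtain B where "\<And>t. t \<in> {c..d} \<Longrightarrow> norm (deriv \<phi> t) \<le> B" unfolding bounded_iff by blast
  then show "square_integrable c d (deriv \<phi>)"
    by (rule square_integrable_bounded[OF borel_measurable_continuous_onI[OF cont]])
  fix t assume "c \<le> t" "t \<le> d"
  from \<open>c \<le> t\<close> have "(deriv \<phi> has_integral (\<phi> t - \<phi> c)) {c..t}"
    by (rule fundamental_theorem_of_calculus[OF _ has_vector_derivative_at_within[OF test_funD(1)[OF \<phi>]]])
  then have "integral {c..t} (deriv \<phi>) = \<phi> t - \<phi> c" by (rule integral_unique)
  then show "\<phi> t = \<phi> c + integral {c..t} (deriv \<phi>)" by simp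
qed

text \<open>Write \<open>z t\<close> as \<open>z a\<close> plus the integral of \<open>v\<close> over \<open>[a,t]\<close> and exchange the two integrations over the triangle
  \<open>s \<le> t\<close>.\<close>
lemma integration_by_parts_h1:
  fixes z :: "real \<Rightarrow> 'a::euclidean_space"
  assumes z: "h1_path a b z v" and \<phi>: "test_fun {a<..<b} \<phi>"
  shows "integral {a..b} (\<lambda>t. deriv \<phi> t *\<^sub>R z t) = - integral {a..b} (\<lambda>t. \<phi> t *\<^sub>R v t)"
proof (cases "a \<le> b")
  case True
  let ?\<psi> = "deriv \<phi>"
  have cont: "continuous_on UNIV ?\<psi>" using \<phi> by (rule test_funD)
  have [measurable]: "?\<psi> \<in> borel_measurable borel" by (rule borel_measurable_continuous_onI[OF cont])
  have cont\<phi>: "continuous_on UNIV \<phi>" by (rule test_fun_continuous[OF \<phi>])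
  have [measurable]: "\<phi> \<in> borel_measurable borel" by (rule borel_measurable_continuous_onI[OF cont\<phi>])
  have si: "square_integrable a b v" by (rule h1_path_square_integrable[OF z])
  have v[measurable]: "v \<in> borel_measurable borel" by (rule square_integrable_measurable[OF si])
  define V where "V s = indicator {a..b} s *\<^sub>R v s" for s
  have V[measurable]: "V \<in> borel_measurable borel" unfolding V_def by measurable
  have Vint: "integrable lborel V"
    using square_integrable_imp_integrable[OF si] unfolding V_def set_integrable_def .
  obtain M where M: "\<And>t. \<bar>?\<psi> t\<bar> \<le> M"
  proof -
    have "bounded (?\<psi> ` {a..b})"
      by (rule compact_imp_bounded[OF compact_continuous_image[OF continuous_on_subset[OF cont subset_UNIV] compact_Icc]])
    then obtain M where M: "\<And>t. t \<in> {a..b} \<Longrightarrow> \<bar>?\<psi> t\<bar> \<le> M"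
      unfolding bounded_iff real_norm_def by blast
    have "\<bar>?\<psi> t\<bar> \<le> \<bar>M\<bar>" for t
      using M[of t] test_funD(4)[OF \<phi>, of t] by (cases "t \<in> {a..b}") auto
    then show ?thesis using that by blast
  qed
  define f where "f = (\<lambda>(t, s). (indicator {a..b} t * (if s \<le> t then ?\<psi> t else 0)) *\<^sub>R V s)"
  have f_meas[measurable]: "f \<in> borel_measurable (lborel \<Otimes>\<^sub>M lborel)" unfolding f_def by measurable
  have f_int: "integrable lborel (\<lambda>s. f (t, s))" for t
  proof (rule Bochner_Integration.integrable_bound)
    show "integrable lborel (\<lambda>s. M *\<^sub>R V s)" using Vint by simp
    show "AE s in lborel. norm (f (t, s)) \<le> norm (M *\<^sub>R V s)"
      using M[of t] by (intro AE_I2) (auto simp: f_def indicator_def intro!: mult_right_mono)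
    show "(\<lambda>s. f (t, s)) \<in> borel_measurable lborel"
      by (rule measurable_compose[OF measurable_Pair1' f_meas]) simp
  qed
  have fi: "integrable (lborel \<Otimes>\<^sub>M lborel) f"
  proof (rule lborel_pair.Fubini_integrable)
    show "AE t in lborel. integrable lborel (\<lambda>s. f (t, s))" using f_int by simp
    show "integrable lborel (\<lambda>t. LINT s|lborel. norm (f (t, s)))"
    proof (rule Bochner_Integration.integrable_bound)
      show "integrable lborel (\<lambda>t. indicator {a..b} t *\<^sub>R (M * (LINT s|lborel. norm (V s))))"
        using set_integrable_const[of a b] unfolding set_integrable_def .
      show "AE t in lborel. norm (LINT s|lborel. norm (f (t, s))) \<le> norm (indicator {a..b} t *\<^sub>R (M * (LINT s|lborel. norm (V s))))"
      proof (rule AE_I2)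
        fix t
        have "(LINT s|lborel. norm (f (t, s))) \<le> (LINT s|lborel. indicator {a..b} t * (M * norm (V s)))"
        proof (rule integral_mono[OF integrable_norm[OF f_int]])
          show "integrable lborel (\<lambda>s. indicator {a..b} t * (M * norm (V s)))"
            using integrable_norm[OF Vint] by simp
          show "norm (f (t, s)) \<le> indicator {a..b} t * (M * norm (V s))" for s
            using M[of t] by (auto simp: f_def indicator_def intro!: mult_right_mono)
        qed
        moreover have "0 \<le> (LINT s|lborel. norm (f (t, s)))" by (rule Bochner_Integration.integral_nonneg) simp
        ultimately show "norm (LINT s|lborel. norm (f (t, s))) \<le> norm (indicator {a..b} t *\<^sub>R (M * (LINT s|lborel. norm (V s))))"
          by simp
      qed
    qed measurable
  qed measurable
  have inner1: "(LINT s|lborel. f (t, s)) = indicator {a..b} t *\<^sub>R (?\<psi> t *\<^sub>R (z t - z a))" for t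
  proof (cases "t \<in> {a..b}")
    case t: True
    have "(LINT s|lborel. f (t, s)) = (LINT s|lborel. ?\<psi> t *\<^sub>R (indicator {a..t} s *\<^sub>R v s))"
      using t by (intro Bochner_Integration.integral_cong) (auto simp: f_def V_def indicator_def)
    also have "\<dots> = ?\<psi> t *\<^sub>R (LINT s:{a..t}|lborel. v s)"
      by (simp only: set_lebesgue_integral_def integral_scaleR_right)
    also have "(LINT s:{a..t}|lborel. v s) = integral {a..t} v"
      using square_integrable_imp_integrable[OF square_integrable_subinterval[OF si order_refl, of t]] t
      by (intro set_borel_integral_eq_integral(2)) auto
    also have "\<dots> = z t - z a" using h1_pathD[OF z, of t] t by simp
    finally show ?thesis using t by simp
  qed (simp add: f_def)
  have inner2: "(LINT t|lborel. f (t, s)) = - (indicator {a..b} s *\<^sub>R (\<phi> s *\<^sub>R v s))" for s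
  proof (cases "s \<in> {a..b}")
    case s: True
    have "(LINT t|lborel. f (t, s)) = (LINT t|lborel. (indicator {s..b} t *\<^sub>R ?\<psi> t) *\<^sub>R v s)"
      using s by (intro Bochner_Integration.integral_cong) (auto simp: f_def V_def indicator_def)
    also have "\<dots> = (LINT t:{s..b}|lborel. ?\<psi> t) *\<^sub>R v s"
      unfolding set_lebesgue_integral_def
      using square_integrable_imp_integrable[OF h1_path_square_integrable[OF test_fun_h1_path[OF \<phi>, of s b]]]
      by (intro integral_scaleR_left) (simp add: set_integrable_def)
    also have "(LINT t:{s..b}|lborel. ?\<psi> t) = integral {s..b} ?\<psi>"
      by (rule set_borel_integral_eq_integral(2)[OF square_integrable_imp_integrable[OF
          h1_path_square_integrable[OF test_fun_h1_path[OF \<phi>]]]])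
    also have "\<dots> = \<phi> b - \<phi> s" using h1_pathD[OF test_fun_h1_path[OF \<phi>, of s b], of b] s by simp
    also have "\<phi> b = 0" using test_funD(3)[OF \<phi>, of b] by simp
    finally show ?thesis using s by simp
  qed (simp add: f_def V_def)
  have cz: "continuous_on {a..b} z" by (rule h1_path_continuous[OF z])
  have c\<psi>: "continuous_on {a..b} ?\<psi>" by (rule continuous_on_subset[OF cont]) simp
  have c\<phi>: "continuous_on {a..b} \<phi>" by (rule continuous_on_subset[OF cont\<phi>]) simp
  have "integral {a..b} (\<lambda>t. ?\<psi> t *\<^sub>R z t) - integral {a..b} ?\<psi> *\<^sub>R z a
      = integral {a..b} (\<lambda>t. ?\<psi> t *\<^sub>R (z t - z a))"
  proof -
    have "integral {a..b} (\<lambda>t. ?\<psi> t *\<^sub>R z a) = integral {a..b} ?\<psi> *\<^sub>R z a"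
      using integral_linear[OF integrable_continuous_real[OF c\<psi>] bounded_linear_scaleR_left[of "z a"]]
      by (simp add: o_def)
    moreover have "integral {a..b} (\<lambda>t. ?\<psi> t *\<^sub>R z t - ?\<psi> t *\<^sub>R z a)
        = integral {a..b} (\<lambda>t. ?\<psi> t *\<^sub>R z t) - integral {a..b} (\<lambda>t. ?\<psi> t *\<^sub>R z a)"
      by (intro integral_diff integrable_continuous_real continuous_intros c\<psi> cz)
    ultimately show ?thesis by (simp add: scaleR_diff_right)
  qed
  moreover have "integral {a..b} ?\<psi> = 0"
    using h1_pathD[OF test_fun_h1_path[OF \<phi>, of a b], of b] True test_funD(3)[OF \<phi>, of b] test_funD(3)[OF \<phi>, of a] by simp
  moreover have "integral {a..b} (\<lambda>t. ?\<psi> t *\<^sub>R (z t - z a)) = (LINT t|lborel. LINT s|lborel. f (t, s))"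
  proof -
    have "set_integrable lborel {a..b} (\<lambda>t. ?\<psi> t *\<^sub>R (z t - z a))"
      by (intro borel_integrable_compact[unfolded set_integrable_def[symmetric]] continuous_intros c\<psi> cz) simp
    then show ?thesis unfolding inner1 by (subst set_borel_integral_eq_integral(2)[symmetric]) (simp_all add: set_lebesgue_integral_def)
  qed
  moreover have "(LINT t|lborel. LINT s|lborel. f (t, s)) = (LINT s|lborel. LINT t|lborel. f (t, s))"
    using lborel_pair.Fubini_integral[of "\<lambda>t s. f (t, s)"] fi by simp
  moreover have "(LINT s|lborel. LINT t|lborel. f (t, s)) = - integral {a..b} (\<lambda>t. \<phi> t *\<^sub>R v t)"
  proof -
    have "bounded (\<phi> ` {a..b})" by (rule compact_imp_bounded[OF compact_continuous_image[OF c\<phi> compact_Icc]])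
    then obtain B where B: "\<And>t. t \<in> {a..b} \<Longrightarrow> \<bar>\<phi> t\<bar> \<le> B"
      unfolding bounded_iff real_norm_def by blast
    have "set_integrable lborel {a..b} (\<lambda>t. \<phi> t *\<^sub>R v t)"
    proof (rule set_integrable_le)
      show "set_integrable lborel {a..b} (\<lambda>t. B * norm (v t))"
        using square_integrable_imp_integrable[OF si] by (intro set_integrable_mult_right set_integrable_norm)
      show "norm (\<phi> t *\<^sub>R v t) \<le> B * norm (v t)" if "t \<in> {a..b}" for t
        using B[OF that] by (simp add: mult_right_mono)
    qed measurable
    then show ?thesis unfolding inner2
      by (subst set_borel_integral_eq_integral(2)[symmetric]) (simp_all add: set_lebesgue_integral_def)
  qed
  ultimately show ?thesis by simp
qed simp

text \<open>The primitive of \<open>\<xi>\<close> is constant on both sides of \<open>[c,d]\<close>, and the vanishing integral makes both constants zero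
  at once.\<close>
lemma ex_test_fun:
  fixes \<xi> :: "real \<Rightarrow> real"
  assumes cont: "continuous_on UNIV \<xi>" and ab: "a < c" "c \<le> d" "d < b"
    and zero: "\<And>t. t \<notin> {c<..<d} \<Longrightarrow> \<xi> t = 0" and int: "integral {a..b} \<xi> = 0"
  obtains \<phi> where "test_fun {a<..<b} \<phi>" "deriv \<phi> = \<xi>"
proof -
  have "\<exists>F. \<forall>x :: real. - \<infinity> < ereal x \<longrightarrow> ereal x < \<infinity> \<longrightarrow> (F has_vector_derivative \<xi> x) (at x)"
    using cont by (intro einterval_antiderivative) (auto simp: continuous_on_eq_continuous_at)
  then obtain F where F: "\<And>x. (F has_vector_derivative \<xi> x) (at x)" by auto
  define \<phi> where "\<phi> t = F t - F c" for t
  have ftc: "F t - F s = integral {s..t} \<xi>" if "s \<le> t" for s t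
    using integral_unique[OF fundamental_theorem_of_calculus[OF that has_vector_derivative_at_within[OF F]]] by simp
  have z: "integral {s..t} \<xi> = 0" if "t \<le> c \<or> d \<le> s" for s t
  proof -
    have "integral {s..t} \<xi> = integral {s..t} (\<lambda>_. 0)"
      by (rule integral_cong) (use zero that in auto)
    then show ?thesis by simp
  qed
  have low: "\<phi> t = 0" if "t \<le> c" for t using ftc[OF that] z[of c t] by (simp add: \<phi>_def)
  have up: "\<phi> t = 0" if "d \<le> t" for t
  proof -
    have "F t = F d" using ftc[OF that] z[of t d] by simp
    moreover have "F b = F d" using ftc[of d b] ab z[of b d] by simp
    moreover have "F b = F a" using ftc[of a b] ab int by simp
    moreover have "F c = F a" using ftc[of a c] ab z[of c a] by simp
    ultimately show ?thesis by (simp add: \<phi>_def)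
  qed
  have d\<phi>: "(\<phi> has_vector_derivative \<xi> t) (at t)" for t
    unfolding \<phi>_def by (auto intro!: derivative_eq_intros F)
  have sub: "closure {t. \<phi> t \<noteq> 0} \<subseteq> {c..d}"
  proof (rule closure_minimal)
    show "{t. \<phi> t \<noteq> 0} \<subseteq> {c..d}"
    proof
      fix t assume "t \<in> {t. \<phi> t \<noteq> 0}"
      then have "\<not> t \<le> c" "\<not> d \<le> t" using low up by blast+
      then show "t \<in> {c..d}" by simp
    qed
  qed simp
  have "compact (closure {t. \<phi> t \<noteq> 0})"
    using sub compact_Icc by (metis bounded_subset compact_eq_bounded_closed closed_closure)
  moreover have "\<phi> C1_differentiable_on UNIV"
    unfolding C1_differentiable_on_def using d\<phi> cont by blast
  moreover have "closure {t. \<phi> t \<noteq> 0} \<subseteq> {a<..<b}" using sub ab by force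
  ultimately have "test_fun {a<..<b} \<phi>" unfolding test_fun_def by blast
  moreover have "deriv \<phi> = \<xi>"
    using d\<phi> by (intro ext DERIV_imp_deriv) (simp add: has_real_derivative_iff_has_vector_derivative)
  ultimately show ?thesis using that by blast
qed

text \<open>Trapezoids supported in the open interval that increase to its indicator function. They are zero
  near the end points, so intervals touching the boundary of the domain need no special treatment.\<close>
definition plateau :: "real \<Rightarrow> real \<Rightarrow> nat \<Rightarrow> real \<Rightarrow> real" where
  "plateau c d n t = min 1 (max 0 (real n * min (t - c) (d - t) - 1))"

lemma plateau_continuous: "continuous_on S (plateau c d n)"
  unfolding plateau_def by (intro continuous_intros)

lemma plateau_bounds: "0 \<le> plateau c d n t" "plateau c d n t \<le> 1"
  by (auto simp: plateau_def)

lemma plateau_zero: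
  assumes "n > 0" "t \<notin> {c + 1 / real n<..<d - 1 / real n}" shows "plateau c d n t = 0"
proof -
  have "min (t - c) (d - t) \<le> 1 / real n" using assms by auto
  then have "real n * min (t - c) (d - t) \<le> 1" using assms(1) by (simp add: field_simps)
  then show ?thesis by (simp add: plateau_def)
qed

lemma plateau_tendsto: "(\<lambda>n. plateau c d n t) \<longlonglongrightarrow> indicator {c<..<d} t"
proof (cases "t \<in> {c<..<d}")
  case True
  then have m: "min (t - c) (d - t) > 0" by auto
  have "\<forall>\<^sub>F n in sequentially. real n \<ge> 2 / min (t - c) (d - t)"
    using filterlim_real_sequentially unfolding filterlim_at_top by blast
  then have "\<forall>\<^sub>F n in sequentially. plateau c d n t = 1"
  proof eventually_elim
    case (elim n)
    then have "real n * min (t - c) (d - t) \<ge> 2" using m by (simp add: pos_divide_le_eq)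
    then show ?case by (simp add: plateau_def)
  qed
  then show ?thesis using True by (simp add: tendsto_eventually)
next
  case False
  then have m: "min (t - c) (d - t) \<le> 0" by auto
  have "plateau c d n t = 0" for n
    using mult_nonneg_nonpos[OF _ m, of "real n"] by (simp add: plateau_def)
  then show ?thesis using False by simp
qed

lemma set_integrable_continuous_scaleR:
  fixes h :: "real \<Rightarrow> 'a::euclidean_space" and \<psi> :: "real \<Rightarrow> real"
  assumes \<psi>: "continuous_on UNIV \<psi>" and h: "set_integrable lborel {a..b} h" "h \<in> borel_measurable borel"
  shows "set_integrable lborel {a..b} (\<lambda>t. \<psi> t *\<^sub>R h t)"
proof -
  have "bounded (\<psi> ` {a..b})"
    by (rule compact_imp_bounded[OF compact_continuous_image[OF continuous_on_subset[OF \<psi> subset_UNIV] compact_Icc]])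
  then obtain B where B: "\<And>t. t \<in> {a..b} \<Longrightarrow> \<bar>\<psi> t\<bar> \<le> B" unfolding bounded_iff real_norm_def by blast
  have [measurable]: "\<psi> \<in> borel_measurable borel" by (rule borel_measurable_continuous_onI[OF \<psi>])
  show ?thesis
  proof (rule set_integrable_le)
    show "set_integrable lborel {a..b} (\<lambda>t. B * norm (h t))"
      using h(1) by (intro set_integrable_mult_right set_integrable_norm)
    show "norm (\<psi> t *\<^sub>R h t) \<le> B * norm (h t)" if "t \<in> {a..b}" for t
      using B[OF that] by (simp add: mult_right_mono)
  qed (use h(2) in measurable)
qed

text \<open>Subtracting a multiple of a fixed trapezoid turns any continuous \<open>\<psi>\<close> with compact support into the derivative of
  a test function. So \<open>\<integral> \<psi> h\<close> is proportional to \<open>\<integral> \<psi>\<close>, and trapezoids \<open>\<psi>\<close> tending to the indicator of \<open>[c,d]\<close> give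
  the claim. The conclusion is about integrals over intervals because this is the form in which it is used:
  it avoids statements almost everywhere.\<close>
lemma du_Bois_Reymond:
  fixes h :: "real \<Rightarrow> 'a::euclidean_space"
  assumes ab: "a < b" and h: "set_integrable lborel {a..b} h" "h \<in> borel_measurable borel"
    and weak: "\<And>\<phi>. test_fun {a<..<b} \<phi> \<Longrightarrow> integral {a..b} (\<lambda>t. deriv \<phi> t *\<^sub>R h t) = 0"
  shows "\<exists>k. \<forall>c d. a \<le> c \<longrightarrow> c \<le> d \<longrightarrow> d \<le> b \<longrightarrow> integral {c..d} h = (d - c) *\<^sub>R k"
proof -
  have int: "(\<lambda>t. \<psi> t *\<^sub>R h t) integrable_on {a..b}" if "continuous_on UNIV \<psi>" for \<psi> :: "real \<Rightarrow> real"
    using set_integrable_integrable_on[OF set_integrable_continuous_scaleR[OF that h]] by blast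
  have int1: "\<psi> integrable_on {a..b}" if "continuous_on UNIV \<psi>" for \<psi> :: "real \<Rightarrow> real"
    by (rule integrable_continuous_real[OF continuous_on_subset[OF that subset_UNIV]])
  obtain n0 :: nat where n0: "n0 > 0" "a + 1 / real n0 < b - 1 / real n0" "integral {a..b} (plateau a b n0) > 0"
  proof -
    have "(\<lambda>n. integral {a..b} (plateau a b n)) \<longlonglongrightarrow> integral {a..b} (indicator {a<..<b})"
    proof (rule dominated_convergence(2))
      show "(\<lambda>_. 1::real) integrable_on {a..b}" by (rule integrable_const_ivl)
      show "norm (plateau a b n t) \<le> 1" for n t using plateau_bounds[of a b n t] by simp
    qed (auto intro: int1 plateau_continuous plateau_tendsto)
    moreover have "integral {a..b} (indicator {a<..<b} :: real \<Rightarrow> real) = b - a"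
    proof -
      have "integral {a..b} (indicator {a<..<b} :: real \<Rightarrow> real) = integral {a<..<b} (indicator {a<..<b})"
        by (simp add: integral_open_interval_real)
      also have "\<dots> = integral {a<..<b} (\<lambda>_. 1)" by (rule integral_cong) simp
      finally show ?thesis using ab by (simp add: integral_open_interval_real[symmetric])
    qed
    ultimately have "\<forall>\<^sub>F n in sequentially. integral {a..b} (plateau a b n) > 0"
      using ab by (auto dest: order_tendstoD(1)[of _ _ _ 0])
    moreover have "\<forall>\<^sub>F n in sequentially. real n \<ge> 3 / (b - a)"
      using filterlim_real_sequentially unfolding filterlim_at_top by blast
    ultimately have "\<forall>\<^sub>F n in sequentially. integral {a..b} (plateau a b n) > 0 \<and> real n \<ge> 3 / (b - a) \<and> n > 0"
      using eventually_gt_at_top[of 0] by eventually_elim auto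
    then obtain n where n: "integral {a..b} (plateau a b n) > 0" "real n \<ge> 3 / (b - a)" "n > 0"
      using eventually_happens'[OF sequentially_bot] by blast
    have "real n * (b - a) \<ge> 3" using n(2) ab by (simp add: pos_divide_le_eq)
    then have "2 / real n < b - a" using n(3) by (simp add: pos_divide_less_eq mult.commute)
    moreover have "2 / real n = 1 / real n + 1 / real n" by simp
    ultimately have "a + 1 / real n < b - 1 / real n" by linarith
    then show ?thesis using that n by blast
  qed
  define p where "p = integral {a..b} (plateau a b n0)"
  define k where "k = (1 / p) *\<^sub>R integral {a..b} (\<lambda>t. plateau a b n0 t *\<^sub>R h t)"
  have p: "p > 0" using n0 by (simp add: p_def)
  have key: "integral {a..b} (\<lambda>t. \<psi> t *\<^sub>R h t) = integral {a..b} \<psi> *\<^sub>R k"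
    if \<psi>: "continuous_on UNIV \<psi>" and cd: "a < c" "c \<le> d" "d < b" and z: "\<And>t. t \<notin> {c<..<d} \<Longrightarrow> \<psi> t = 0" for \<psi> c d
  proof -
    define q where "q = integral {a..b} \<psi> / p"
    define \<xi> where "\<xi> = (\<lambda>t. \<psi> t - q * plateau a b n0 t)"
    have c\<xi>: "continuous_on UNIV \<xi>" unfolding \<xi>_def by (intro continuous_intros \<psi> plateau_continuous)
    have "integral {a..b} \<xi> = integral {a..b} \<psi> - q * p"
      unfolding \<xi>_def p_def
      by (subst integral_diff) (auto intro!: int1 \<psi> plateau_continuous continuous_intros)
    then have i0: "integral {a..b} \<xi> = 0" using p by (simp add: q_def)
    have z\<xi>: "\<xi> t = 0" if "t \<notin> {min c (a + 1 / real n0)<..<max d (b - 1 / real n0)}" for t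
    proof -
      have "\<psi> t = 0" by (rule z) (use that in auto)
      moreover have "plateau a b n0 t = 0" by (rule plateau_zero[OF n0(1)]) (use that in auto)
      ultimately show ?thesis by (simp add: \<xi>_def)
    qed
    obtain \<phi> where "test_fun {a<..<b} \<phi>" "deriv \<phi> = \<xi>"
      by (rule ex_test_fun[OF c\<xi> _ _ _ z\<xi> i0]) (use cd n0(1,2) in \<open>auto simp: min_def max_def\<close>)
    then have "0 = integral {a..b} (\<lambda>t. \<xi> t *\<^sub>R h t)" using weak by metis
    also have "\<dots> = integral {a..b} (\<lambda>t. \<psi> t *\<^sub>R h t - q *\<^sub>R (plateau a b n0 t *\<^sub>R h t))"
      by (simp add: \<xi>_def scaleR_diff_left)
    also have "\<dots> = integral {a..b} (\<lambda>t. \<psi> t *\<^sub>R h t) - q *\<^sub>R integral {a..b} (\<lambda>t. plateau a b n0 t *\<^sub>R h t)"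
      by (simp only: integral_diff[OF int[OF \<psi>] integrable_cmul[OF int[OF plateau_continuous]]] integral_cmul)
    also have "q *\<^sub>R integral {a..b} (\<lambda>t. plateau a b n0 t *\<^sub>R h t) = integral {a..b} \<psi> *\<^sub>R k"
      by (simp add: q_def k_def)
    finally show ?thesis by simp
  qed
  have "integral {c..d} h = (d - c) *\<^sub>R k" if cd: "a \<le> c" "c \<le> d" "d \<le> b" for c d
  proof -
    have e: "integral {a..b} (\<lambda>t. plateau c d n t *\<^sub>R h t) = integral {a..b} (plateau c d n) *\<^sub>R k" if "n > 0" for n
    proof (cases "c + 1 / real n \<le> d - 1 / real n")
      case True
      have "1 / real n > 0" using that by simp
      then have "a < c + 1 / real n" "d - 1 / real n < b" using cd by linarith+
      then show ?thesis by (intro key[OF plateau_continuous _ True _ plateau_zero[OF that]])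
    next
      case False
      then have "plateau c d n t = 0" for t using plateau_zero[OF that, of t c d] by auto
      then have "plateau c d n = (\<lambda>_. 0)" by auto
      then show ?thesis by simp
    qed
    have restrict: "integral {a..b} (\<lambda>t. indicator {c<..<d} t *\<^sub>R u t) = integral {c..d} u" for u :: "real \<Rightarrow> 'b::euclidean_space"
    proof -
      have "integral {a..b} (\<lambda>t. indicator {c<..<d} t *\<^sub>R u t) = integral {a..b} (\<lambda>t. if t \<in> {c<..<d} then u t else 0)"
        by (rule integral_cong) (auto simp: indicator_def)
      also have "\<dots> = integral ({c<..<d} \<inter> {a..b}) u" by (rule integral_restrict_Int)
      also have "{c<..<d} \<inter> {a..b} = {c<..<d}" using cd by auto
      finally show ?thesis by (simp add: integral_open_interval_real)
    qed
    have "(\<lambda>n. integral {a..b} (\<lambda>t. plateau c d n t *\<^sub>R h t)) \<longlonglongrightarrow> integral {a..b} (\<lambda>t. indicator {c<..<d} t *\<^sub>R h t)"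
    proof (rule dominated_convergence(2))
      show "(\<lambda>t. norm (h t)) integrable_on {a..b}"
        by (rule set_integrable_integrable_on[OF set_integrable_norm[OF h(1)] order_refl order_refl])
      show "norm (plateau c d n t *\<^sub>R h t) \<le> norm (h t)" for n t
        using plateau_bounds[of c d n t] by (simp add: mult_left_le_one_le)
    qed (auto intro: int plateau_continuous tendsto_scaleR plateau_tendsto)
    then have "(\<lambda>n. integral {a..b} (\<lambda>t. plateau c d n t *\<^sub>R h t)) \<longlonglongrightarrow> integral {c..d} h" unfolding restrict .
    moreover have "(\<lambda>n. integral {a..b} (\<lambda>t. plateau c d n t *\<^sub>R (1::real))) \<longlonglongrightarrow> integral {a..b} (\<lambda>t. indicator {c<..<d} t *\<^sub>R (1::real))"
    proof (rule dominated_convergence(2))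
      show "(\<lambda>_. 1::real) integrable_on {a..b}" by (rule integrable_const_ivl)
      show "norm (plateau c d n t *\<^sub>R (1::real)) \<le> 1" for n t using plateau_bounds[of c d n t] by simp
    qed (auto intro: int1 plateau_continuous plateau_tendsto)
    then have "(\<lambda>n. integral {a..b} (plateau c d n)) \<longlonglongrightarrow> d - c" unfolding restrict using cd by simp
    then have "(\<lambda>n. integral {a..b} (plateau c d n) *\<^sub>R k) \<longlonglongrightarrow> (d - c) *\<^sub>R k" by (intro tendsto_intros)
    moreover have "\<forall>\<^sub>F n in sequentially. integral {a..b} (\<lambda>t. plateau c d n t *\<^sub>R h t) = integral {a..b} (plateau c d n) *\<^sub>R k"
      using eventually_gt_at_top[of 0] by eventually_elim (rule e)
    then have "(\<lambda>n. integral {a..b} (\<lambda>t. plateau c d n t *\<^sub>R h t)) \<longlonglongrightarrow> (d - c) *\<^sub>R k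
       \<longleftrightarrow> (\<lambda>n. integral {a..b} (plateau c d n) *\<^sub>R k) \<longlonglongrightarrow> (d - c) *\<^sub>R k"
      by (rule tendsto_cong)
    ultimately show ?thesis using LIMSEQ_unique by blast
  qed
  then show ?thesis by blast
qed

lemma AE_zero_if_integrals_zero:
  fixes f :: "real \<Rightarrow> 'a::euclidean_space"
  assumes f: "integrable lborel f" and z: "\<And>a b. a \<le> b \<Longrightarrow> (LINT t:{a..b}|lborel. f t) = 0"
    and tot: "(LINT t|lborel. f t) = 0"
  shows "AE t in lborel. f t = 0"
proof (rule sigma_finite_measure.density_zero[OF sigma_finite_lborel f])
  have si: "set_integrable lborel A f" if "A \<in> sets borel" for A
    unfolding set_integrable_def by (rule integrable_mult_indicator[OF _ f]) (use that in simp)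
  fix A :: "real set" assume "A \<in> sets lborel"
  then have "A \<in> sets borel" by simp
  then show "(LINT t:A|lborel. f t) = 0"
  proof (induction rule: borel_set_induct)
    case empty
    show ?case by (simp add: set_lebesgue_integral_def)
  next
    case (interval a b)
    then show ?case by (rule z)
  next
    case (compl A)
    have "(LINT t:A \<union> - A|lborel. f t) = (LINT t:A|lborel. f t) + (LINT t:- A|lborel. f t)"
      by (rule set_integral_Un) (use compl si in auto)
    then show ?case using compl tot by (simp add: set_lebesgue_integral_def)
  next
    case (union F)
    have "(LINT t:(\<Union>i. F i)|lborel. f t) = (\<Sum>i. (LINT t:F i|lborel. f t))"
    proof (rule lebesgue_integral_countable_add)
      show "F i \<in> sets lborel" for i using union by simp
      show "i \<noteq> j \<Longrightarrow> F i \<inter> F j = {}" for i j using union(1) by (auto simp: disjoint_family_on_def)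
      show "set_integrable lborel (\<Union>i. F i) f" by (rule si) (use union in auto)
    qed
    then show ?case using union by simp
  qed
qed

lemma h1_path_velocity_unique:
  assumes v: "h1_path a b z v" and w: "h1_path a b z w"
  shows "AE t in lborel. t \<in> {a..b} \<longrightarrow> v t = w t"
proof -
  let ?d = "\<lambda>t. v t - w t"
  have si: "square_integrable a b ?d"
    by (rule square_integrable_diff[OF h1_path_square_integrable[OF v] h1_path_square_integrable[OF w]])
  have zero: "(LINT t:{c..d}|lborel. ?d t) = 0" if "a \<le> c" "d \<le> b" for c d
  proof (cases "c \<le> d")
    case True
    have sv: "square_integrable c d v" and sw: "square_integrable c d w"
      using square_integrable_subinterval[OF h1_path_square_integrable[OF v] that]
        square_integrable_subinterval[OF h1_path_square_integrable[OF w] that] by auto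
    have "(LINT t:{c..d}|lborel. ?d t) = integral {c..d} ?d"
      by (rule set_borel_integral_eq_integral(2)[OF square_integrable_imp_integrable[OF square_integrable_subinterval[OF si that]]])
    also have "\<dots> = integral {c..d} v - integral {c..d} w"
      by (rule integral_diff[OF square_integrable_integrable_on(1)[OF sv] square_integrable_integrable_on(1)[OF sw]])
    also have "\<dots> = 0" using h1_path_diff[OF v, of c d] h1_path_diff[OF w, of c d] that True by simp
    finally show ?thesis .
  qed (simp add: set_lebesgue_integral_def)
  have "AE t in lborel. indicator {a..b} t *\<^sub>R ?d t = 0"
  proof (rule AE_zero_if_integrals_zero)
    show "integrable lborel (\<lambda>t. indicator {a..b} t *\<^sub>R ?d t)"
      using square_integrable_imp_integrable[OF si] unfolding set_integrable_def .
    show "(LINT t|lborel. indicator {a..b} t *\<^sub>R ?d t) = 0"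
      using zero[of a b] by (simp add: set_lebesgue_integral_def)
    fix c d :: real
    have "(LINT t:{c..d}|lborel. indicator {a..b} t *\<^sub>R ?d t) = (LINT t:{max a c..min b d}|lborel. ?d t)"
      unfolding set_lebesgue_integral_def
      by (rule Bochner_Integration.integral_cong) (auto simp: indicator_def)
    then show "(LINT t:{c..d}|lborel. indicator {a..b} t *\<^sub>R ?d t) = 0" using zero by simp
  qed
  then show ?thesis by eventually_elim (auto simp: indicator_def split: if_splits)
qed

lemma set_integral_open_eq_integral:
  fixes f :: "real \<Rightarrow> 'a::euclidean_space"
  assumes "set_integrable lborel {a..b} f"
  shows "(LINT t:{a<..<b}|lborel. f t) = integral {a..b} f"
proof -
  have "set_integrable lborel {a<..<b} f" by (rule set_integrable_subset[OF assms]) auto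
  then have "(LINT t:{a<..<b}|lborel. f t) = integral {a<..<b} f" by (rule set_borel_integral_eq_integral(2))
  then show ?thesis by (simp add: integral_open_interval_real)
qed

lemma continuous_set_integrable:
  fixes f :: "real \<Rightarrow> 'a::euclidean_space"
  assumes "continuous_on {a..b} f" shows "set_integrable lborel {a..b} f"
  using borel_integrable_compact[OF compact_Icc assms] by (simp add: set_integrable_def)

lemma h1_path_L2_on:
  assumes "h1_path a b z v"
  shows "L2_on {a<..<b} z" "L2_on {a<..<b} v"
proof -
  have si: "square_integrable a b v" by (rule h1_path_square_integrable[OF assms])
  have c: "continuous_on {a..b} z" by (rule h1_path_continuous[OF assms])
  then have c': "continuous_on {a<..<b} z" by (rule continuous_on_subset) auto
  have "set_borel_measurable lborel {a<..<b} z"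
    unfolding set_borel_measurable_def using borel_measurable_continuous_on_indicator[OF _ c'] by simp
  moreover have "set_integrable lborel {a..b} (\<lambda>t. (norm (z t))\<^sup>2)"
    by (rule continuous_set_integrable) (intro continuous_intros c)
  then have "set_integrable lborel {a<..<b} (\<lambda>t. (norm (z t))\<^sup>2)"
    by (rule set_integrable_subset) auto
  ultimately show "L2_on {a<..<b} z" unfolding L2_on_def by blast
  have "set_integrable lborel {a<..<b} (\<lambda>t. (norm (v t))\<^sup>2)"
    by (rule set_integrable_subset[OF square_integrable_sq[OF si]]) auto
  moreover have "set_borel_measurable lborel {a<..<b} v"
    unfolding set_borel_measurable_def using square_integrable_measurable[OF si] by measurable
  ultimately show "L2_on {a<..<b} v" unfolding L2_on_def by blast
qed

lemma h1_path_weak_deriv: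
  assumes z: "h1_path a b z v"
  shows "has_L2_weak_deriv {a<..<b} z v"
  unfolding has_L2_weak_deriv_def
proof (intro conjI allI impI)
  show "L2_on {a<..<b} v" by (rule h1_path_L2_on[OF z])
  fix \<phi> assume \<phi>: "test_fun {a<..<b} \<phi>"
  have si: "square_integrable a b v" by (rule h1_path_square_integrable[OF z])
  have c: "continuous_on {a..b} z" by (rule h1_path_continuous[OF z])
  have cont\<phi>: "continuous_on UNIV \<phi>" by (rule test_fun_continuous[OF \<phi>])
  have "(LINT t:{a<..<b}|lborel. deriv \<phi> t *\<^sub>R z t) = integral {a..b} (\<lambda>t. deriv \<phi> t *\<^sub>R z t)"
    by (rule set_integral_open_eq_integral[OF continuous_set_integrable])
      (intro continuous_intros c continuous_on_subset[OF test_funD(2)[OF \<phi>] subset_UNIV])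
  also have "\<dots> = - integral {a..b} (\<lambda>t. \<phi> t *\<^sub>R v t)"
    by (rule integration_by_parts_h1[OF z \<phi>])
  also have "integral {a..b} (\<lambda>t. \<phi> t *\<^sub>R v t) = (LINT t:{a<..<b}|lborel. \<phi> t *\<^sub>R v t)"
    by (rule set_integral_open_eq_integral[symmetric, OF set_integrable_continuous_scaleR[OF cont\<phi>
          square_integrable_imp_integrable[OF si] square_integrable_measurable[OF si]]])
  finally show "(LINT t:{a<..<b}|lborel. deriv \<phi> t *\<^sub>R z t) = - (LINT t:{a<..<b}|lborel. \<phi> t *\<^sub>R v t)" .
qed

text \<open>By integration by parts the weak derivative of \<open>z - \<integral> v\<close> vanishes, so this continuous function is constant by
  the lemma of du Bois-Reymond.\<close>
lemma has_L2_weak_deriv_h1_path: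
  fixes z :: "real \<Rightarrow> 'a::euclidean_space"
  assumes ab: "a < b" and c: "continuous_on {a..b} z" and v: "has_L2_weak_deriv {a<..<b} z v"
  shows "h1_path a b z (\<lambda>t. indicator {a<..<b} t *\<^sub>R v t)"
proof -
  let ?v = "\<lambda>t. indicator {a<..<b} t *\<^sub>R v t"
  have L2: "set_borel_measurable lborel {a<..<b} v" "set_integrable lborel {a<..<b} (\<lambda>t. (norm (v t))\<^sup>2)"
    using v unfolding has_L2_weak_deriv_def L2_on_def by auto
  have si: "square_integrable a b ?v" unfolding square_integrable_def
  proof
    show "?v \<in> borel_measurable borel" using L2(1) unfolding set_borel_measurable_def by simp
    have "(\<lambda>t. indicator {a..b} t *\<^sub>R (norm (?v t))\<^sup>2) = (\<lambda>t. indicator {a<..<b} t *\<^sub>R (norm (v t))\<^sup>2)"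
      by (rule ext) (auto simp: indicator_def)
    then show "set_integrable lborel {a..b} (\<lambda>t. (norm (?v t))\<^sup>2)"
      using L2(2) unfolding set_integrable_def by simp
  qed
  define y where "y t = integral {a..t} ?v" for t
  have y: "h1_path a b y ?v" by (rule h1_pathI[OF si]) (simp add: y_def)
  have cy: "continuous_on {a..b} y" by (rule h1_path_continuous[OF y])
  have cd: "continuous_on {a..b} (\<lambda>t. z t - y t)" by (intro continuous_intros c cy)
  let ?h = "\<lambda>t. indicator {a..b} t *\<^sub>R (z t - y t)"
  have h_meas: "?h \<in> borel_measurable borel" by (rule borel_measurable_continuous_on_indicator[OF _ cd]) simp
  have h_int: "set_integrable lborel {a..b} ?h"
    using continuous_set_integrable[OF cd] unfolding set_integrable_def
    by (rule Bochner_Integration.integrable_cong[THEN iffD1, rotated 2]) (auto simp: indicator_def)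
  have "\<exists>k. \<forall>c d. a \<le> c \<longrightarrow> c \<le> d \<longrightarrow> d \<le> b \<longrightarrow> integral {c..d} ?h = (d - c) *\<^sub>R k"
  proof (rule du_Bois_Reymond[OF ab h_int h_meas])
    fix \<phi> assume \<phi>: "test_fun {a<..<b} \<phi>"
    have c\<phi>: "continuous_on {a..b} (deriv \<phi>)" by (rule continuous_on_subset[OF test_funD(2)[OF \<phi>] subset_UNIV])
    have cont\<phi>: "continuous_on UNIV \<phi>" by (rule test_fun_continuous[OF \<phi>])
    have "integral {a..b} (\<lambda>t. deriv \<phi> t *\<^sub>R ?h t) = integral {a..b} (\<lambda>t. deriv \<phi> t *\<^sub>R z t - deriv \<phi> t *\<^sub>R y t)"
      by (rule integral_cong) (simp add: scaleR_diff_right)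
    also have "\<dots> = integral {a..b} (\<lambda>t. deriv \<phi> t *\<^sub>R z t) - integral {a..b} (\<lambda>t. deriv \<phi> t *\<^sub>R y t)"
      by (intro integral_diff integrable_continuous_real continuous_intros c cy c\<phi>)
    also have "integral {a..b} (\<lambda>t. deriv \<phi> t *\<^sub>R z t) = (LINT t:{a<..<b}|lborel. deriv \<phi> t *\<^sub>R z t)"
      by (rule set_integral_open_eq_integral[symmetric, OF continuous_set_integrable]) (intro continuous_intros c c\<phi>)
    also have "\<dots> = - (LINT t:{a<..<b}|lborel. \<phi> t *\<^sub>R v t)"
      using v \<phi> unfolding has_L2_weak_deriv_def by blast
    also have "(LINT t:{a<..<b}|lborel. \<phi> t *\<^sub>R v t) = (LINT t:{a<..<b}|lborel. \<phi> t *\<^sub>R ?v t)"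
      unfolding set_lebesgue_integral_def
      by (rule Bochner_Integration.integral_cong) (auto simp: indicator_def)
    also have "\<dots> = integral {a..b} (\<lambda>t. \<phi> t *\<^sub>R ?v t)"
      by (rule set_integral_open_eq_integral[OF set_integrable_continuous_scaleR[OF cont\<phi>
          square_integrable_imp_integrable[OF si] square_integrable_measurable[OF si]]])
    also have "integral {a..b} (\<lambda>t. deriv \<phi> t *\<^sub>R y t) = - integral {a..b} (\<lambda>t. \<phi> t *\<^sub>R ?v t)"
      by (rule integration_by_parts_h1[OF y \<phi>])
    finally show "integral {a..b} (\<lambda>t. deriv \<phi> t *\<^sub>R ?h t) = 0" by simp
  qed
  then obtain k where k: "\<And>t. a \<le> t \<Longrightarrow> t \<le> b \<Longrightarrow> integral {a..t} ?h = (t - a) *\<^sub>R k" by (metis order_refl)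
  have const: "z t - y t = k" if t: "t \<in> {a..b}" for t
  proof (rule vector_derivative_unique_within_closed_interval[OF ab])
    show "t \<in> cbox a b" using t by simp
    show "((\<lambda>u. integral {a..u} (\<lambda>t. z t - y t)) has_vector_derivative (z t - y t)) (at t within cbox a b)"
      using integral_has_vector_derivative[OF cd t] by simp
    have "((\<lambda>u. (u - a) *\<^sub>R k) has_vector_derivative k) (at t within cbox a b)"
      by (auto intro!: derivative_eq_intros)
    moreover have "integral {a..u} (\<lambda>t. z t - y t) = (u - a) *\<^sub>R k" if "u \<in> cbox a b" for u
    proof -
      have "integral {a..u} (\<lambda>t. z t - y t) = integral {a..u} ?h"
        by (rule integral_cong) (use that in auto)
      then show ?thesis using k[of u] that by simp
    qed
    ultimately show "((\<lambda>u. integral {a..u} (\<lambda>t. z t - y t)) has_vector_derivative k) (at t within cbox a b)"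
      using has_vector_derivative_transform[of t "cbox a b" "\<lambda>u. integral {a..u} (\<lambda>t. z t - y t)" "\<lambda>u. (u - a) *\<^sub>R k" k] t by simp
  qed
  show ?thesis
  proof (rule h1_pathI[OF si])
    fix t assume "a \<le> t" "t \<le> b"
    then have "z t - y t = k" "z a - y a = k" using const ab by auto
    then show "z t = z a + integral {a..t} ?v" by (simp add: y_def algebra_simps)
  qed
qed

section \<open>Action functionals with a step field\<close>

lemma set_integrable_comp:
  fixes F :: "'a::euclidean_space \<Rightarrow> real"
  assumes x: "continuous_on {a..b::real} x" and F: "F \<in> borel_measurable borel"
    and K: "\<And>t. t \<in> {a..b} \<Longrightarrow> \<bar>F (x t)\<bar> \<le> K"
  shows "set_integrable lborel {a..b} (\<lambda>t. F (x t))"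
proof (cases "a \<le> b")
  case True
  let ?c = "\<lambda>t. max a (min b t)"
  have c: "?c t \<in> {a..b}" for t using True by auto
  have "continuous_on UNIV (\<lambda>t. x (?c t))"
    by (rule continuous_on_compose2[OF x]) (use c in \<open>auto intro!: continuous_intros\<close>)
  then have [measurable]: "(\<lambda>t. x (?c t)) \<in> borel_measurable borel"
    by (rule borel_measurable_continuous_onI)
  have "set_integrable lborel {a..b} (\<lambda>t. F (x (?c t)))"
  proof (rule set_integrable_le[OF set_integrable_const])
    show "norm (F (x (?c t))) \<le> K" for t using K[OF c] by simp
    show "(\<lambda>t. F (x (?c t))) \<in> borel_measurable borel"
      using F by measurable
  qed
  moreover have "x (?c t) = x t" if "t \<in> {a..b}" for t
  proof -
    have "?c t = t" using that by auto
    then show ?thesis by simp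
  qed
  ultimately show ?thesis by (subst set_integrable_cong[where f' = "\<lambda>t. F (x (?c t))"]) auto
qed (simp add: set_integrable_def)

text \<open>Fields that are homogeneous of degree 0 may jump at the origin, where the curves start, so pointwise bounds
  are only available in the open interval.\<close>
lemma integral_le_interior:
  fixes f h :: "real \<Rightarrow> real"
  assumes "f integrable_on {a..b}" "h integrable_on {a..b}" "\<And>t. a < t \<Longrightarrow> t < b \<Longrightarrow> f t \<le> h t"
  shows "integral {a..b} f \<le> integral {a..b} h"
proof -
  have "integral {a<..<b} f \<le> integral {a<..<b} h"
    using assms by (intro integral_le) (auto simp: integrable_on_open_interval_real)
  then show ?thesis by (simp add: integral_open_interval_real)
qed

definition action :: "('a::euclidean_space \<Rightarrow> 'a) \<Rightarrow> real \<Rightarrow> real \<Rightarrow> (real \<Rightarrow> 'a) \<Rightarrow> (real \<Rightarrow> 'a) \<Rightarrow> real" where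
  "action G a b x v = integral {a..b} (\<lambda>t. (norm (v t))\<^sup>2 + (norm (x t - G (x t)))\<^sup>2)"

locale step_field =
  fixes G :: "'a::euclidean_space \<Rightarrow> 'a"
  assumes measurable_G [measurable]: "G \<in> borel_measurable borel"
    and finite_range_G: "finite (range G)"
begin

lemma bound_G: obtains B where "B \<ge> 0" "\<And>x. norm (G x) \<le> B"
proof -
  have "bounded (range G)" using finite_range_G by (rule finite_imp_bounded)
  then show ?thesis using that unfolding bounded_pos by (metis less_imp_le rangeI)
qed

lemma set_integrable_potential:
  assumes x: "continuous_on {a..b::real} x"
  shows "set_integrable lborel {a..b} (\<lambda>t. (norm (x t - G (x t)))\<^sup>2)"
proof -
  obtain B where B: "\<And>x. norm (G x) \<le> B" using bound_G by blast
  have "bounded (x ` {a..b})" by (intro compact_imp_bounded compact_continuous_image x) auto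
  then obtain R where R: "\<And>t. t \<in> {a..b} \<Longrightarrow> norm (x t) \<le> R" unfolding bounded_iff by blast
  show ?thesis
  proof (rule set_integrable_comp[OF x, of "\<lambda>x. (norm (x - G x))\<^sup>2"])
    fix t assume "t \<in> {a..b}"
    then have "norm (x t - G (x t)) \<le> R + B" using norm_triangle_ineq4[of "x t" "G (x t)"] R B[of "x t"] by fastforce
    then show "\<bar>(norm (x t - G (x t)))\<^sup>2\<bar> \<le> (R + B)\<^sup>2" by (simp add: power_mono)
  qed measurable
qed

lemma set_integrable_action:
  assumes h: "h1_path a b x v"
  shows "set_integrable lborel {a..b} (\<lambda>t. (norm (v t))\<^sup>2 + (norm (x t - G (x t)))\<^sup>2)"
  by (rule set_integral_add(1)[OF square_integrable_sq[OF h1_path_square_integrable[OF h]]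
     set_integrable_potential[OF h1_path_continuous[OF h]]])

lemma integrable_potential:
  "continuous_on {a..b::real} x \<Longrightarrow> (\<lambda>t. (norm (x t - G (x t)))\<^sup>2) integrable_on {a..b}"
  by (rule set_integrable_integrable_on[OF set_integrable_potential order_refl order_refl])

lemma integrable_action:
  "h1_path a b x v \<Longrightarrow> (\<lambda>t. (norm (v t))\<^sup>2 + (norm (x t - G (x t)))\<^sup>2) integrable_on {a..b}"
  by (rule set_integrable_integrable_on[OF set_integrable_action order_refl order_refl])

lemma action_split:
  assumes h: "h1_path a b x v"
  shows "action G a b x v = integral {a..b} (\<lambda>t. (norm (v t))\<^sup>2) + integral {a..b} (\<lambda>t. (norm (x t - G (x t)))\<^sup>2)"
  unfolding action_def
  by (rule integral_add[OF square_integrable_integrable_on(2)[OF h1_path_square_integrable[OF h]]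
     integrable_potential[OF h1_path_continuous[OF h]]])

lemma action_combine:
  assumes h: "h1_path a b x v" and "a \<le> c" "c \<le> b"
  shows "action G a b x v = action G a c x v + action G c b x v"
  unfolding action_def using integrable_action[OF h] assms
  by (intro Henstock_Kurzweil_Integration.integral_combine[symmetric]) auto

lemma action_cong:
  assumes "\<And>t. a < t \<Longrightarrow> t < b \<Longrightarrow> x t = x' t" "\<And>t. a < t \<Longrightarrow> t < b \<Longrightarrow> v t = v' t"
  shows "action G a b x v = action G a b x' v'"
  unfolding action_def integral_open_interval_real[of a b]
  by (rule integral_cong) (use assms in auto)

lemma integrable_step_norm:
  assumes x: "continuous_on {a..b::real} x"
  shows "(\<lambda>t. (norm (G (x t)))\<^sup>2) integrable_on {a..b}"
proof -
  obtain B where B: "\<And>x. norm (G x) \<le> B" using bound_G by blast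
  have "set_integrable lborel {a..b} (\<lambda>t. (norm (G (x t)))\<^sup>2)"
  proof (rule set_integrable_comp[OF x, of "\<lambda>x. (norm (G x))\<^sup>2"])
    show "\<bar>(norm (G (x t)))\<^sup>2\<bar> \<le> B\<^sup>2" for t using B[of "x t"] by (simp add: power_mono)
  qed measurable
  then show ?thesis by (rule set_integrable_integrable_on[OF _ order_refl order_refl])
qed

text \<open>Near the origin the potential is the step function \<open>|G|\<^sup>2\<close> up to a term of first order. The step
  function carries all the information on orders, the other term only has to be estimated.\<close>
lemma potential_near_origin:
  assumes B: "\<And>x. norm (G x) \<le> B" and x: "norm x \<le> r"
  shows "\<bar>(norm (x - G x))\<^sup>2 - (norm (G x))\<^sup>2\<bar> \<le> (r + 2 * B) * norm x"
proof -
  have "(norm (x - G x))\<^sup>2 - (norm (G x))\<^sup>2 = norm x * norm x - 2 * (x \<bullet> G x)"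
    by (simp add: power2_norm_eq_inner inner_diff inner_commute flip: power2_eq_square)
  moreover have "\<bar>x \<bullet> G x\<bar> \<le> norm x * B"
    using Cauchy_Schwarz_ineq2[of x "G x"] B[of x] by (meson mult_left_mono norm_ge_zero order_trans)
  moreover have "norm x * norm x \<le> r * norm x" using x by (simp add: mult_right_mono)
  moreover have "0 \<le> norm x * norm x" by simp
  moreover have "(r + 2 * B) * norm x = r * norm x + 2 * (norm x * B)" by (simp add: algebra_simps)
  ultimately show ?thesis by linarith
qed

lemma action_affine_le:
  assumes B: "\<And>x. norm (G x) \<le> B" and ab: "a \<le> b" and h: "h1_path a b x (\<lambda>t. e)"
    and R: "\<And>t. a < t \<Longrightarrow> t < b \<Longrightarrow> norm (x t) \<le> R" "0 \<le> R" "R \<le> r"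
    and W: "\<And>t. a < t \<Longrightarrow> t < b \<Longrightarrow> (norm (G (x t)))\<^sup>2 \<le> m"
  shows "action G a b x (\<lambda>t. e) \<le> (b - a) * ((norm e)\<^sup>2 + m + (r + 2 * B) * R)"
proof -
  have B0: "B \<ge> 0" using B[of 0] norm_ge_zero order_trans by blast
  have "action G a b x (\<lambda>t. e) \<le> integral {a..b} (\<lambda>t. (norm e)\<^sup>2 + m + (r + 2 * B) * R)"
    unfolding action_def
  proof (rule integral_le_interior)
    show "(\<lambda>t. (norm e)\<^sup>2 + (norm (x t - G (x t)))\<^sup>2) integrable_on {a..b}"
      using integrable_action[OF h] .
    fix t assume t: "a < t" "t < b"
    have "(norm (x t - G (x t)))\<^sup>2 \<le> (norm (G (x t)))\<^sup>2 + (r + 2 * B) * norm (x t)"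
      using potential_near_origin[OF B, of "x t" r] R(1)[OF t] R(3) by linarith
    also have "(r + 2 * B) * norm (x t) \<le> (r + 2 * B) * R"
      using R(1)[OF t] R(2,3) B0 by (intro mult_left_mono) auto
    finally show "(norm e)\<^sup>2 + (norm (x t - G (x t)))\<^sup>2 \<le> (norm e)\<^sup>2 + m + (r + 2 * B) * R"
      using W[OF t] by linarith
  qed (rule integrable_const_ivl)
  then show ?thesis using ab by simp
qed

end

text \<open>The oscillation of \<open>Q\<close> between the scales \<open>s / 16\<close> and \<open>s\<close> is bounded by the fourth root of \<open>s\<close>, which is halved
  when \<open>s\<close> is divided by 16. So the oscillations sum up to a convergent geometric series.\<close>
lemma geometric_scale_limit:
  fixes Q :: "real \<Rightarrow> 'a::euclidean_space"
  assumes K: "K \<ge> 0" and \<tau>: "\<tau> > 0"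
    and near: "\<And>s s'. 0 < s \<Longrightarrow> s \<le> \<tau> \<Longrightarrow> s / 16 \<le> s' \<Longrightarrow> s' \<le> s \<Longrightarrow> norm (Q s - Q s') \<le> K * sqrt (sqrt s)"
  shows "\<exists>\<theta>. \<forall>s. 0 < s \<longrightarrow> s \<le> \<tau> \<longrightarrow> norm (Q s - \<theta>) \<le> 2 * K * sqrt (sqrt s)"
proof -
  have step: "norm (Q s - Q s') \<le> 2 * K * sqrt (sqrt s)"
    if "0 < s" "s \<le> \<tau>" "s / 16 ^ k \<le> s'" "s' \<le> s" for s s' k
    using that
  proof (induction k arbitrary: s)
    case 0
    then show ?case using K by auto
  next
    case (Suc k)
    show ?case
    proof (cases "s / 16 \<le> s'")
      case True
      then have "norm (Q s - Q s') \<le> K * sqrt (sqrt s)" using near Suc.prems by auto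
      also have "\<dots> \<le> 2 * K * sqrt (sqrt s)" using K Suc.prems by (simp add: mult_right_mono)
      finally show ?thesis .
    next
      case False
      have "norm (Q s - Q (s / 16)) \<le> K * sqrt (sqrt s)" using near[of s "s/16"] Suc.prems by auto
      moreover have "norm (Q (s/16) - Q s') \<le> 2 * K * sqrt (sqrt (s/16))"
        using False Suc.prems by (intro Suc.IH) (auto simp: field_simps)
      moreover have "sqrt (sqrt (s/16)) = sqrt (sqrt s) / 2"
      proof -
        have "sqrt 16 = 4" "sqrt 4 = 2" by (rule real_sqrt_unique; simp)+
        then show ?thesis by (simp add: real_sqrt_divide)
      qed
      ultimately show ?thesis using norm_triangle_ineq[of "Q s - Q (s/16)" "Q (s/16) - Q s'"] by simp
    qed
  qed
  have all: "norm (Q s - Q s') \<le> 2 * K * sqrt (sqrt s)" if "0 < s" "s \<le> \<tau>" "0 < s'" "s' \<le> s" for s s'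
  proof -
    obtain k where "s / s' < 16 ^ k" using real_arch_pow[of 16 "s / s'"] by auto
    then have "s / 16 ^ k \<le> s'" using that by (simp add: field_simps)
    then show ?thesis using step that by blast
  qed
  define q where "q n = Q (\<tau> / real (Suc n))" for n
  have "bounded (range q)"
  proof (rule boundedI)
    fix x assume "x \<in> range q"
    then obtain n where n: "x = q n" by auto
    have "norm (Q \<tau> - q n) \<le> 2 * K * sqrt (sqrt \<tau>)"
      unfolding q_def by (rule all) (use \<tau> in \<open>auto simp: field_simps\<close>)
    then show "norm x \<le> norm (Q \<tau>) + 2 * K * sqrt (sqrt \<tau>)"
      using norm_triangle_ineq4[of "Q \<tau>" "Q \<tau> - q n"] n by simp
  qed
  then obtain \<theta> r where r: "strict_mono (r :: nat \<Rightarrow> nat)" "(q \<circ> r) \<longlonglongrightarrow> \<theta>"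
    using bounded_imp_convergent_subsequence by blast
  have "norm (Q s - \<theta>) \<le> 2 * K * sqrt (sqrt s)" if s: "0 < s" "s \<le> \<tau>" for s
  proof (rule tendsto_upperbound)
    show "(\<lambda>n. norm (Q s - (q \<circ> r) n)) \<longlonglongrightarrow> norm (Q s - \<theta>)"
      by (intro tendsto_intros r)
    have "(\<lambda>n. \<tau> / real (Suc n)) \<longlonglongrightarrow> 0"
      by (rule LIMSEQ_Suc[OF lim_const_over_n])
    then have "\<forall>\<^sub>F n in sequentially. \<tau> / real (Suc n) < s"
      using s by (auto dest: order_tendstoD(2))
    then have "\<forall>\<^sub>F n in sequentially. \<tau> / real (Suc (r n)) < s"
      using eventually_subseq[OF r(1)] by blast
    then show "\<forall>\<^sub>F n in sequentially. norm (Q s - (q \<circ> r) n) \<le> 2 * K * sqrt (sqrt s)"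
      by eventually_elim (use s \<tau> in \<open>auto simp: q_def intro!: all\<close>)
  qed simp
  then show ?thesis by blast
qed

section \<open>One-sided germs of minimizers for conical fields\<close>

text \<open>An axiomatic version of \<open>y \<mapsto> g (x + y) - x\<close> for small \<open>y\<close>. The map \<open>P\<close> is the orthogonal projection to the
  span of the stratum of \<open>\<theta>\<close>. Points near \<open>\<theta>\<close> project into this stratum and the field there projects to
  its value at \<open>\<theta>\<close>, so \<open>|G|\<^sup>2\<close> does not decrease away from the stratum. The condition with \<open>a\<close> says that moving
  towards the ray of \<open>\<theta>\<close> without reaching it does not leave a stratum.\<close>
locale conical_field = step_field +
  assumes hom: "c > 0 \<Longrightarrow> G (c *\<^sub>R y) = G y"
    and local_projection: "\<exists>\<kappa>>0. \<exists>P. bounded_linear P \<and> (\<forall>v w. P v \<bullet> w = v \<bullet> P w) \<and> (\<forall>v. P (P v) = P v) \<and>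
      (\<forall>q. norm (q - \<theta>) < \<kappa> \<longrightarrow> P (G q) = G \<theta> \<and> G (P q) = G \<theta> \<and>
         (\<forall>a\<ge>0. G (a *\<^sub>R \<theta> + q) = G q) \<and> (G q = G \<theta> \<longrightarrow> P q = q))"
begin

abbreviation W :: "'a \<Rightarrow> real" where "W x \<equiv> (norm (G x))\<^sup>2"

lemma finite_range_W: "finite (range W)"
proof -
  have "range W = (\<lambda>p. (norm p)\<^sup>2) ` range G" by auto
  then show ?thesis using finite_range_G by simp
qed

lemma lowest_level:
  fixes y :: "real \<Rightarrow> 'a"
  obtains m where "\<forall>\<^sub>F t in at_right 0. W (y t) \<ge> m" "\<exists>\<^sub>F t in at_right 0. W (y t) = m"
proof -
  define F where "F = {m \<in> range W. \<exists>\<^sub>F t in at_right (0::real). W (y t) = m}"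
  have fin: "finite F" unfolding F_def using finite_range_W by simp
  have avoid: "\<forall>\<^sub>F t in at_right 0. W (y t) \<notin> S" if "S \<subseteq> range W" "S \<inter> F = {}" for S
  proof -
    have "\<forall>\<^sub>F t in at_right 0. \<forall>m\<in>S. W (y t) \<noteq> m"
      using that finite_subset[OF that(1) finite_range_W]
      by (intro eventually_ball_finite) (auto simp: F_def frequently_def)
    then show ?thesis by eventually_elim auto
  qed
  have "F \<noteq> {}"
  proof
    assume "F = {}"
    then have "\<forall>\<^sub>F t in at_right 0. W (y t) \<notin> range W" by (intro avoid) auto
    then show False by auto
  qed
  then have mem: "Min F \<in> F" using fin by simp
  have "\<forall>\<^sub>F t in at_right 0. W (y t) \<notin> {m \<in> range W. m < Min F}"
    by (rule avoid) (use fin in \<open>auto simp: not_less[symmetric] dest: Min_le\<close>)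
  then have "\<forall>\<^sub>F t in at_right 0. W (y t) \<ge> Min F"
    by eventually_elim (auto simp: not_less)
  then show ?thesis using that mem by (auto simp: F_def)
qed

lemma W_gap:
  obtains d where "d > 0" "\<And>x. W x > m \<Longrightarrow> W x \<ge> m + d" "\<And>x. W x < m \<Longrightarrow> W x \<le> m - d"
proof -
  obtain d where "d > 0" "\<And>p. p \<in> range W \<Longrightarrow> p \<noteq> m \<Longrightarrow> d \<le> dist m p"
    using finite_set_avoid[OF finite_range_W, of m] by blast
  then have "W x > m \<Longrightarrow> W x \<ge> m + d" "W x < m \<Longrightarrow> W x \<le> m - d" for x
    by (force simp: dist_real_def)+
  then show ?thesis using that \<open>d > 0\<close> by blast
qed

text \<open>The chord from \<open>0\<close> to \<open>y \<tau>\<close> stays in the stratum of \<open>y \<tau>\<close> and has the least kinetic energy. Hence what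
  a minimizer loses in kinetic energy it must gain in \<open>W\<close>, up to the first order error of
  the potential; this error is \<open>O(\<tau>\<^bsup>3/2\<^esup>)\<close> because \<open>|y t|\<^sup>2 \<le> t E\<close>.\<close>
lemma minimizer_against_chord:
  assumes B: "\<And>x. norm (G x) \<le> B"
    and \<tau>: "0 < \<tau>" and y: "h1_path 0 \<tau> y w" "y 0 = 0"
    and r: "\<And>t. t \<in> {0..\<tau>} \<Longrightarrow> norm (y t) < r"
    and E: "integral {0..\<tau>} (\<lambda>t. (norm (w t))\<^sup>2) \<le> E"
    and min: "\<And>x \<eta>. h1_path 0 \<tau> x \<eta> \<Longrightarrow> x 0 = 0 \<Longrightarrow> x \<tau> = y \<tau> \<Longrightarrow> (\<And>t. t \<in> {0..\<tau>} \<Longrightarrow> norm (x t) < r) \<Longrightarrow>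
      action G 0 \<tau> y w \<le> action G 0 \<tau> x \<eta>"
  shows "integral {0..\<tau>} (\<lambda>t. (norm (w t - y \<tau> /\<^sub>R \<tau>))\<^sup>2) + integral {0..\<tau>} (\<lambda>t. W (y t) - W (y \<tau>))
      \<le> 2 * (r + 2 * B) * sqrt E * \<tau> * sqrt \<tau>" (is ?chord)
    and "integral {0..\<tau>} (\<lambda>t. (norm (w t))\<^sup>2) + integral {0..\<tau>} (\<lambda>t. W (y t))
      - (r + 2 * B) * sqrt E * \<tau> * sqrt \<tau> \<le> action G 0 \<tau> y w" (is ?lower)
    and "integral {0..\<tau>} (\<lambda>t. (norm (w t - y \<tau> /\<^sub>R \<tau>))\<^sup>2) = integral {0..\<tau>} (\<lambda>t. (norm (w t))\<^sup>2) - \<tau> * (norm (y \<tau> /\<^sub>R \<tau>))\<^sup>2"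
      (is ?var)
proof -
  define q where "q = y \<tau> /\<^sub>R \<tau>"
  define C where "C = r + 2 * B"
  define R where "R = sqrt E * sqrt \<tau>"
  let ?K = "integral {0..\<tau>} (\<lambda>t. (norm (w t))\<^sup>2)"
  have si: "square_integrable 0 \<tau> w" by (rule h1_path_square_integrable[OF y(1)])
  have cont: "continuous_on {0..\<tau>} y" by (rule h1_path_continuous[OF y(1)])
  have B0: "B \<ge> 0" using B[of 0] norm_ge_zero order_trans by blast
  have r0: "r > 0" using r[of 0] \<tau> y(2) by simp
  have C0: "C > 0" using B0 r0 by (simp add: C_def)
  have E0: "E \<ge> 0" using E integral_nonneg[OF square_integrable_integrable_on(2)[OF si]] by fastforce
  have yR: "norm (y t) \<le> R" if t: "t \<in> {0..\<tau>}" for t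
  proof -
    have "(norm (y t))\<^sup>2 \<le> t * integral {0..t} (\<lambda>t. (norm (w t))\<^sup>2)"
      using h1_path_increment[OF y(1), of 0 t] t y(2) by simp
    also have "\<dots> \<le> \<tau> * E"
    proof (rule mult_mono)
      have "integral {0..t} (\<lambda>t. (norm (w t))\<^sup>2) \<le> ?K"
        using t by (intro integral_subset_le square_integrable_integrable_on(2)
            square_integrable_integrable_on(2)[OF si] square_integrable_subinterval[OF si]) auto
      then show "integral {0..t} (\<lambda>t. (norm (w t))\<^sup>2) \<le> E" using E by simp
      show "0 \<le> integral {0..t} (\<lambda>t. (norm (w t))\<^sup>2)"
        using t by (intro integral_nonneg square_integrable_integrable_on(2) square_integrable_subinterval[OF si]) auto
    qed (use t \<tau> in auto)
    finally have "sqrt ((norm (y t))\<^sup>2) \<le> sqrt (\<tau> * E)" by (rule real_sqrt_le_mono)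
    then show ?thesis by (simp add: R_def real_sqrt_mult mult.commute)
  qed
  have Wint: "(\<lambda>t. W (y t)) integrable_on {0..\<tau>}" by (rule integrable_step_norm[OF cont])
  have "integral {0..\<tau>} (\<lambda>t. W (y t) - C * R) \<le> integral {0..\<tau>} (\<lambda>t. (norm (y t - G (y t)))\<^sup>2)"
  proof (rule integral_le_interior)
    show "(\<lambda>t. W (y t) - C * R) integrable_on {0..\<tau>}" using Wint by (intro integrable_diff) auto
    show "(\<lambda>t. (norm (y t - G (y t)))\<^sup>2) integrable_on {0..\<tau>}" by (rule integrable_potential[OF cont])
    fix t assume "0 < t" "t < \<tau>"
    then have t: "t \<in> {0..\<tau>}" by auto
    have "\<bar>(norm (y t - G (y t)))\<^sup>2 - W (y t)\<bar> \<le> C * norm (y t)"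
      unfolding C_def by (rule potential_near_origin[OF B less_imp_le[OF r[OF t]]])
    also have "\<dots> \<le> C * R" using C0 yR[OF t] by (intro mult_left_mono) auto
    finally show "W (y t) - C * R \<le> (norm (y t - G (y t)))\<^sup>2" by linarith
  qed
  moreover have "integral {0..\<tau>} (\<lambda>t. W (y t) - C * R) = integral {0..\<tau>} (\<lambda>t. W (y t)) - C * R * \<tau>"
    using Wint \<tau> by (subst integral_diff) auto
  ultimately have lower: "?K + integral {0..\<tau>} (\<lambda>t. W (y t)) - C * R * \<tau> \<le> action G 0 \<tau> y w"
    using action_split[OF y(1)] by simp
  have CR: "C * R * \<tau> = (r + 2 * B) * sqrt E * \<tau> * sqrt \<tau>"
    by (simp add: C_def R_def)
  show ?lower using lower unfolding CR .
  have int_w: "integral {0..\<tau>} w = \<tau> *\<^sub>R q" using h1_path_diff[OF y(1), of 0 \<tau>] y(2) \<tau> by (simp add: q_def)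
  show var: ?var
    using integral_norm_diff_const[OF si, of q] \<tau> unfolding int_w q_def[symmetric]
    by (simp add: power2_norm_eq_inner)
  let ?x = "\<lambda>t. 0 + (t - 0) *\<^sub>R q"
  have \<tau>q: "\<tau> *\<^sub>R q = y \<tau>" using \<tau> by (simp add: q_def)
  have xnorm: "norm (?x t) \<le> norm (y \<tau>)" if "t \<in> {0..\<tau>}" for t
  proof -
    have "norm (?x t) \<le> norm (\<tau> *\<^sub>R q)" using that by (simp add: mult_right_mono)
    then show ?thesis unfolding \<tau>q .
  qed
  have \<tau>mem: "\<tau> \<in> {0..\<tau>}" using \<tau> by simp
  have "action G 0 \<tau> y w \<le> action G 0 \<tau> ?x (\<lambda>t. q)"
  proof (rule min[OF h1_path_affine])
    show "norm (?x t) < r" if "t \<in> {0..\<tau>}" for t using xnorm[OF that] r[OF \<tau>mem] by linarith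
  qed (use \<tau>q in auto)
  also have "\<dots> \<le> (\<tau> - 0) * ((norm q)\<^sup>2 + W (y \<tau>) + (r + 2 * B) * min R r)"
  proof (rule action_affine_le[OF B _ h1_path_affine])
    fix t assume t: "0 < t" "t < \<tau>"
    show "norm (?x t) \<le> min R r" using xnorm[of t] yR[OF \<tau>mem] r[OF \<tau>mem] t by auto
    have "G (?x t) = G (y \<tau>)" using hom[of t q] hom[of \<tau> q] t \<tau> \<tau>q by simp
    then show "W (?x t) \<le> W (y \<tau>)" by simp
  qed (use \<tau> r0 E0 in \<open>auto simp: R_def\<close>)
  also have "\<dots> \<le> \<tau> * ((norm q)\<^sup>2 + W (y \<tau>) + C * R)"
    unfolding diff_zero C_def[symmetric] using \<tau> C0 by (intro mult_left_mono add_left_mono) auto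
  finally have up: "action G 0 \<tau> y w \<le> \<tau> * ((norm q)\<^sup>2 + W (y \<tau>) + C * R)" .
  have "integral {0..\<tau>} (\<lambda>t. W (y t) - W (y \<tau>)) = integral {0..\<tau>} (\<lambda>t. W (y t)) - \<tau> * W (y \<tau>)"
    using Wint \<tau> by (subst integral_diff) auto
  moreover have "\<tau> * ((norm q)\<^sup>2 + W (y \<tau>) + C * R) = \<tau> * (norm q)\<^sup>2 + \<tau> * W (y \<tau>) + C * R * \<tau>"
    by (simp add: algebra_simps)
  ultimately have "integral {0..\<tau>} (\<lambda>t. (norm (w t - q))\<^sup>2) + integral {0..\<tau>} (\<lambda>t. W (y t) - W (y \<tau>))
      \<le> 2 * (C * R * \<tau>)"
    using up lower var unfolding q_def[symmetric] by linarith
  then show ?chord unfolding CR q_def by (simp only: mult.assoc)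
qed

text \<open>Times with \<open>W (y \<tau>) = m\<close>, where \<open>m\<close> is the smallest value taken at arbitrarily small times, are called
  good. The three steps of the proof are the convergence of \<open>Q t = y t / t\<close> to a direction \<open>\<theta>\<close>, the inequality
  \<open>W \<theta> \<ge> m\<close>, and the comparison with the projection to the span of the stratum of \<open>\<theta>\<close>.\<close>
lemma minimizer_germ:
  assumes \<epsilon>: "0 < \<epsilon>" and y: "h1_path 0 \<epsilon> y w" "y 0 = 0"
    and r: "\<And>t. t \<in> {0..\<epsilon>} \<Longrightarrow> norm (y t) < r"
    and min: "\<And>\<tau> x \<eta>. 0 < \<tau> \<Longrightarrow> \<tau> \<le> \<epsilon> \<Longrightarrow> h1_path 0 \<tau> x \<eta> \<Longrightarrow> x 0 = 0 \<Longrightarrow> x \<tau> = y \<tau> \<Longrightarrow>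
      (\<And>t. t \<in> {0..\<tau>} \<Longrightarrow> norm (x t) < r) \<Longrightarrow> action G 0 \<tau> y w \<le> action G 0 \<tau> x \<eta>"
  shows "\<exists>\<delta>>0. \<delta> \<le> \<epsilon> \<and> (\<forall>s\<in>{0<..\<delta>}. G (y s) = G (y \<delta>))"
proof -
  obtain B where B0: "B \<ge> 0" and B: "\<And>x. norm (G x) \<le> B" using bound_G by blast
  define C where "C = r + 2 * B"
  define E where "E = integral {0..\<epsilon>} (\<lambda>t. (norm (w t))\<^sup>2)"
  define C2 where "C2 = 2 * C * sqrt E"
  define Q where "Q s = y s /\<^sub>R s" for s
  have si: "square_integrable 0 \<epsilon> w" by (rule h1_path_square_integrable[OF y(1)])
  have r0: "r > 0" using r[of 0] \<epsilon> y(2) by simp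
  have C0: "C > 0" using B0 r0 by (simp add: C_def)
  have E0: "E \<ge> 0" unfolding E_def by (intro integral_nonneg square_integrable_integrable_on(2)[OF si]) auto
  have C20: "C2 \<ge> 0" using C0 E0 by (simp add: C2_def)
  have y': "h1_path 0 \<tau> y w" if "\<tau> \<le> \<epsilon>" for \<tau> using h1_path_subinterval[OF y(1)] that by simp
  have Wint: "(\<lambda>t. W (y t) - c) integrable_on {a..b}" if "0 \<le> a" "b \<le> \<epsilon>" for a b c
    using integrable_step_norm[OF h1_path_continuous[OF h1_path_subinterval[OF y(1) that]]]
    by (intro integrable_diff) auto
  have sq_diff_int: "(\<lambda>t. (norm (w t - e))\<^sup>2) integrable_on {0..\<tau>}" if "\<tau> \<le> \<epsilon>" for \<tau> e
    by (rule square_integrable_integrable_on(2)[OF square_integrable_diff[OF square_integrable_subinterval[OF si] square_integrable_const]])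
      (use that in auto)

  have chord: "integral {0..\<tau>} (\<lambda>t. (norm (w t - Q \<tau>))\<^sup>2) + integral {0..\<tau>} (\<lambda>t. W (y t) - W (y \<tau>)) \<le> C2 * \<tau> * sqrt \<tau>"
      (is "?chord \<tau>")
    and lower: "integral {0..\<tau>} (\<lambda>t. (norm (w t))\<^sup>2) + integral {0..\<tau>} (\<lambda>t. W (y t)) - C2 / 2 * \<tau> * sqrt \<tau>
      \<le> action G 0 \<tau> y w" (is "?lower \<tau>")
    and var: "integral {0..\<tau>} (\<lambda>t. (norm (w t - Q \<tau>))\<^sup>2) = integral {0..\<tau>} (\<lambda>t. (norm (w t))\<^sup>2) - \<tau> * (norm (Q \<tau>))\<^sup>2"
      (is "?var \<tau>")
    if \<tau>: "0 < \<tau>" "\<tau> \<le> \<epsilon>" for \<tau>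
  proof -
    have E: "integral {0..\<tau>} (\<lambda>t. (norm (w t))\<^sup>2) \<le> E"
      unfolding E_def using \<tau> by (intro integral_subset_le square_integrable_integrable_on(2)
            square_integrable_integrable_on(2)[OF si] square_integrable_subinterval[OF si]) auto
    have r': "norm (y t) < r" if "t \<in> {0..\<tau>}" for t using r that \<tau>(2) by auto
    note ch = minimizer_against_chord[OF B \<tau>(1) y'[OF \<tau>(2)] y(2) r' E]
    show "?chord \<tau>"
      unfolding Q_def C2_def C_def by (rule ch(1), assumption, rule min[OF \<tau>], assumption+)
    have "C2 / 2 = (r + 2 * B) * sqrt E" by (simp add: C2_def C_def)
    then show "?lower \<tau>"
      by (simp only:) (rule ch(2), assumption, rule min[OF \<tau>], assumption+)
    show "?var \<tau>"
      unfolding Q_def by (rule ch(3), assumption, rule min[OF \<tau>], assumption+)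
  qed

  obtain m where m: "\<forall>\<^sub>F t in at_right 0. W (y t) \<ge> m" "\<exists>\<^sub>F t in at_right 0. W (y t) = m"
    using lowest_level[of y] by blast
  obtain d where d: "d > 0" "\<And>x. W x > m \<Longrightarrow> W x \<ge> m + d" "\<And>x. W x < m \<Longrightarrow> W x \<le> m - d"
    using W_gap[of m] by metis
  obtain b where b: "b > 0" "\<And>t. 0 < t \<Longrightarrow> t < b \<Longrightarrow> W (y t) \<ge> m"
    using m(1) unfolding eventually_at_right_field by blast
  \<comment> \<open>the last bound makes the error \<open>C2 \<tau> sqrt \<tau>\<close> at most \<open>d \<tau> / 2\<close>, half of what it costs to stay
    above the level \<open>m\<close> during the whole of \<open>[0,\<tau>]\<close>\<close>
  define \<epsilon>1 where "\<epsilon>1 = min \<epsilon> (min (b/2) ((d / (2 * (C2 + 1)))\<^sup>2))"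
  have \<epsilon>1: "0 < \<epsilon>1" "\<epsilon>1 \<le> \<epsilon>" "\<epsilon>1 < b" "\<epsilon>1 \<le> (d / (2 * (C2 + 1)))\<^sup>2"
    using \<epsilon> b(1) d(1) C20 by (auto simp: \<epsilon>1_def)
  have small: "C2 * sqrt \<tau> \<le> d / 2" if "\<tau> \<le> \<epsilon>1" for \<tau>
  proof -
    have "sqrt \<tau> \<le> d / (2 * (C2 + 1))"
      using that \<epsilon>1(4) d(1) C20 by (intro real_le_lsqrt) auto
    then have "C2 * sqrt \<tau> \<le> C2 * (d / (2 * (C2 + 1)))" using C20 by (rule mult_left_mono)
    also have "\<dots> \<le> d / 2" using C20 d(1) by (simp add: field_simps)
    finally show ?thesis .
  qed
  define good where "good \<tau> \<longleftrightarrow> 0 < \<tau> \<and> \<tau> \<le> \<epsilon>1 \<and> W (y \<tau>) = m" for \<tau>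
  have ge_m: "W (y t) \<ge> m" if "0 < t" "t \<le> \<epsilon>1" for t using b(2)[of t] that \<epsilon>1 by auto
  have freq_good: "\<exists>\<^sub>F t in at_right 0. good t"
  proof -
    have "\<forall>\<^sub>F t in at_right 0. 0 < t \<and> t \<le> \<epsilon>1"
      unfolding eventually_at_right_field using \<epsilon>1(1) by (intro exI[of _ \<epsilon>1]) auto
    from frequently_eventually_conj[OF m(2) this] show ?thesis
      by (rule frequently_mono[rotated]) (auto simp: good_def)
  qed
  have W_nonneg: "0 \<le> integral {0..\<tau>} (\<lambda>t. W (y t) - m)" if "\<tau> \<le> \<epsilon>1" for \<tau>
  proof -
    have "integral {0..\<tau>} (\<lambda>t. 0) \<le> integral {0..\<tau>} (\<lambda>t. W (y t) - m)"
      by (rule integral_le_interior) (use that ge_m \<epsilon>1 in \<open>auto intro!: Wint\<close>)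
    then show ?thesis by simp
  qed
  have good_W: "integral {0..\<tau>} (\<lambda>t. W (y t) - m) \<le> C2 * \<tau> * sqrt \<tau>"
    and good_D: "integral {0..\<tau>} (\<lambda>t. (norm (w t - Q \<tau>))\<^sup>2) \<le> C2 * \<tau> * sqrt \<tau>" if "good \<tau>" for \<tau>
  proof -
    have \<tau>: "0 < \<tau>" "\<tau> \<le> \<epsilon>" "\<tau> \<le> \<epsilon>1" "W (y \<tau>) = m" using that \<epsilon>1 by (auto simp: good_def)
    have "0 \<le> integral {0..\<tau>} (\<lambda>t. (norm (w t - Q \<tau>))\<^sup>2)"
      by (intro integral_nonneg sq_diff_int \<tau>) auto
    then show "integral {0..\<tau>} (\<lambda>t. W (y t) - m) \<le> C2 * \<tau> * sqrt \<tau>"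
      and "integral {0..\<tau>} (\<lambda>t. (norm (w t - Q \<tau>))\<^sup>2) \<le> C2 * \<tau> * sqrt \<tau>"
      using chord[OF \<tau>(1,2)] W_nonneg[OF \<tau>(3)] unfolding \<tau>(4) by linarith+
  qed
  obtain \<tau>0 where \<tau>0: "good \<tau>0" using frequently_ex[OF freq_good] by blast
  have \<tau>0': "0 < \<tau>0" "\<tau>0 \<le> \<epsilon>1" "\<tau>0 \<le> \<epsilon>" using \<tau>0 \<epsilon>1 by (auto simp: good_def)

  \<comment> \<open>A gap from \<open>s\<close> to \<open>5 s\<close> without good times would lie in \<open>[0,\<tau>]\<close> for a good \<open>\<tau>\<close> just after
    the gap, and staying above level \<open>m\<close> during it would cost more than the error allows.\<close>
  have dense: "\<exists>\<tau>. good \<tau> \<and> s \<le> \<tau> \<and> \<tau> < 5 * s \<and> \<tau> \<le> \<tau>0" if s: "0 < s" "s \<le> \<tau>0" for s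
  proof (rule ccontr)
    assume none: "\<not> ?thesis"
    define S where "S = {\<tau>. good \<tau> \<and> s \<le> \<tau> \<and> \<tau> \<le> \<tau>0}"
    have ne: "S \<noteq> {}" using \<tau>0 s by (auto simp: S_def)
    have bdd: "bdd_below S" by (rule bdd_belowI[of _ s]) (auto simp: S_def)
    define \<sigma> where "\<sigma> = Inf S"
    have \<sigma>5: "5 * s \<le> \<sigma>" unfolding \<sigma>_def
      using none by (intro cInf_greatest[OF ne]) (auto simp: S_def not_less)
    have "Inf S < 3 / 2 * \<sigma>" using \<sigma>5 s by (simp add: \<sigma>_def)
    then obtain \<tau> where \<tau>: "\<tau> \<in> S" "\<tau> < 3 / 2 * \<sigma>" using cInf_lessD[OF ne] by blast
    have \<sigma>\<tau>: "\<sigma> \<le> \<tau>" unfolding \<sigma>_def by (rule cInf_lower[OF \<tau>(1) bdd])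
    have g\<tau>: "good \<tau>" "\<tau> \<le> \<epsilon>1" "\<tau> \<le> \<epsilon>" "0 < \<tau>" using \<tau> \<epsilon>1 by (auto simp: S_def good_def)
    have bad: "W (y t) - m \<ge> d" if t: "s < t" "t < \<sigma>" for t
    proof -
      have "\<not> good t"
      proof
        assume "good t"
        then have "t \<in> S" using t \<sigma>\<tau> \<tau> by (auto simp: S_def)
        then have "\<sigma> \<le> t" unfolding \<sigma>_def by (rule cInf_lower[OF _ bdd])
        then show False using t by simp
      qed
      then have "W (y t) \<noteq> m" using t s \<sigma>\<tau> g\<tau> by (auto simp: good_def)
      moreover have "W (y t) \<ge> m" using t s \<sigma>\<tau> g\<tau> by (intro ge_m) auto
      ultimately show ?thesis using d(2)[of "y t"] by linarith
    qed
    have "d * (\<sigma> - s) = integral {s..\<sigma>} (\<lambda>t. d)" using \<sigma>5 s by simp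
    also have "\<dots> \<le> integral {s..\<sigma>} (\<lambda>t. W (y t) - m)"
      by (rule integral_le_interior) (use s \<sigma>\<tau> g\<tau> bad in \<open>auto intro!: Wint\<close>)
    also have "\<dots> \<le> integral {0..\<tau>} (\<lambda>t. W (y t) - m)"
    proof -
      have "integral {s<..<\<sigma>} (\<lambda>t. W (y t) - m) \<le> integral {0<..<\<tau>} (\<lambda>t. W (y t) - m)"
        by (rule integral_subset_le)
          (use s \<sigma>\<tau> g\<tau> ge_m in \<open>auto intro!: Wint simp: integrable_on_open_interval_real\<close>)
      then show ?thesis by (simp add: integral_open_interval_real)
    qed
    also have "\<dots> \<le> (C2 * sqrt \<tau>) * \<tau>" using good_W[OF g\<tau>(1)] by (simp add: mult_ac)
    also have "\<dots> \<le> d / 2 * \<tau>" using small[OF g\<tau>(2)] g\<tau>(4) by (intro mult_right_mono) auto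
    also have "\<dots> \<le> d / 2 * (3 / 2 * \<sigma>)" using \<tau> d(1) by (intro mult_left_mono) auto
    finally have "d * (\<sigma> / 4) \<le> d * s" by (simp add: algebra_simps)
    then have "\<sigma> / 4 \<le> s" using d(1) by simp
    then show False using \<sigma>5 s by simp
  qed

  have near_good: "(norm (Q s - Q \<tau>))\<^sup>2 \<le> C2 * \<tau> * sqrt \<tau> / s" if g: "good \<tau>" and s: "0 < s" "s \<le> \<tau>" for s \<tau>
  proof -
    have \<tau>: "\<tau> \<le> \<epsilon>" using g \<epsilon>1 by (auto simp: good_def)
    have "h1_path 0 \<tau> (\<lambda>t. y t + (0 + (t - 0) *\<^sub>R (- Q \<tau>))) (\<lambda>t. w t + (- Q \<tau>))"
      by (intro h1_path_add y'[OF \<tau>] h1_path_affine)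
    from h1_path_increment[OF this, of 0 s] s y(2)
    have "(norm (y s - s *\<^sub>R Q \<tau>))\<^sup>2 \<le> s * integral {0..s} (\<lambda>t. (norm (w t - Q \<tau>))\<^sup>2)" by simp
    also have "\<dots> \<le> s * integral {0..\<tau>} (\<lambda>t. (norm (w t - Q \<tau>))\<^sup>2)"
      using s \<tau> by (intro mult_left_mono integral_subset_le sq_diff_int) auto
    also have "\<dots> \<le> s * (C2 * \<tau> * sqrt \<tau>)" using s good_D[OF g] by (intro mult_left_mono) auto
    finally have le: "(norm (y s - s *\<^sub>R Q \<tau>))\<^sup>2 \<le> s * (C2 * \<tau> * sqrt \<tau>)" .
    have "y s - s *\<^sub>R Q \<tau> = s *\<^sub>R (Q s - Q \<tau>)" using s by (simp add: Q_def scaleR_diff_right)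
    then have "s * (s * (norm (Q s - Q \<tau>))\<^sup>2) \<le> s * (C2 * \<tau> * sqrt \<tau>)"
      using le s by (simp add: power_mult_distrib power2_eq_square[of s] mult.assoc)
    then have "s * (norm (Q s - Q \<tau>))\<^sup>2 \<le> C2 * \<tau> * sqrt \<tau>" using s by simp
    then show ?thesis using s by (simp add: pos_le_divide_eq mult.commute)
  qed
  \<comment> \<open>If \<open>s / 16 \<le> u \<le> s \<le> \<tau> < 5 s\<close>, then \<open>\<tau> / u \<le> 80\<close> and \<open>sqrt \<tau> \<le> 3 sqrt s\<close>, and \<open>240 = 80 \<sqdot> 3\<close>.\<close>
  define K where "K = 2 * sqrt (240 * C2)"
  have K0: "K \<ge> 0" using C20 by (simp add: K_def)
  have "norm (Q s - Q s') \<le> K * sqrt (sqrt s)" if s: "0 < s" "s \<le> \<tau>0" "s / 16 \<le> s'" "s' \<le> s" for s s'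
  proof -
    obtain \<tau> where \<tau>: "good \<tau>" "s \<le> \<tau>" "\<tau> < 5 * s" using dense[OF s(1,2)] by blast
    have *: "norm (Q u - Q \<tau>) \<le> sqrt (240 * C2) * sqrt (sqrt s)" if u: "s / 16 \<le> u" "u \<le> s" for u
    proof -
      have u0: "0 < u" using u s by auto
      have \<tau>u: "\<tau> / u \<le> 80" using u \<tau> u0 by (simp add: pos_divide_le_eq)
      have "sqrt \<tau> \<le> sqrt (9 * s)" using \<tau> s by (intro real_sqrt_le_mono) auto
      then have sq: "sqrt \<tau> \<le> 3 * sqrt s" by (simp add: real_sqrt_mult)
      have "(norm (Q u - Q \<tau>))\<^sup>2 \<le> C2 * ((\<tau> / u) * sqrt \<tau>)"
        using near_good[OF \<tau>(1) u0] u \<tau> by simp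
      also have "\<dots> \<le> C2 * (80 * (3 * sqrt s))"
        using \<tau>u sq C20 u0 \<tau> s by (intro mult_left_mono mult_mono) auto
      finally have "(norm (Q u - Q \<tau>))\<^sup>2 \<le> (240 * C2) * sqrt s" by simp
      then have "norm (Q u - Q \<tau>) \<le> sqrt ((240 * C2) * sqrt s)" by (rule real_le_rsqrt)
      then show ?thesis by (simp add: real_sqrt_mult)
    qed
    have "norm (Q s - Q s') \<le> norm (Q s - Q \<tau>) + norm (Q s' - Q \<tau>)"
      by (metis norm_triangle_ineq4 diff_diff_eq2 diff_add_cancel)
    then show ?thesis using *[of s] *[of s'] s by (simp add: K_def)
  qed
  then obtain \<theta> where \<theta>: "\<And>s. 0 < s \<Longrightarrow> s \<le> \<tau>0 \<Longrightarrow> norm (Q s - \<theta>) \<le> 2 * K * sqrt (sqrt s)"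
    using geometric_scale_limit[OF K0 \<tau>0'(1), of Q] by blast
  have lim_Q: "((\<lambda>s. norm (Q s - \<theta>)) \<longlongrightarrow> 0) (at_right 0)"
  proof (rule tendsto_sandwich[where f = "\<lambda>_. 0" and h = "\<lambda>s. 2 * K * sqrt (sqrt s)"])
    show "\<forall>\<^sub>F s in at_right 0. norm (Q s - \<theta>) \<le> 2 * K * sqrt (sqrt s)"
      unfolding eventually_at_right_field using \<theta> \<tau>0' by (intro exI[of _ \<tau>0]) auto
    have "((\<lambda>s. 2 * K * sqrt (sqrt s)) \<longlongrightarrow> 2 * K * sqrt (sqrt 0)) (at_right 0)"
      by (intro tendsto_intros)
    then show "((\<lambda>s. 2 * K * sqrt (sqrt s)) \<longlongrightarrow> 0) (at_right 0)" by simp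
  qed auto
  obtain \<kappa> P where \<kappa>: "\<kappa> > 0" and P: "bounded_linear P" "\<And>v w. P v \<bullet> w = v \<bullet> P w" "\<And>v. P (P v) = P v"
    and loc: "\<And>q. norm (q - \<theta>) < \<kappa> \<Longrightarrow> P (G q) = G \<theta>" "\<And>q. norm (q - \<theta>) < \<kappa> \<Longrightarrow> G (P q) = G \<theta>"
      "\<And>q a. norm (q - \<theta>) < \<kappa> \<Longrightarrow> 0 \<le> a \<Longrightarrow> G (a *\<^sub>R \<theta> + q) = G q"
      "\<And>q. norm (q - \<theta>) < \<kappa> \<Longrightarrow> G q = G \<theta> \<Longrightarrow> P q = q"
    using local_projection[of \<theta>] by blast
  have ev_near: "\<forall>\<^sub>F s in at_right 0. norm (Q s - \<theta>) < \<kappa>"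
    using order_tendstoD(2)[OF lim_Q \<kappa>] .
  have GQ: "G (y s) = G (Q s)" if "s > 0" for s
    using hom[of "inverse s" "y s"] that by (simp add: Q_def)
  have sQ: "s *\<^sub>R Q s = y s" if "s > 0" for s using that by (simp add: Q_def)

  have level_\<theta>: "W \<theta> \<ge> m"
  proof (rule ccontr)
    assume "\<not> W \<theta> \<ge> m"
    then have low: "W \<theta> \<le> m - d" using d(3) by simp
    define R where "R \<tau> = \<tau> * (2 * norm \<theta> + 1)" for \<tau>
    have "((\<lambda>\<tau>. (norm (Q \<tau> - \<theta>))\<^sup>2 + C2 / 2 * sqrt \<tau> + C * R \<tau>) \<longlongrightarrow> 0\<^sup>2 + C2 / 2 * sqrt 0 + C * (0 * (2 * norm \<theta> + 1))) (at_right 0)"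
      unfolding R_def by (intro tendsto_intros lim_Q)
    then have "\<forall>\<^sub>F \<tau> in at_right 0. (norm (Q \<tau> - \<theta>))\<^sup>2 + C2 / 2 * sqrt \<tau> + C * R \<tau> < d / 2"
      using d(1) by (intro order_tendstoD(2)) auto
    moreover have "(R \<longlongrightarrow> 0 * (2 * norm \<theta> + 1)) (at_right 0)"
      unfolding R_def by (intro tendsto_intros)
    then have "\<forall>\<^sub>F \<tau> in at_right 0. R \<tau> < r" using r0 by (intro order_tendstoD(2)) auto
    moreover have "\<forall>\<^sub>F s in at_right 0. norm (Q s - \<theta>) < 1"
      using order_tendstoD(2)[OF lim_Q, of 1] by simp
    ultimately have "\<forall>\<^sub>F \<tau> in at_right 0. (norm (Q \<tau> - \<theta>))\<^sup>2 + C2 / 2 * sqrt \<tau> + C * R \<tau> < d / 2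
        \<and> R \<tau> < r \<and> norm (Q \<tau> - \<theta>) < 1 \<and> norm (Q \<tau> - \<theta>) < \<kappa>"
      using ev_near by eventually_elim auto
    from frequently_ex[OF frequently_eventually_conj[OF freq_good this]] obtain \<tau> where
      good\<tau>: "good \<tau>" and tiny: "(norm (Q \<tau> - \<theta>))\<^sup>2 + C2 / 2 * sqrt \<tau> + C * R \<tau> < d / 2"
      and Rr: "R \<tau> < r" and near1: "norm (Q \<tau> - \<theta>) < 1" and near: "norm (Q \<tau> - \<theta>) < \<kappa>" by blast
    have \<tau>: "0 < \<tau>" "\<tau> \<le> \<epsilon>" "\<tau> \<le> \<epsilon>1" "W (y \<tau>) = m" using good\<tau> \<epsilon>1 by (auto simp: good_def)
    define q where "q = Q \<tau>"
    have nq: "norm q \<le> norm \<theta> + 1"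
      using norm_triangle_ineq2[of q \<theta>] near1 by (simp add: q_def)
    \<comment> \<open>The competitor follows the ray of \<open>\<theta>\<close> and then goes straight to \<open>y \<tau>\<close>. Its kinetic energy
      exceeds that of the chord only by \<open>\<tau> |q - \<theta>|\<^sup>2\<close>, and it saves \<open>d \<tau> / 2\<close> on the ray.\<close>
    let ?x1 = "\<lambda>t. 0 + (t - 0) *\<^sub>R \<theta>" and ?x2 = "\<lambda>t. (\<tau>/2) *\<^sub>R \<theta> + (t - \<tau>/2) *\<^sub>R (2 *\<^sub>R q - \<theta>)"
    define x where "x = (\<lambda>t. if t \<le> \<tau>/2 then ?x1 t else ?x2 t)"
    define \<eta> where "\<eta> = (\<lambda>t. if t \<le> \<tau>/2 then \<theta> else 2 *\<^sub>R q - \<theta>)"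
    have hx: "h1_path 0 \<tau> x \<eta>" unfolding x_def \<eta>_def
      by (rule h1_path_If[OF h1_path_affine h1_path_affine]) (use \<tau> in auto)
    have x2: "?x2 t = (\<tau> - t) *\<^sub>R \<theta> + (2 * t - \<tau>) *\<^sub>R q" for t
    proof -
      have e: "\<tau> - t = \<tau>/2 - (t - \<tau>/2)" "2 * t - \<tau> = (t - \<tau>/2) * 2"
        by (simp_all add: field_simps)
      show ?thesis unfolding e
        by (simp only: scaleR_left_diff_distrib scaleR_right_diff_distrib scaleR_scaleR) simp
    qed
    have n1: "norm (?x1 t) \<le> R \<tau>" if "0 \<le> t" "t \<le> \<tau>/2" for t
    proof -
      have "norm (?x1 t) = t * norm \<theta>" using that by simp
      also have "\<dots> \<le> \<tau> * (2 * norm \<theta> + 1)" using that by (intro mult_mono) auto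
      finally show ?thesis by (simp add: R_def)
    qed
    have n2: "norm (?x2 t) \<le> R \<tau>" if "\<tau>/2 \<le> t" "t \<le> \<tau>" for t
    proof -
      have "norm (?x2 t) \<le> (\<tau> - t) * norm \<theta> + (2 * t - \<tau>) * norm q"
        unfolding x2 using norm_triangle_ineq[of "(\<tau> - t) *\<^sub>R \<theta>" "(2 * t - \<tau>) *\<^sub>R q"] that by simp
      also have "\<dots> \<le> \<tau> * norm \<theta> + \<tau> * (norm \<theta> + 1)"
        using that nq \<tau> by (intro add_mono mult_mono) auto
      finally show ?thesis by (simp add: R_def algebra_simps)
    qed
    have R0: "0 \<le> R \<tau>" using \<tau> by (simp add: R_def)
    have "action G 0 \<tau> y w \<le> action G 0 \<tau> x \<eta>"
    proof (rule min[OF \<tau>(1,2) hx])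
      show "x \<tau> = y \<tau>" using \<tau> sQ[OF \<tau>(1)] x2[of \<tau>] by (simp add: x_def q_def)
      show "norm (x t) < r" if "t \<in> {0..\<tau>}" for t
        using n1[of t] n2[of t] that Rr unfolding x_def by (cases "t \<le> \<tau>/2") auto
    qed (use \<tau> in \<open>simp add: x_def\<close>)
    also have "\<dots> = action G 0 (\<tau>/2) x \<eta> + action G (\<tau>/2) \<tau> x \<eta>"
      by (rule action_combine[OF hx]) (use \<tau> in auto)
    also have "action G 0 (\<tau>/2) x \<eta> = action G 0 (\<tau>/2) ?x1 (\<lambda>t. \<theta>)"
      by (rule action_cong) (auto simp: x_def \<eta>_def)
    also have "\<dots> \<le> (\<tau>/2 - 0) * ((norm \<theta>)\<^sup>2 + (m - d) + (r + 2 * B) * R \<tau>)"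
    proof (rule action_affine_le[OF B _ h1_path_affine])
      fix t assume t: "0 < t" "t < \<tau>/2"
      show "norm (?x1 t) \<le> R \<tau>" using n1 t by auto
      show "W (?x1 t) \<le> m - d" using low hom[OF t(1), of \<theta>] by simp
    qed (use \<tau> R0 Rr in auto)
    also have "action G (\<tau>/2) \<tau> x \<eta> = action G (\<tau>/2) \<tau> ?x2 (\<lambda>t. 2 *\<^sub>R q - \<theta>)"
      by (rule action_cong) (auto simp: x_def \<eta>_def)
    also have "\<dots> \<le> (\<tau> - \<tau>/2) * ((norm (2 *\<^sub>R q - \<theta>))\<^sup>2 + m + (r + 2 * B) * R \<tau>)"
    proof (rule action_affine_le[OF B _ h1_path_affine])
      fix t assume t: "\<tau>/2 < t" "t < \<tau>"
      show "norm (?x2 t) \<le> R \<tau>" using n2 t by auto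
      have c: "2 * t - \<tau> > 0" using t by simp
      have "?x2 t = (2 * t - \<tau>) *\<^sub>R (((\<tau> - t) / (2 * t - \<tau>)) *\<^sub>R \<theta> + q)"
        unfolding x2 using c by (simp add: scaleR_add_right)
      then have "G (?x2 t) = G (((\<tau> - t) / (2 * t - \<tau>)) *\<^sub>R \<theta> + q)" using hom[OF c] by simp
      also have "\<dots> = G q" using loc(3)[OF near] t c by (simp add: q_def)
      finally show "W (?x2 t) \<le> m" using \<tau>(4) GQ[OF \<tau>(1)] by (simp add: q_def)
    qed (use \<tau> R0 Rr in auto)
    finally have up: "action G 0 \<tau> y w \<le> \<tau>/2 * ((norm \<theta>)\<^sup>2 + (norm (2 *\<^sub>R q - \<theta>))\<^sup>2 + 2 * m - d + 2 * C * R \<tau>)"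
      by (simp add: C_def algebra_simps)
    have par: "(norm \<theta>)\<^sup>2 + (norm (2 *\<^sub>R q - \<theta>))\<^sup>2 = 2 * (norm q)\<^sup>2 + 2 * (norm (q - \<theta>))\<^sup>2"
      by (simp add: power2_norm_eq_inner inner_diff inner_commute algebra_simps)
    have "0 \<le> integral {0..\<tau>} (\<lambda>t. (norm (w t - Q \<tau>))\<^sup>2)"
      by (intro integral_nonneg sq_diff_int \<tau>) auto
    then have "\<tau> * (norm q)\<^sup>2 \<le> integral {0..\<tau>} (\<lambda>t. (norm (w t))\<^sup>2)" using var[OF \<tau>(1,2)] by (simp add: q_def)
    moreover have "\<tau> * m \<le> integral {0..\<tau>} (\<lambda>t. W (y t))"
    proof -
      have "(\<lambda>t. W (y t)) integrable_on {0..\<tau>}" using Wint[of 0 \<tau> 0] \<tau> by simp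
      then have "integral {0..\<tau>} (\<lambda>t. W (y t) - m) = integral {0..\<tau>} (\<lambda>t. W (y t)) - \<tau> * m"
        using \<tau> by (subst integral_diff) auto
      then show ?thesis using W_nonneg[OF \<tau>(3)] by simp
    qed
    ultimately have "\<tau> * (norm q)\<^sup>2 + \<tau> * m - C2 / 2 * \<tau> * sqrt \<tau> \<le> action G 0 \<tau> y w"
      using lower[OF \<tau>(1,2)] by linarith
    then have "\<tau> * (d / 2) \<le> \<tau> * ((norm (Q \<tau> - \<theta>))\<^sup>2 + C2 / 2 * sqrt \<tau> + C * R \<tau>)"
      using up unfolding par by (simp add: q_def algebra_simps)
    then have "d / 2 \<le> (norm (Q \<tau> - \<theta>))\<^sup>2 + C2 / 2 * sqrt \<tau> + C * R \<tau>" using \<tau> by simp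
    then show False using tiny by linarith
  qed

  obtain \<beta> where \<beta>: "\<beta> > 0" "\<And>s. 0 < s \<Longrightarrow> s < \<beta> \<Longrightarrow> norm (Q s - \<theta>) < \<kappa>"
    using ev_near unfolding eventually_at_right_field by blast
  have "\<forall>\<^sub>F s in at_right 0. s < \<beta>"
    unfolding eventually_at_right_field using \<beta>(1) by (intro exI[of _ \<beta>]) auto
  from frequently_ex[OF frequently_eventually_conj[OF freq_good this]]
  obtain \<delta> where good\<delta>: "good \<delta>" and \<delta>\<beta>: "\<delta> < \<beta>" by blast
  have \<delta>: "0 < \<delta>" "\<delta> \<le> \<epsilon>" "W (y \<delta>) = m" using good\<delta> \<epsilon>1 by (auto simp: good_def)
  have near: "norm (Q s - \<theta>) < \<kappa>" if "0 < s" "s \<le> \<delta>" for s using \<beta>(2) that \<delta>\<beta> by auto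
  interpret P: bounded_linear P by (rule P(1))
  have pyth: "(norm v)\<^sup>2 = (norm (P v))\<^sup>2 + (norm (v - P v))\<^sup>2" for v
  proof -
    have "P v \<bullet> P v = v \<bullet> P v" using P(2)[of v "P v"] P(3) by simp
    then show ?thesis by (simp add: power2_norm_eq_inner inner_diff inner_commute)
  qed
  have P_le: "norm (P v) \<le> norm v" for v
  proof (rule power2_le_imp_le)
    show "(norm (P v))\<^sup>2 \<le> (norm v)\<^sup>2" unfolding pyth[of v] by simp
  qed simp
  \<comment> \<open>equality of levels at \<open>\<delta>\<close> puts \<open>y \<delta>\<close> into the stratum of \<open>\<theta>\<close>, so the projected curve is a competitor\<close>
  have "W (Q \<delta>) = W \<theta> + (norm (G (Q \<delta>) - G \<theta>))\<^sup>2"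
    using pyth[of "G (Q \<delta>)"] loc(1)[OF near[of \<delta>]] \<delta> by simp
  then have "(norm (G (Q \<delta>) - G \<theta>))\<^sup>2 \<le> 0"
    using level_\<theta> \<delta>(3) unfolding GQ[OF \<delta>(1)] by linarith
  then have "G (Q \<delta>) = G \<theta>" by (simp add: power2_less_eq_zero_iff)
  then have PQ: "P (Q \<delta>) = Q \<delta>" using loc(4) near[of \<delta>] \<delta> by simp
  have Py: "P (y \<delta>) = y \<delta>" using sQ[OF \<delta>(1)] PQ P.scaleR[of \<delta> "Q \<delta>"] by simp
  have "G (y s) = G \<theta>" if s: "0 < s" "s \<le> \<delta>" for s
  proof -
    let ?D = "\<lambda>t. w t - P (w t)"
    have hP: "h1_path 0 \<delta> (\<lambda>t. P (y t)) (\<lambda>t. P (w t))"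
      by (rule h1_path_linear[OF P(1) y'[OF \<delta>(2)]])
    have hD: "h1_path 0 \<delta> (\<lambda>t. y t - P (y t)) ?D"
      by (rule h1_path_linear[OF bounded_linear_sub[OF bounded_linear_ident P(1)] y'[OF \<delta>(2)]])
    have "action G 0 \<delta> y w \<le> action G 0 \<delta> (\<lambda>t. P (y t)) (\<lambda>t. P (w t))"
    proof (rule min[OF \<delta>(1,2) hP])
      show "norm (P (y t)) < r" if "t \<in> {0..\<delta>}" for t
        using P_le[of "y t"] r[of t] that \<delta> by fastforce
    qed (use Py y(2) P.zero in auto)
    also have "\<dots> \<le> integral {0..\<delta>} (\<lambda>t. ((norm (w t))\<^sup>2 + (norm (y t - G (y t)))\<^sup>2) - (norm (?D t))\<^sup>2)"
      unfolding action_def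
    proof (rule integral_le_interior)
      show "(\<lambda>t. (norm (P (w t)))\<^sup>2 + (norm (P (y t) - G (P (y t))))\<^sup>2) integrable_on {0..\<delta>}"
        by (rule integrable_action[OF hP])
      show "(\<lambda>t. ((norm (w t))\<^sup>2 + (norm (y t - G (y t)))\<^sup>2) - (norm (?D t))\<^sup>2) integrable_on {0..\<delta>}"
        by (rule integrable_diff[OF integrable_action[OF y'[OF \<delta>(2)]]
            square_integrable_integrable_on(2)[OF h1_path_square_integrable[OF hD]]])
      fix t assume t: "0 < t" "t < \<delta>"
      have nt: "norm (Q t - \<theta>) < \<kappa>" using near t by auto
      have "P (y t) = t *\<^sub>R P (Q t)" using sQ[OF t(1)] P.scaleR[of t "Q t"] by simp
      then have "G (P (y t)) = G \<theta>" using hom[OF t(1)] loc(2)[OF nt] by simp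
      moreover have "P (y t - G (y t)) = P (y t) - G \<theta>" using GQ[OF t(1)] loc(1)[OF nt] by (simp add: P.diff)
      ultimately have "norm (P (y t) - G (P (y t))) \<le> norm (y t - G (y t))" using P_le[of "y t - G (y t)"] by simp
      then have "(norm (P (y t) - G (P (y t))))\<^sup>2 \<le> (norm (y t - G (y t)))\<^sup>2" by (simp add: power_mono)
      then show "(norm (P (w t)))\<^sup>2 + (norm (P (y t) - G (P (y t))))\<^sup>2
          \<le> ((norm (w t))\<^sup>2 + (norm (y t - G (y t)))\<^sup>2) - (norm (?D t))\<^sup>2"
        using pyth[of "w t"] by linarith
    qed
    also have "\<dots> = action G 0 \<delta> y w - integral {0..\<delta>} (\<lambda>t. (norm (?D t))\<^sup>2)"
      unfolding action_def by (rule integral_diff[OF integrable_action[OF y'[OF \<delta>(2)]]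
            square_integrable_integrable_on(2)[OF h1_path_square_integrable[OF hD]]])
    finally have D0: "integral {0..\<delta>} (\<lambda>t. (norm (?D t))\<^sup>2) \<le> 0" by simp
    have hDs: "square_integrable 0 s ?D"
      using square_integrable_subinterval[OF h1_path_square_integrable[OF hD]] s by simp
    have "(norm (y s - P (y s)))\<^sup>2 \<le> s * integral {0..s} (\<lambda>t. (norm (?D t))\<^sup>2)"
      using h1_path_increment[OF hD, of 0 s] s y(2) P.zero by simp
    also have "\<dots> \<le> s * integral {0..\<delta>} (\<lambda>t. (norm (?D t))\<^sup>2)"
      using s by (intro mult_left_mono integral_subset_le[OF _ square_integrable_integrable_on(2)[OF hDs]
          square_integrable_integrable_on(2)[OF h1_path_square_integrable[OF hD]]]) auto
    also have "\<dots> \<le> 0" using D0 s by (simp add: mult_nonneg_nonpos)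
    finally have "P (y s) = y s" by simp
    then have "P (Q s) = Q s" unfolding Q_def P.scaleR by simp
    then show ?thesis using GQ[OF s(1)] loc(2)[OF near[OF s]] by simp
  qed
  then show ?thesis using \<delta> by (intro exI[of _ \<delta>]) auto
qed

end

section \<open>Reduction to a conical field near a given configuration\<close>

lemma subspace_projection:
  fixes S :: "'a::euclidean_space set"
  assumes "subspace S"
  obtains P where "bounded_linear P" "\<And>v w. P v \<bullet> w = v \<bullet> P w" "\<And>v. P (P v) = P v"
    "\<And>v. P v \<in> S" "\<And>v. v \<in> S \<Longrightarrow> P v = v"
    "\<And>v p. p \<in> S \<Longrightarrow> (\<And>s. s \<in> S \<Longrightarrow> s \<bullet> v = s \<bullet> p) \<Longrightarrow> P v = p"
proof -
  obtain B where B: "B \<subseteq> S" "pairwise orthogonal B" "\<And>x. x \<in> B \<Longrightarrow> norm x = 1" "independent B" "span B = S"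
    using orthonormal_basis_subspace[OF assms] by metis
  have fin: "finite B" using B(4) by (rule independent_imp_finite)
  define P where "P v = (\<Sum>b\<in>B. (b \<bullet> v) *\<^sub>R b)" for v
  have lin: "bounded_linear P" unfolding P_def
    by (intro bounded_linear_sum bounded_linear_scaleR_const[OF bounded_linear_inner_right])
  have self: "P v \<bullet> w = v \<bullet> P w" for v w
    by (simp add: P_def inner_sum_left inner_sum_right inner_commute mult.commute)
  have PS: "P v \<in> S" for v
    unfolding P_def by (intro subspace_sum[OF assms] subspace_scale[OF assms]) (use B in auto)
  have Pb: "P b = b" if "b \<in> B" for b
  proof -
    have "P b = (\<Sum>c\<in>B. if c = b then b else 0)" unfolding P_def
    proof (rule sum.cong[OF refl])
      fix c assume "c \<in> B"
      then show "(c \<bullet> b) *\<^sub>R c = (if c = b then b else 0)"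
        using B(2,3) that by (auto simp: pairwise_def orthogonal_def norm_eq_1)
    qed
    then show ?thesis using that fin by simp
  qed
  have id: "P v = v" if "v \<in> S" for v
  proof (rule linear_eq_on[of P "\<lambda>x. x"])
    show "linear P" using lin by (simp add: linear_conv_bounded_linear)
    show "v \<in> span B" using that B by simp
  qed (auto simp: Pb linear_conv_bounded_linear bounded_linear_ident)
  have unique: "P v = p" if "p \<in> S" "\<And>s. s \<in> S \<Longrightarrow> s \<bullet> v = s \<bullet> p" for v p
  proof -
    have "w \<bullet> P v = w \<bullet> p" for w
      using that(2)[OF PS[of w]] self[of w v] self[of w p] id[OF that(1)] by simp
    then show ?thesis using vector_eq_ldot by blast
  qed
  show ?thesis using that[of P] lin self PS id unique by blast
qed

text \<open>The scaling keeps the point within distance \<open>\<rho>\<close> of \<open>x\<close> for every \<open>y\<close>. If \<open>\<rho>\<close> is small enough, then the order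
  of this point is lexicographic: by \<open>x\<close> first, ties being broken by \<open>y\<close>. Such an order does not change when
  \<open>y\<close> is multiplied by a positive number.\<close>
definition tangent_point :: "real ^ 'n \<Rightarrow> real \<Rightarrow> real ^ 'n \<Rightarrow> real ^ 'n" where
  "tangent_point x \<rho> y = x + (\<rho> / (2 * (1 + norm y))) *\<^sub>R y"

lemma (in increasing_vector) step_field_barycenter: "step_field g"
  by unfold_locales (auto simp: finite_range_barycenter)

locale order_neighbourhood = increasing_vector A for A :: "real ^ 'n::{finite,linorder}" +
  fixes x0 :: "real ^ 'n::{finite,linorder}" and \<rho> :: real
  assumes radius: "\<rho> > 0" "\<And>x. dist x0 x < \<rho> \<Longrightarrow> order_refines x x0"
begin

abbreviation pt :: "(real, 'n) vec \<Rightarrow> (real, 'n) vec" where "pt \<equiv> tangent_point x0 \<rho>"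

lemma add_less_iff:
  assumes "norm y < \<rho>"
  shows "(x0 + y) $ i < (x0 + y) $ j \<longleftrightarrow> x0 $ i < x0 $ j \<or> x0 $ i = x0 $ j \<and> y $ i < y $ j"
proof -
  have o: "order_refines (x0 + y) x0" using assms by (intro radius(2)) (simp add: dist_norm)
  show ?thesis
  proof (cases "x0 $ i" "x0 $ j" rule: linorder_cases)
    case less
    then have "(x0 + y) $ i < (x0 + y) $ j" using o unfolding order_refines_def by blast
    then show ?thesis using less by simp
  next
    case greater
    then have "(x0 + y) $ j < (x0 + y) $ i" using o unfolding order_refines_def by blast
    then show ?thesis using greater by simp
  qed simp
qed

lemma pt_less_iff: "pt y $ i < pt y $ j \<longleftrightarrow> x0 $ i < x0 $ j \<or> x0 $ i = x0 $ j \<and> y $ i < y $ j"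
proof -
  let ?c = "\<rho> / (2 * (1 + norm y))"
  have n: "1 + norm y > 0" by (simp add: add_pos_nonneg)
  then have c: "?c > 0" using radius(1) by simp
  have "norm (?c *\<^sub>R y) = ?c * norm y" by (simp only: norm_scaleR abs_of_pos[OF c])
  also have "\<dots> \<le> ?c * (1 + norm y)" using c by (intro mult_left_mono) auto
  also have "\<dots> = \<rho> / 2" using n by (simp add: field_simps)
  also have "\<dots> < \<rho>" using radius(1) by simp
  finally have "norm (?c *\<^sub>R y) < \<rho>" .
  from add_less_iff[OF this]
  show ?thesis unfolding tangent_point_def vector_scaleR_component real_scaleR_def mult_less_cancel_left_pos[OF c] .
qed

lemma pt_eq_iff: "pt y $ i = pt y $ j \<longleftrightarrow> x0 $ i = x0 $ j \<and> y $ i = y $ j"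
proof -
  have e: "u = v \<longleftrightarrow> \<not> u < v \<and> \<not> v < u" for u v :: real by auto
  show ?thesis unfolding e pt_less_iff by blast
qed

lemma pt_eq_add: "norm y < \<rho> \<Longrightarrow> g (pt y) = g (x0 + y)"
  by (simp only: barycenter_eq_iff pt_less_iff add_less_iff) blast

text \<open>For \<open>\<theta>\<close> the space to project to is the level space of the point belonging to \<open>\<theta>\<close>, that is, the vectors that
  are constant on the common ties of \<open>x0\<close> and \<open>\<theta>\<close>. It contains \<open>x0\<close>, so subtracting \<open>x0\<close> does
  no harm.\<close>
lemma conical_field_tangent: "conical_field (\<lambda>y. g (pt y) - x0)"
proof
  have [measurable]: "pt \<in> borel_measurable borel"
    unfolding tangent_point_def
    by (intro borel_measurable_continuous_onI continuous_intros) (smt (verit) norm_ge_zero)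
  show "(\<lambda>y. g (pt y) - x0) \<in> borel_measurable borel" by measurable
  have "range (\<lambda>y. g (pt y) - x0) \<subseteq> (\<lambda>p. p - x0) ` range g" by auto
  then show "finite (range (\<lambda>y. g (pt y) - x0))"
    using finite_range_barycenter by (auto intro: finite_subset)
  show "g (pt (c *\<^sub>R y)) - x0 = g (pt y) - x0" if "c > 0" for c y
  proof -
    have "g (pt (c *\<^sub>R y)) = g (pt y)"
      unfolding barycenter_eq_iff pt_less_iff using that by simp
    then show ?thesis by simp
  qed
  fix \<theta> :: "(real, 'n) vec"
  obtain \<kappa> where \<kappa>: "\<kappa> > 0" "\<And>q. q \<in> ball \<theta> \<kappa> \<Longrightarrow> order_refines q \<theta>"
    using order_refines_near[of \<theta>] by blast
  let ?L = "level_space (pt \<theta>)"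
  obtain P where P: "bounded_linear P" "\<And>v w. P v \<bullet> w = v \<bullet> P w" "\<And>v. P (P v) = P v"
    "\<And>v. P v \<in> ?L" "\<And>v. v \<in> ?L \<Longrightarrow> P v = v"
    "\<And>v p. p \<in> ?L \<Longrightarrow> (\<And>s. s \<in> ?L \<Longrightarrow> s \<bullet> v = s \<bullet> p) \<Longrightarrow> P v = p"
    using subspace_projection[OF subspace_level_space, of "pt \<theta>"] by blast
  interpret P: bounded_linear P by (rule P(1))
  have L_iff: "v \<in> ?L \<longleftrightarrow> (\<forall>i j. x0 $ i = x0 $ j \<and> \<theta> $ i = \<theta> $ j \<longrightarrow> v $ i = v $ j)" for v
    unfolding level_space_def mem_Collect_eq pt_eq_iff ..
  have x0L: "x0 \<in> ?L" and \<theta>L: "\<theta> \<in> ?L" unfolding L_iff by blast+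
  have P_le: "norm (P v) \<le> norm v" for v
  proof (cases "P v = 0")
    case False
    have "norm (P v) * norm (P v) = v \<bullet> P v" using P(2)[of v "P v"] P(3) by (metis norm_eq_square power2_norm_eq_inner power2_eq_square)
    also have "\<dots> \<le> norm v * norm (P v)" by (rule norm_cauchy_schwarz)
    finally show ?thesis using False by simp
  qed simp
  have near: "P (g (pt q) - x0) = g (pt \<theta>) - x0" "g (pt (P q)) - x0 = g (pt \<theta>) - x0"
      "\<forall>a\<ge>0. g (pt (a *\<^sub>R \<theta> + q)) - x0 = g (pt q) - x0" 
      "g (pt q) - x0 = g (pt \<theta>) - x0 \<longrightarrow> P q = q" if q: "norm (q - \<theta>) < \<kappa>" for q
  proof -
    have oq: "\<theta> $ i < \<theta> $ j \<Longrightarrow> q $ i < q $ j" for i j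
      using \<kappa>(2)[of q] q by (auto simp: dist_norm norm_minus_commute order_refines_def)
    have "order_refines (pt q) (pt \<theta>)"
      unfolding order_refines_def pt_less_iff using oq by blast
    then have "s \<bullet> g (pt q) = s \<bullet> g (pt \<theta>)" if "s \<in> ?L" for s
      using inner_barycenter_refines that by blast
    then have "P (g (pt q)) = g (pt \<theta>)" by (intro P(6) barycenter_level)
    then show "P (g (pt q) - x0) = g (pt \<theta>) - x0" using P(5)[OF x0L] by (simp add: P.diff)
    have "norm (P q - \<theta>) = norm (P (q - \<theta>))" using P(5)[OF \<theta>L] by (simp add: P.diff)
    also have "\<dots> < \<kappa>" using P_le[of "q - \<theta>"] q by linarith
    finally have oPq: "\<theta> $ i < \<theta> $ j \<Longrightarrow> P q $ i < P q $ j" for i j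
      using \<kappa>(2)[of "P q"] by (auto simp: dist_norm norm_minus_commute order_refines_def)
    have "g (pt (P q)) = g (pt \<theta>)"
    proof (rule barycenter_eqI)
      show "order_refines (pt (P q)) (pt \<theta>)"
        unfolding order_refines_def pt_less_iff using oPq by blast
      show "pt (P q) \<in> ?L" unfolding tangent_point_def
        by (intro subspace_add[OF subspace_level_space] subspace_scale[OF subspace_level_space] P(4)
            x0L[unfolded tangent_point_def])
          (use x0L P(4)[of q] in \<open>simp_all add: tangent_point_def\<close>)
    qed
    then show "g (pt (P q)) - x0 = g (pt \<theta>) - x0" by simp
    show "\<forall>a\<ge>0. g (pt (a *\<^sub>R \<theta> + q)) - x0 = g (pt q) - x0"
    proof (intro allI impI)
      fix a :: real assume a: "a \<ge> 0"
      have "(a *\<^sub>R \<theta> + q) $ i < (a *\<^sub>R \<theta> + q) $ j \<longleftrightarrow> q $ i < q $ j" for i j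
      proof (cases "\<theta> $ i" "\<theta> $ j" rule: linorder_cases)
        case less
        then have "a * \<theta> $ i \<le> a * \<theta> $ j" using a by (simp add: mult_left_mono)
        then show ?thesis using oq[OF less] by simp
      next
        case greater
        then have "a * \<theta> $ j \<le> a * \<theta> $ i" using a by (simp add: mult_left_mono)
        then show ?thesis using oq[OF greater] by simp
      qed simp
      then have "g (pt (a *\<^sub>R \<theta> + q)) = g (pt q)" unfolding barycenter_eq_iff pt_less_iff by blast
      then show "g (pt (a *\<^sub>R \<theta> + q)) - x0 = g (pt q) - x0" by simp
    qed
    show "g (pt q) - x0 = g (pt \<theta>) - x0 \<longrightarrow> P q = q"
    proof
      assume "g (pt q) - x0 = g (pt \<theta>) - x0"
      then have "g (pt q) = g (pt \<theta>)" by simp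
      then have "level_space (pt q) = ?L" by (rule barycenter_eq_level_space)
      moreover have "q \<in> level_space (pt q)" unfolding level_space_def mem_Collect_eq pt_eq_iff by blast
      ultimately show "P q = q" using P(5) by blast
    qed
  qed
  show "\<exists>\<kappa>>0. \<exists>P. bounded_linear P \<and> (\<forall>v w. P v \<bullet> w = v \<bullet> P w) \<and> (\<forall>v. P (P v) = P v) \<and>
      (\<forall>q. norm (q - \<theta>) < \<kappa> \<longrightarrow> P (g (pt q) - x0) = g (pt \<theta>) - x0 \<and> g (pt (P q)) - x0 = g (pt \<theta>) - x0 \<and>
         (\<forall>a\<ge>0. g (pt (a *\<^sub>R \<theta> + q)) - x0 = g (pt q) - x0) \<and> (g (pt q) - x0 = g (pt \<theta>) - x0 \<longrightarrow> P q = q))"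
    using \<kappa>(1) P(1-3) near by blast
qed

end

context increasing_vector begin

text \<open>The translated curve minimizes the action of the conical field only among curves that stay in the ball of
  radius \<open>\<rho>\<close>, which is all that \<open>minimizer_germ\<close> asks for.\<close>
lemma minimizer_eventually_constant:
  assumes \<epsilon>: "0 < \<epsilon>" and z: "h1_path 0 \<epsilon> z v"
    and min: "\<And>\<tau> x \<eta>. 0 < \<tau> \<Longrightarrow> \<tau> \<le> \<epsilon> \<Longrightarrow> h1_path 0 \<tau> x \<eta> \<Longrightarrow> x 0 = z 0 \<Longrightarrow> x \<tau> = z \<tau> \<Longrightarrow>
      action g 0 \<tau> z v \<le> action g 0 \<tau> x \<eta>"
  shows "\<exists>\<delta>>0. \<delta> \<le> \<epsilon> \<and> (\<forall>s\<in>{0<..\<delta>}. g (z s) = g (z \<delta>))"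
proof -
  define x0 where "x0 = z 0"
  obtain \<rho> where \<rho>: "\<rho> > 0" "\<And>x. x \<in> ball x0 \<rho> \<Longrightarrow> order_refines x x0"
    using order_refines_near[of x0] by blast
  interpret order_neighbourhood A x0 \<rho> by unfold_locales (use \<rho> in auto)
  interpret conical_field "\<lambda>y. g (pt y) - x0" by (rule conical_field_tangent)
  have "continuous_on {0..\<epsilon>} z" by (rule h1_path_continuous[OF z])
  then obtain \<epsilon>' where \<epsilon>': "0 < \<epsilon>'" "\<And>t. t \<in> {0..\<epsilon>} \<Longrightarrow> dist t 0 < \<epsilon>' \<Longrightarrow> dist (z t) (z 0) < \<rho>"
    using \<epsilon> \<rho>(1) unfolding continuous_on_iff by (metis atLeastAtMost_iff less_eq_real_def order_refl)
  define e where "e = min \<epsilon> (\<epsilon>' / 2)"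
  have e: "0 < e" "e \<le> \<epsilon>" "e < \<epsilon>'" using \<epsilon> \<epsilon>'(1) by (auto simp: e_def)
  define y where "y t = z t - x0" for t
  have small: "norm (y t) < \<rho>" if "t \<in> {0..e}" for t
    using \<epsilon>'(2)[of t] that e by (simp add: y_def x0_def dist_norm)
  have act: "action (\<lambda>y. g (pt y) - x0) 0 \<tau> x \<eta> = action g 0 \<tau> (\<lambda>t. x0 + x t) \<eta>"
    if "\<And>t. t \<in> {0..\<tau>} \<Longrightarrow> norm (x t) < \<rho>" for \<tau> x \<eta>
    unfolding action_def
  proof (rule integral_cong)
    fix t assume "t \<in> {0..\<tau>}"
    then have "g (pt (x t)) = g (x0 + x t)" using that pt_eq_add by blast
    then show "(norm (\<eta> t))\<^sup>2 + (norm (x t - (g (pt (x t)) - x0)))\<^sup>2 = (norm (\<eta> t))\<^sup>2 + (norm (x0 + x t - g (x0 + x t)))\<^sup>2"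
      by (simp add: algebra_simps)
  qed
  have shift: "h1_path 0 \<tau> (\<lambda>t. c + x t) \<eta>" if "h1_path 0 \<tau> x \<eta>" for \<tau> x \<eta> and c :: "(real, 'n) vec"
    using h1_path_add[OF h1_path_affine[of 0 \<tau> c 0] that] by simp
  have ye: "h1_path 0 e y v"
    using shift[OF h1_path_subinterval[OF z order_refl e(2)], of "- x0"] unfolding y_def by simp
  have "\<exists>\<delta>>0. \<delta> \<le> e \<and> (\<forall>s\<in>{0<..\<delta>}. g (pt (y s)) - x0 = g (pt (y \<delta>)) - x0)"
  proof (rule minimizer_germ[OF e(1) ye _ small])
    fix \<tau> x \<eta> assume a: "0 < \<tau>" "\<tau> \<le> e" "h1_path 0 \<tau> x \<eta>" "x 0 = 0" "x \<tau> = y \<tau>"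
      "\<And>t. t \<in> {0..\<tau>} \<Longrightarrow> norm (x t) < \<rho>"
    have z_eq: "z = (\<lambda>t. x0 + y t)" by (simp add: y_def fun_eq_iff)
    have "action (\<lambda>y. g (pt y) - x0) 0 \<tau> y v = action g 0 \<tau> z v"
      unfolding z_eq by (rule act, rule small) (use a(2) in simp)
    also have "\<dots> \<le> action g 0 \<tau> (\<lambda>t. x0 + x t) \<eta>"
    proof (rule min[OF a(1) _ shift[OF a(3)]])
      show "\<tau> \<le> \<epsilon>" using a(2) e(2) by simp
      show "x0 + x 0 = z 0" using a(4) by (simp add: x0_def)
      show "x0 + x \<tau> = z \<tau>" using a(5) by (simp add: y_def)
    qed
    also have "\<dots> = action (\<lambda>y. g (pt y) - x0) 0 \<tau> x \<eta>" by (rule act[OF a(6), symmetric])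
    finally show "action (\<lambda>y. g (pt y) - x0) 0 \<tau> y v \<le> action (\<lambda>y. g (pt y) - x0) 0 \<tau> x \<eta>" .
  qed (auto simp: y_def x0_def)
  then obtain \<delta> where \<delta>: "\<delta> > 0" "\<delta> \<le> e" "\<forall>s\<in>{0<..\<delta>}. g (pt (y s)) - x0 = g (pt (y \<delta>)) - x0" by blast
  have pty: "g (pt (y s)) = g (z s)" if "s \<in> {0<..\<delta>}" for s
  proof -
    have "s \<in> {0..e}" using that \<delta>(2) by simp
    from pt_eq_add[OF small[OF this]] show ?thesis by (simp add: y_def)
  qed
  have "g (z s) = g (z \<delta>)" if s: "s \<in> {0<..\<delta>}" for s
  proof -
    have d: "\<delta> \<in> {0<..\<delta>}" using \<delta>(1) by simp
    show ?thesis using bspec[OF \<delta>(3) s] unfolding pty[OF s] pty[OF d] by simp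
  qed
  then show ?thesis using \<delta>(1,2) e(2) by (meson order_trans)
qed

end

section \<open>Restriction, translation and reflection of minimizers\<close>

text \<open>Only translations and reflections occur, so one statement with \<open>\<kappa> = \<plusminus>1\<close> covers both.\<close>
lemma affine_substitution:
  fixes f :: "real \<Rightarrow> 'a::euclidean_space"
  assumes f: "set_integrable lborel {a..b} f" and \<kappa>: "\<kappa> = 1 \<or> \<kappa> = (-1::real)"
    and iff: "\<And>s. s \<in> {a'..b'} \<longleftrightarrow> c + \<kappa> * s \<in> {a..b}"
  shows "set_integrable lborel {a'..b'} (\<lambda>s. f (c + \<kappa> * s))"
    and "integral {a'..b'} (\<lambda>s. f (c + \<kappa> * s)) = integral {a..b} f"
proof -
  have ind: "indicator {a..b} (c + \<kappa> * s) = (indicator {a'..b'} s :: real)" for s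
    using iff[of s] by (simp only: indicator_def)
  show si: "set_integrable lborel {a'..b'} (\<lambda>s. f (c + \<kappa> * s))"
    using lborel_integrable_real_affine[OF f[unfolded set_integrable_def], of \<kappa> c] \<kappa>
    unfolding set_integrable_def ind by auto
  have "(LINT t:{a..b}|lborel. f t) = (LINT s:{a'..b'}|lborel. f (c + \<kappa> * s))"
    using lborel_integral_real_affine[of \<kappa> "\<lambda>t. indicator {a..b} t *\<^sub>R f t" c] \<kappa>
    unfolding set_lebesgue_integral_def ind by auto
  then show "integral {a'..b'} (\<lambda>s. f (c + \<kappa> * s)) = integral {a..b} f"
    using set_borel_integral_eq_integral(2)[OF f] set_borel_integral_eq_integral(2)[OF si] by simp
qed

lemma square_integrable_affine:
  assumes v: "square_integrable a b v" and \<kappa>: "\<kappa> = 1 \<or> \<kappa> = (-1::real)"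
    and iff: "\<And>s. s \<in> {a'..b'} \<longleftrightarrow> c + \<kappa> * s \<in> {a..b}"
  shows "square_integrable a' b' (\<lambda>s. \<kappa> *\<^sub>R v (c + \<kappa> * s))"
proof -
  have [measurable]: "v \<in> borel_measurable borel" by (rule square_integrable_measurable[OF v])
  have n: "norm (\<kappa> *\<^sub>R x) = norm x" for x :: 'a using \<kappa> by auto
  show ?thesis unfolding square_integrable_def n
    using affine_substitution(1)[OF square_integrable_sq[OF v] \<kappa> iff] by simp
qed

lemma h1_path_shift:
  assumes z: "h1_path a b z v"
  shows "h1_path (a - c) (b - c) (\<lambda>s. z (c + s)) (\<lambda>s. v (c + s))"
proof (rule h1_pathI)
  have si: "square_integrable a b v" by (rule h1_path_square_integrable[OF z])
  show "square_integrable (a - c) (b - c) (\<lambda>s. v (c + s))"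
  proof -
    have "s \<in> {a - c..b - c} \<longleftrightarrow> c + 1 * s \<in> {a..b}" for s by auto
    from square_integrable_affine[OF si _ this] show ?thesis by simp
  qed
  fix s assume s: "a - c \<le> s" "s \<le> b - c"
  have v: "square_integrable a (c + s) v" by (rule square_integrable_subinterval[OF si]) (use s in auto)
  have "u \<in> {a - c..s} \<longleftrightarrow> c + 1 * u \<in> {a..c + s}" for u by auto
  from affine_substitution(2)[OF square_integrable_imp_integrable[OF v] _ this]
  have "integral {a - c..s} (\<lambda>s. v (c + s)) = integral {a..c + s} v" by simp
  then show "z (c + s) = z (c + (a - c)) + integral {a - c..s} (\<lambda>s. v (c + s))"
    using h1_pathD[OF z, of "c + s"] s by simp
qed

lemma h1_path_reflect:
  assumes z: "h1_path a b z v"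
  shows "h1_path (c - b) (c - a) (\<lambda>s. z (c - s)) (\<lambda>s. - v (c - s))"
proof (rule h1_pathI)
  have si: "square_integrable a b v" by (rule h1_path_square_integrable[OF z])
  show "square_integrable (c - b) (c - a) (\<lambda>s. - v (c - s))"
  proof -
    have "s \<in> {c - b..c - a} \<longleftrightarrow> c + (- 1) * s \<in> {a..b}" for s by auto
    from square_integrable_affine[OF si _ this] show ?thesis by simp
  qed
  fix s assume s: "c - b \<le> s" "s \<le> c - a"
  have v: "square_integrable (c - s) b v" by (rule square_integrable_subinterval[OF si]) (use s in auto)
  have "u \<in> {c - b..s} \<longleftrightarrow> c + (- 1) * u \<in> {c - s..b}" for u by auto
  from affine_substitution(2)[OF square_integrable_imp_integrable[OF v] _ this]
  have "integral {c - b..s} (\<lambda>s. v (c - s)) = integral {c - s..b} v" by simp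
  also have "\<dots> = z b - z (c - s)" using h1_path_diff[OF z, of "c - s" b] s by simp
  finally show "z (c - s) = z (c - (c - b)) + integral {c - b..s} (\<lambda>s. - v (c - s))" by simp
qed

context step_field begin

lemma action_nonneg: "h1_path a b x v \<Longrightarrow> 0 \<le> action G a b x v"
  unfolding action_def by (rule Henstock_Kurzweil_Integration.integral_nonneg[OF integrable_action]) auto

lemma action_shift:
  assumes z: "h1_path a b z v"
  shows "action G (a - c) (b - c) (\<lambda>s. z (c + s)) (\<lambda>s. v (c + s)) = action G a b z v"
proof -
  have "s \<in> {a - c..b - c} \<longleftrightarrow> c + 1 * s \<in> {a..b}" for s by auto
  from affine_substitution(2)[OF set_integrable_action[OF z] _ this] show ?thesis by (simp add: action_def)
qed

lemma action_reflect:
  assumes z: "h1_path a b z v"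
  shows "action G (c - b) (c - a) (\<lambda>s. z (c - s)) (\<lambda>s. - v (c - s)) = action G a b z v"
proof -
  have "s \<in> {c - b..c - a} \<longleftrightarrow> c + (- 1) * s \<in> {a..b}" for s by auto
  from affine_substitution(2)[OF set_integrable_action[OF z] _ this] show ?thesis by (simp add: action_def)
qed

definition action_minimizer :: "real \<Rightarrow> real \<Rightarrow> (real \<Rightarrow> 'a) \<Rightarrow> (real \<Rightarrow> 'a) \<Rightarrow> bool" where
  "action_minimizer a b z v \<longleftrightarrow> h1_path a b z v \<and>
     (\<forall>x \<eta>. h1_path a b x \<eta> \<longrightarrow> x a = z a \<longrightarrow> x b = z b \<longrightarrow> action G a b z v \<le> action G a b x \<eta>)"

lemma action_minimizerD:
  "action_minimizer a b z v \<Longrightarrow> h1_path a b z v"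
  "action_minimizer a b z v \<Longrightarrow> h1_path a b x \<eta> \<Longrightarrow> x a = z a \<Longrightarrow> x b = z b \<Longrightarrow> action G a b z v \<le> action G a b x \<eta>"
  unfolding action_minimizer_def by blast+

text \<open>A competitor on \<open>[c,d]\<close> extends to \<open>[a,b]\<close> by \<open>z\<close>.\<close>
lemma action_minimizer_subinterval:
  assumes m: "action_minimizer a b z v" and cd: "a \<le> c" "c \<le> d" "d \<le> b"
  shows "action_minimizer c d z v"
  unfolding action_minimizer_def
proof (intro conjI allI impI)
  have z: "h1_path a b z v" by (rule action_minimizerD(1)[OF m])
  show "h1_path c d z v" by (rule h1_path_subinterval[OF z cd(1,3)])
  fix x \<eta> assume x: "h1_path c d x \<eta>" "x c = z c" "x d = z d"
  define y where "y = (\<lambda>t. if t \<le> d then (if t \<le> c then z t else x t) else z t)"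
  define w where "w = (\<lambda>t. if t \<le> d then (if t \<le> c then v t else \<eta> t) else v t)"
  have zac: "h1_path a c z v" by (rule h1_path_subinterval[OF z]) (use cd in auto)
  have zdb: "h1_path d b z v" by (rule h1_path_subinterval[OF z]) (use cd in auto)
  have "h1_path a d (\<lambda>t. if t \<le> c then z t else x t) (\<lambda>t. if t \<le> c then v t else \<eta> t)"
    by (rule h1_path_If[OF zac x(1)]) (use cd x in auto)
  then have y: "h1_path a b y w" unfolding y_def w_def
    by (rule h1_path_If[OF _ zdb]) (use cd x in auto)
  have "action G a c z v + action G c d z v + action G d b z v = action G a b z v"
    using action_combine[OF z, of c] action_combine[OF h1_path_subinterval[OF z, of c b], of d] cd by simp
  also have "\<dots> \<le> action G a b y w"
    by (rule action_minimizerD(2)[OF m y]) (use cd x in \<open>auto simp: y_def\<close>)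
  also have "\<dots> = action G a c y w + action G c d y w + action G d b y w"
    using action_combine[OF y, of c] action_combine[OF h1_path_subinterval[OF y, of c b], of d] cd by simp
  also have "action G a c y w = action G a c z v"
    by (rule action_cong) (use cd in \<open>auto simp: y_def w_def\<close>)
  also have "action G c d y w = action G c d x \<eta>"
    by (rule action_cong) (use cd in \<open>auto simp: y_def w_def\<close>)
  also have "action G d b y w = action G d b z v"
    by (rule action_cong) (use cd in \<open>auto simp: y_def w_def\<close>)
  finally show "action G c d z v \<le> action G c d x \<eta>" by simp
qed

lemma action_minimizer_shift:
  assumes m: "action_minimizer a b z v"
  shows "action_minimizer (a - c) (b - c) (\<lambda>s. z (c + s)) (\<lambda>s. v (c + s))"
  unfolding action_minimizer_def
proof (intro conjI allI impI)
  have z: "h1_path a b z v" by (rule action_minimizerD(1)[OF m])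
  show "h1_path (a - c) (b - c) (\<lambda>s. z (c + s)) (\<lambda>s. v (c + s))" by (rule h1_path_shift[OF z])
  fix x \<eta> assume x: "h1_path (a - c) (b - c) x \<eta>" "x (a - c) = z (c + (a - c))" "x (b - c) = z (c + (b - c))"
  have x': "h1_path a b (\<lambda>t. x (- c + t)) (\<lambda>t. \<eta> (- c + t))" using h1_path_shift[OF x(1), of "- c"] by simp
  have "action G a b z v \<le> action G a b (\<lambda>t. x (- c + t)) (\<lambda>t. \<eta> (- c + t))"
    by (rule action_minimizerD(2)[OF m x']) (use x in \<open>simp_all add: algebra_simps\<close>)
  also have "\<dots> = action G (a - c) (b - c) x \<eta>" using action_shift[OF x(1), of "- c"] by simp
  finally show "action G (a - c) (b - c) (\<lambda>s. z (c + s)) (\<lambda>s. v (c + s)) \<le> action G (a - c) (b - c) x \<eta>"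
    unfolding action_shift[OF z] .
qed

lemma action_minimizer_reflect:
  assumes m: "action_minimizer a b z v"
  shows "action_minimizer (c - b) (c - a) (\<lambda>s. z (c - s)) (\<lambda>s. - v (c - s))"
  unfolding action_minimizer_def
proof (intro conjI allI impI)
  have z: "h1_path a b z v" by (rule action_minimizerD(1)[OF m])
  show "h1_path (c - b) (c - a) (\<lambda>s. z (c - s)) (\<lambda>s. - v (c - s))" by (rule h1_path_reflect[OF z])
  fix x \<eta> assume x: "h1_path (c - b) (c - a) x \<eta>" "x (c - b) = z (c - (c - b))" "x (c - a) = z (c - (c - a))"
  have x': "h1_path a b (\<lambda>t. x (c - t)) (\<lambda>t. - \<eta> (c - t))" using h1_path_reflect[OF x(1), of c] by simp
  have "action G a b z v \<le> action G a b (\<lambda>t. x (c - t)) (\<lambda>t. - \<eta> (c - t))"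
    by (rule action_minimizerD(2)[OF m x']) (use x in simp_all)
  also have "\<dots> = action G (c - b) (c - a) x \<eta>" using action_reflect[OF x(1), of c] by simp
  finally show "action G (c - b) (c - a) (\<lambda>s. z (c - s)) (\<lambda>s. - v (c - s)) \<le> action G (c - b) (c - a) x \<eta>"
    unfolding action_reflect[OF z] .
qed

end

context increasing_vector begin

interpretation step_field g by (rule step_field_barycenter)

lemma minimizer_germ_right:
  assumes m: "action_minimizer a b Z v" and ab: "a < b"
  shows "\<exists>\<delta>>0. \<exists>c. \<forall>s. a < s \<longrightarrow> s < a + \<delta> \<longrightarrow> g (Z s) = c"
proof -
  have m': "action_minimizer 0 (b - a) (\<lambda>s. Z (a + s)) (\<lambda>s. v (a + s))"
    using action_minimizer_shift[OF m, of a] by simp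
  have "\<exists>\<delta>>0. \<delta> \<le> b - a \<and> (\<forall>s\<in>{0<..\<delta>}. g (Z (a + s)) = g (Z (a + \<delta>)))"
  proof (rule minimizer_eventually_constant[OF _ action_minimizerD(1)[OF m']])
    fix \<tau> x \<eta> assume "0 < \<tau>" "\<tau> \<le> b - a" and x: "h1_path 0 \<tau> x \<eta>" "x 0 = Z (a + 0)" "x \<tau> = Z (a + \<tau>)"
    then have "action_minimizer 0 \<tau> (\<lambda>s. Z (a + s)) (\<lambda>s. v (a + s))"
      by (intro action_minimizer_subinterval[OF m']) auto
    from action_minimizerD(2)[OF this x]
    show "action g 0 \<tau> (\<lambda>s. Z (a + s)) (\<lambda>s. v (a + s)) \<le> action g 0 \<tau> x \<eta>" .
  qed (use ab in simp)
  then obtain \<delta> where \<delta>: "\<delta> > 0" "\<forall>s\<in>{0<..\<delta>}. g (Z (a + s)) = g (Z (a + \<delta>))" by blast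
  have "g (Z s) = g (Z (a + \<delta>))" if "a < s" "s < a + \<delta>" for s
    using bspec[OF \<delta>(2), of "s - a"] that by simp
  then show ?thesis using \<delta>(1) by blast
qed

lemma minimizer_germ_left:
  assumes m: "action_minimizer a b Z v" and ab: "a < b"
  shows "\<exists>\<delta>>0. \<exists>c. \<forall>s. b - \<delta> < s \<longrightarrow> s < b \<longrightarrow> g (Z s) = c"
proof -
  have "action_minimizer 0 (b - a) (\<lambda>s. Z (b - s)) (\<lambda>s. - v (b - s))"
    using action_minimizer_reflect[OF m, of b] by simp
  from minimizer_germ_right[OF this] ab
  obtain \<delta> c where \<delta>: "\<delta> > 0" "\<And>s. 0 < s \<Longrightarrow> s < \<delta> \<Longrightarrow> g (Z (b - s)) = c" by auto
  have "g (Z s) = c" if "b - \<delta> < s" "s < b" for s using \<delta>(2)[of "b - s"] that by simp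
  then show ?thesis using \<delta>(1) by blast
qed

end

section \<open>Smoothness where the order is constant\<close>

lemma first_variation_zero:
  fixes \<alpha> \<beta> h0 :: real
  assumes h0: "h0 > 0" and nonneg: "\<And>h. \<bar>h\<bar> < h0 \<Longrightarrow> 0 \<le> 2 * h * \<alpha> + h\<^sup>2 * \<beta>"
  shows "\<alpha> = 0"
proof -
  have "((\<lambda>h. 2 * h * \<alpha> + h\<^sup>2 * \<beta>) has_real_derivative 2 * \<alpha>) (at 0)"
    by (auto intro!: derivative_eq_intros)
  then have "2 * \<alpha> = 0" by (rule DERIV_local_min[OF _ h0]) (use nonneg in auto)
  then show ?thesis by simp
qed

context increasing_vector begin

interpretation step_field g by (rule step_field_barycenter)

text \<open>The curve lies in the level space \<open>L\<close> of one of its points, and small perturbations within \<open>L\<close> that vanish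
  near the end points do not change the order. Along these the functional is quadratic, and its first
  variation gives \<open>\<integral> \<phi>' P v + \<phi> (Z - c) = 0\<close>, where \<open>P\<close> is the projection to \<open>L\<close>. With \<open>R\<close> a primitive of \<open>Z - c\<close> the lemma of
  du Bois-Reymond yields \<open>P v = R + k\<close>; so \<open>Z' = R + k\<close> and \<open>Z'' = Z - c\<close> on the closed interval.\<close>
lemma smooth_where_order_constant:
  assumes m: "action_minimizer a b Z v" and ab: "a < b"
    and const: "\<And>s. a < s \<Longrightarrow> s < b \<Longrightarrow> g (Z s) = c"
  shows "smooth_on {a..b} Z"
proof -
  have Zv: "h1_path a b Z v" by (rule action_minimizerD(1)[OF m])
  have cZ: "continuous_on {a..b} Z" by (rule h1_path_continuous[OF Zv])
  have siv: "square_integrable a b v" by (rule h1_path_square_integrable[OF Zv])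
  define xm where "xm = Z ((a + b) / 2)"
  have gxm: "g xm = c" using const[of "(a + b) / 2"] ab by (simp add: xm_def)
  let ?L = "level_space xm"
  have level: "level_space (Z s) = ?L" if "a < s" "s < b" for s
    using barycenter_eq_level_space const[OF that] gxm by simp
  obtain P where P: "bounded_linear P" "\<And>v w. P v \<bullet> w = v \<bullet> P w" "\<And>v. P (P v) = P v"
    "\<And>v. P v \<in> ?L" "\<And>v. v \<in> ?L \<Longrightarrow> P v = v"
    using subspace_projection[OF subspace_level_space, of xm] by metis
  interpret P: bounded_linear P by (rule P(1))
  have ZL: "Z s \<in> ?L" if "a < s" "s < b" for s
    using level_space_self[of "Z s"] level[OF that] by simp
  have cL: "c \<in> ?L" using barycenter_level[of xm] gxm by simp
  have PZ: "P (Z s) = Z s" if s: "s \<in> {a..b}" for s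
  proof -
    have cl: "closure {a<..<b} = {a..b}" using ab by (rule closure_greaterThanLessThan)
    have "continuous_on {a..b} (\<lambda>s. P (Z s) - Z s)"
      by (rule continuous_on_diff[OF P.continuous_on[OF cZ] cZ])
    then have cont: "continuous_on (closure {a<..<b}) (\<lambda>s. P (Z s) - Z s)" unfolding cl .
    have "P (Z s) - Z s = 0"
    proof (rule continuous_constant_on_closure[OF cont])
      show "P (Z u) - Z u = 0" if "u \<in> {a<..<b}" for u using P(5)[OF ZL[of u]] that by simp
      show "s \<in> closure {a<..<b}" using s unfolding cl .
    qed
    then show ?thesis by simp
  qed

  define U where "U t = indicator {a..b} t *\<^sub>R (Z t - c)" for t
  have cZc: "continuous_on {a..b} (\<lambda>t. Z t - c)" by (intro continuous_intros cZ)
  have U_meas: "U \<in> borel_measurable borel"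
    unfolding U_def by (rule borel_measurable_continuous_on_indicator[OF _ cZc]) simp
  have siU: "square_integrable a b U"
  proof -
    have "bounded ((\<lambda>t. Z t - c) ` {a..b})" by (rule compact_imp_bounded[OF compact_continuous_image[OF cZc compact_Icc]])
    then obtain B where B: "\<forall>t\<in>{a..b}. norm (Z t - c) \<le> B" unfolding bounded_iff by blast
    show ?thesis by (rule square_integrable_bounded[OF U_meas, of a b B]) (use B in \<open>simp add: U_def\<close>)
  qed
  define R where "R t = integral {a..t} U" for t
  have RU: "h1_path a b R U" by (rule h1_pathI[OF siU]) (simp add: R_def)
  have cR: "continuous_on {a..b} R" by (rule h1_path_continuous[OF RU])
  have siPv: "square_integrable a b (\<lambda>t. P (v t))" by (rule square_integrable_linear[OF P(1) siv])

  have weak: "integral {a..b} (\<lambda>t. deriv \<phi> t *\<^sub>R P (v t) + \<phi> t *\<^sub>R U t) = 0" if \<phi>: "test_fun {a<..<b} \<phi>" for \<phi>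
  proof -
    have path\<phi>: "h1_path a b \<phi> (deriv \<phi>)" by (rule test_fun_h1_path[OF \<phi>])
    have c\<phi>: "continuous_on {a..b} \<phi>" by (rule h1_path_continuous[OF path\<phi>])
    have cont\<phi>: "continuous_on UNIV \<phi>" by (rule test_fun_continuous[OF \<phi>])
    have int_full: "(\<lambda>t. deriv \<phi> t *\<^sub>R P (v t) + \<phi> t *\<^sub>R U t) integrable_on {a..b}"
      by (intro integrable_add set_integrable_integrable_on[of a b] set_integrable_continuous_scaleR
          test_funD(2)[OF \<phi>] cont\<phi> square_integrable_imp_integrable siPv siU square_integrable_measurable[OF siPv] U_meas order_refl)
    have "integral {a..b} (\<lambda>t. deriv \<phi> t *\<^sub>R P (v t) + \<phi> t *\<^sub>R U t) \<bullet> e = 0" for e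
    proof -
      define p where "p = P e"
      define K where "K = closure {t. \<phi> t \<noteq> 0}"
      have K: "compact K" "K \<subseteq> {a<..<b}" using \<phi> unfolding test_fun_def K_def by auto
      have outK: "\<phi> t = 0" if "t \<notin> K" for t using that closure_subset[of "{t. \<phi> t \<noteq> 0}"] unfolding K_def by blast
      have "K \<subseteq> {a..b}" using K(2) by auto
      then have "compact (Z ` K)" by (intro compact_continuous_image K continuous_on_subset[OF cZ])
      moreover have "Z ` K \<subseteq> {y. order_refines y xm}"
      proof
        fix y assume "y \<in> Z ` K"
        then obtain s where s: "s \<in> K" "y = Z s" by blast
        then have "a < s" "s < b" using K(2) by auto
        then have "g y = g xm" using const gxm s by simp
        then show "y \<in> {y. order_refines y xm}"
          unfolding barycenter_eq_iff order_refines_def by blast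
      qed
      ultimately obtain \<gamma> where \<gamma>: "\<gamma> > 0" "(\<Union>x\<in>Z ` K. ball x \<gamma>) \<subseteq> {y. order_refines y xm}"
        using compact_subset_open_imp_ball_epsilon_subset[OF _ open_order_refines] by metis
      have "bounded (\<phi> ` {a..b})" by (rule compact_imp_bounded[OF compact_continuous_image[OF c\<phi> compact_Icc]])
      then obtain B where B: "\<forall>t\<in>{a..b}. \<bar>\<phi> t\<bar> \<le> B" unfolding bounded_iff real_norm_def by blast
      \<comment> \<open>for \<open>|h| < h0\<close> the perturbation is shorter than \<open>\<gamma>\<close> and so does not reverse a strict inequality\<close>
      define h0 where "h0 = \<gamma> / (\<bar>B\<bar> * norm p + 1)"
      have den: "\<bar>B\<bar> * norm p + 1 > 0" by (intro add_nonneg_pos mult_nonneg_nonneg) auto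
      have h0: "h0 > 0" using \<gamma>(1) den by (simp add: h0_def)
      have stay: "g (Z s + (h * \<phi> s) *\<^sub>R p) = c" if h: "\<bar>h\<bar> < h0" and s: "a < s" "s < b" for h s
      proof (cases "s \<in> K")
        case True
        have "\<bar>\<phi> s\<bar> \<le> \<bar>B\<bar>" using bspec[OF B, of s] s by simp
        then have "\<bar>h\<bar> * (\<bar>\<phi> s\<bar> * norm p) \<le> \<bar>h\<bar> * (\<bar>B\<bar> * norm p + 1)"
          by (intro mult_left_mono) (simp_all add: mult_right_mono add_increasing2)
        also have "\<dots> < \<gamma>" using h den by (simp add: h0_def pos_less_divide_eq)
        finally have "norm ((h * \<phi> s) *\<^sub>R p) < \<gamma>" by (simp add: abs_mult mult.assoc)
        then have "Z s + (h * \<phi> s) *\<^sub>R p \<in> ball (Z s) \<gamma>" by (simp add: dist_norm)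
        then have "order_refines (Z s + (h * \<phi> s) *\<^sub>R p) xm" using \<gamma>(2) True by blast
        moreover have "Z s + (h * \<phi> s) *\<^sub>R p \<in> ?L"
          unfolding p_def
          by (rule subspace_add[OF subspace_level_space ZL[OF s] subspace_scale[OF subspace_level_space P(4)]])
        ultimately show ?thesis using barycenter_eqI gxm by simp
      next
        case False
        then show ?thesis using outK const[OF s] by simp
      qed
      define \<alpha> where "\<alpha> = integral {a..b} (\<lambda>t. (deriv \<phi> t *\<^sub>R P (v t) + \<phi> t *\<^sub>R U t) \<bullet> e)"
      define \<beta> where "\<beta> = integral {a..b} (\<lambda>t. (norm (deriv \<phi> t *\<^sub>R p))\<^sup>2 + (norm (\<phi> t *\<^sub>R p))\<^sup>2)"
      have int\<alpha>: "(\<lambda>t. (deriv \<phi> t *\<^sub>R P (v t) + \<phi> t *\<^sub>R U t) \<bullet> e) integrable_on {a..b}"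
        using integrable_linear[OF int_full bounded_linear_inner_left[of e]] by (simp add: o_def)
      have c\<psi>: "continuous_on {a..b} (deriv \<phi>)" by (rule continuous_on_subset[OF test_funD(2)[OF \<phi>] subset_UNIV])
      have int\<beta>: "(\<lambda>t. (norm (deriv \<phi> t *\<^sub>R p))\<^sup>2 + (norm (\<phi> t *\<^sub>R p))\<^sup>2) integrable_on {a..b}"
        by (intro integrable_continuous_real continuous_intros c\<phi> c\<psi>)
      have "0 \<le> 2 * h * \<alpha> + h\<^sup>2 * \<beta>" if h: "\<bar>h\<bar> < h0" for h
      proof -
        let ?x = "\<lambda>t. Z t + (h * \<phi> t) *\<^sub>R p" and ?\<eta> = "\<lambda>t. v t + (h * deriv \<phi> t) *\<^sub>R p"
        have lin: "bounded_linear (\<lambda>s::real. (h * s) *\<^sub>R p)"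
          by (intro bounded_linear_scaleR_left[THEN bounded_linear_compose] bounded_linear_mult_right)
        have x: "h1_path a b ?x ?\<eta>" by (rule h1_path_add[OF Zv h1_path_linear[OF lin path\<phi>]])
        let ?l = "\<lambda>t. (norm (v t))\<^sup>2 + (norm (Z t - g (Z t)))\<^sup>2"
        have "action g a b Z v \<le> action g a b ?x ?\<eta>"
          by (rule action_minimizerD(2)[OF m x]) (use test_funD(3)[OF \<phi>, of a] test_funD(3)[OF \<phi>, of b] in auto)
        also have "\<dots> \<le> integral {a..b} (\<lambda>t. ?l t + ((2 * h) * ((deriv \<phi> t *\<^sub>R P (v t) + \<phi> t *\<^sub>R U t) \<bullet> e)
             + h\<^sup>2 * ((norm (deriv \<phi> t *\<^sub>R p))\<^sup>2 + (norm (\<phi> t *\<^sub>R p))\<^sup>2)))"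
          unfolding action_def
        proof (rule integral_le_interior[OF integrable_action[OF x]])
          show "(\<lambda>t. ?l t + ((2 * h) * ((deriv \<phi> t *\<^sub>R P (v t) + \<phi> t *\<^sub>R U t) \<bullet> e)
             + h\<^sup>2 * ((norm (deriv \<phi> t *\<^sub>R p))\<^sup>2 + (norm (\<phi> t *\<^sub>R p))\<^sup>2))) integrable_on {a..b}"
            by (intro integrable_add[OF integrable_action[OF Zv]] integrable_add integrable_on_mult_right int\<alpha> int\<beta>)
          fix t assume t: "a < t" "t < b"
          have gx: "g (?x t) = c" by (rule stay[OF h t])
          have U: "U t = Z t - c" using t by (simp add: U_def)
          have PU: "P (U t) = U t" unfolding U using ZL[OF t] cL P(5) by (simp add: P.diff)
          have e1: "(norm (?\<eta> t))\<^sup>2 = (norm (v t))\<^sup>2 + 2 * h * (deriv \<phi> t * (P (v t) \<bullet> e)) + h\<^sup>2 * (norm (deriv \<phi> t *\<^sub>R p))\<^sup>2"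
            using P(2)[of "v t" e] unfolding p_def power2_norm_eq_inner
            by (simp add: inner_add_left inner_add_right inner_commute power2_eq_square algebra_simps)
          have "(norm (?x t - c))\<^sup>2 = (norm (U t + (h * \<phi> t) *\<^sub>R p))\<^sup>2" unfolding U by (simp add: algebra_simps)
          also have "\<dots> = (norm (U t))\<^sup>2 + 2 * h * (\<phi> t * (U t \<bullet> e)) + h\<^sup>2 * (norm (\<phi> t *\<^sub>R p))\<^sup>2"
            using P(2)[of "U t" e] PU unfolding p_def power2_norm_eq_inner
            by (simp add: inner_add_left inner_add_right inner_commute power2_eq_square algebra_simps)
          finally have e2: "(norm (?x t - c))\<^sup>2 = (norm (U t))\<^sup>2 + 2 * h * (\<phi> t * (U t \<bullet> e)) + h\<^sup>2 * (norm (\<phi> t *\<^sub>R p))\<^sup>2" .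
          show "(norm (?\<eta> t))\<^sup>2 + (norm (?x t - g (?x t)))\<^sup>2 \<le> ?l t + ((2 * h) * ((deriv \<phi> t *\<^sub>R P (v t) + \<phi> t *\<^sub>R U t) \<bullet> e)
             + h\<^sup>2 * ((norm (deriv \<phi> t *\<^sub>R p))\<^sup>2 + (norm (\<phi> t *\<^sub>R p))\<^sup>2))"
            unfolding gx e1 e2 const[OF t] U[symmetric] inner_add_left inner_scaleR_left
            by (simp add: distrib_left)
        qed
        also have "\<dots> = action g a b Z v + (2 * h * \<alpha> + h\<^sup>2 * \<beta>)"
          unfolding action_def \<alpha>_def \<beta>_def
          by (simp only: integral_add[OF integrable_action[OF Zv] integrable_add[OF integrable_on_mult_right[OF int\<alpha>] integrable_on_mult_right[OF int\<beta>]]]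
             integral_add[OF integrable_on_mult_right[OF int\<alpha>] integrable_on_mult_right[OF int\<beta>]] integral_mult_right)
        finally show ?thesis by simp
      qed
      then have "\<alpha> = 0" by (rule first_variation_zero[OF h0])
      moreover have "\<alpha> = integral {a..b} (\<lambda>t. deriv \<phi> t *\<^sub>R P (v t) + \<phi> t *\<^sub>R U t) \<bullet> e"
        unfolding \<alpha>_def using integral_linear[OF int_full bounded_linear_inner_left[of e]] by (simp add: o_def)
      ultimately show ?thesis by simp
    qed
    then show ?thesis using inner_eq_zero_iff by blast
  qed

  define h where "h t = indicator {a..b} t *\<^sub>R (P (v t) - R t)" for t
  have h_meas: "h \<in> borel_measurable borel"
  proof -
    have [measurable]: "(\<lambda>t. indicator {a..b} t *\<^sub>R R t) \<in> borel_measurable borel"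
      by (rule borel_measurable_continuous_on_indicator[OF _ cR]) simp
    have [measurable]: "(\<lambda>t. P (v t)) \<in> borel_measurable borel" by (rule square_integrable_measurable[OF siPv])
    have "h = (\<lambda>t. indicator {a..b} t *\<^sub>R P (v t) - indicator {a..b} t *\<^sub>R R t)"
      by (rule ext) (simp add: h_def scaleR_diff_right)
    then show ?thesis by simp
  qed
  have h_int: "set_integrable lborel {a..b} h"
  proof -
    have "set_integrable lborel {a..b} (\<lambda>t. P (v t) - R t)"
      by (rule set_integral_diff(1)[OF square_integrable_imp_integrable[OF siPv] continuous_set_integrable[OF cR]])
    then show ?thesis unfolding set_integrable_def h_def
      by (rule Bochner_Integration.integrable_cong[THEN iffD1, rotated 2]) (auto simp: indicator_def)
  qed
  have "\<exists>k. \<forall>c d. a \<le> c \<longrightarrow> c \<le> d \<longrightarrow> d \<le> b \<longrightarrow> integral {c..d} h = (d - c) *\<^sub>R k"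
  proof (rule du_Bois_Reymond[OF ab h_int h_meas])
    fix \<phi> assume \<phi>: "test_fun {a<..<b} \<phi>"
    have cont\<phi>: "continuous_on UNIV \<phi>" by (rule test_fun_continuous[OF \<phi>])
    have c\<psi>: "continuous_on {a..b} (deriv \<phi>)" by (rule continuous_on_subset[OF test_funD(2)[OF \<phi>] subset_UNIV])
    have i1: "(\<lambda>t. deriv \<phi> t *\<^sub>R P (v t)) integrable_on {a..b}"
      by (rule set_integrable_integrable_on[OF set_integrable_continuous_scaleR[OF test_funD(2)[OF \<phi>]
            square_integrable_imp_integrable[OF siPv] square_integrable_measurable[OF siPv]] order_refl order_refl])
    have i2: "(\<lambda>t. \<phi> t *\<^sub>R U t) integrable_on {a..b}"
      by (rule set_integrable_integrable_on[OF set_integrable_continuous_scaleR[OF cont\<phi>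
            square_integrable_imp_integrable[OF siU] U_meas] order_refl order_refl])
    have i3: "(\<lambda>t. deriv \<phi> t *\<^sub>R R t) integrable_on {a..b}"
      by (intro integrable_continuous_real continuous_intros c\<psi> cR)
    have "integral {a..b} (\<lambda>t. deriv \<phi> t *\<^sub>R h t) = integral {a..b} (\<lambda>t. deriv \<phi> t *\<^sub>R P (v t) - deriv \<phi> t *\<^sub>R R t)"
      by (rule integral_cong) (simp add: h_def scaleR_diff_right)
    also have "\<dots> = integral {a..b} (\<lambda>t. deriv \<phi> t *\<^sub>R P (v t)) - integral {a..b} (\<lambda>t. deriv \<phi> t *\<^sub>R R t)"
      by (rule integral_diff[OF i1 i3])
    also have "\<dots> = integral {a..b} (\<lambda>t. deriv \<phi> t *\<^sub>R P (v t)) + integral {a..b} (\<lambda>t. \<phi> t *\<^sub>R U t)"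
      unfolding integration_by_parts_h1[OF RU \<phi>] by simp
    also have "\<dots> = integral {a..b} (\<lambda>t. deriv \<phi> t *\<^sub>R P (v t) + \<phi> t *\<^sub>R U t)"
      by (rule integral_add[OF i1 i2, symmetric])
    also have "\<dots> = 0" by (rule weak[OF \<phi>])
    finally show "integral {a..b} (\<lambda>t. deriv \<phi> t *\<^sub>R h t) = 0" .
  qed
  then obtain k where k: "\<And>t. a \<le> t \<Longrightarrow> t \<le> b \<Longrightarrow> integral {a..t} h = (t - a) *\<^sub>R k" by (metis order_refl)

  define D1 where "D1 t = R t + k" for t
  have cD1: "continuous_on {a..b} D1" unfolding D1_def by (intro continuous_intros cR)
  have Zint: "Z t = Z a + integral {a..t} D1" if t: "t \<in> {a..b}" for t
  proof -
    have at: "a \<le> t" "t \<le> b" using t by auto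
    have iv: "(\<lambda>t. P (v t)) integrable_on {a..t}"
      by (rule square_integrable_integrable_on(1)[OF square_integrable_subinterval[OF siPv order_refl at(2)]])
    have iR: "R integrable_on {a..t}"
      by (rule integrable_continuous_real[OF continuous_on_subset[OF cR]]) (use at in auto)
    have "Z t = Z a + integral {a..t} (\<lambda>t. P (v t))"
      using h1_pathD[OF h1_path_linear[OF P(1) Zv] at] PZ t ab by simp
    moreover have "integral {a..t} (\<lambda>t. P (v t)) - integral {a..t} R = integral {a..t} h"
      unfolding integral_diff[OF iv iR, symmetric] by (rule integral_cong) (use at in \<open>simp add: h_def\<close>)
    moreover have "integral {a..t} D1 = integral {a..t} R + (t - a) *\<^sub>R k"
      unfolding D1_def using at by (subst integral_add[OF iR integrable_const_ivl]) simp
    ultimately show ?thesis unfolding k[OF at] by (metis add.commute diff_eq_eq)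
  qed
  have dZ: "(Z has_vector_derivative D1 t) (at t within {a..b})" if t: "t \<in> {a..b}" for t
  proof (rule has_vector_derivative_transform[OF t])
    show "((\<lambda>t. Z a + integral {a..t} D1) has_vector_derivative D1 t) (at t within {a..b})"
      using has_vector_derivative_add[OF has_vector_derivative_const integral_has_vector_derivative[OF cD1 t], of "Z a"] by simp
  qed (rule Zint)
  have dD1: "(D1 has_vector_derivative (Z t - c)) (at t within {a..b})" if t: "t \<in> {a..b}" for t
  proof (rule has_vector_derivative_transform[OF t])
    show "((\<lambda>u. integral {a..u} (\<lambda>t. Z t - c) + k) has_vector_derivative (Z t - c)) (at t within {a..b})"
      using has_vector_derivative_add[OF integral_has_vector_derivative[OF cZc t] has_vector_derivative_const, of k] by simp
    fix u assume u: "u \<in> {a..b}"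
    have "R u = integral {a..u} (\<lambda>t. Z t - c)" unfolding R_def
      by (rule integral_cong) (use u in \<open>simp add: U_def\<close>)
    then show "D1 u = integral {a..u} (\<lambda>t. Z t - c) + k" by (simp add: D1_def)
  qed
  have dZc: "((\<lambda>t. Z t - c) has_vector_derivative D1 t) (at t within {a..b})" if t: "t \<in> {a..b}" for t
    using has_vector_derivative_diff[OF dZ[OF t] has_vector_derivative_const, of c] by simp
  \<comment> \<open>\<open>Z'' = Z - c\<close> makes the higher derivatives alternate\<close>
  define D where "D n = (if n = 0 then Z else if odd n then D1 else (\<lambda>t. Z t - c))" for n :: nat
  have "(D n has_vector_derivative D (Suc n) t) (at t within {a..b})" if "t \<in> {a..b}" for n t
    using dZ[OF that] dD1[OF that] dZc[OF that] by (cases "n = 0"; cases "odd n") (simp_all add: D_def)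
  moreover have "D 0 = Z" by (simp add: D_def)
  ultimately show ?thesis unfolding smooth_on_def by (intro exI[of _ D]) simp
qed

end

section \<open>Conclusion\<close>

context increasing_vector begin

interpretation step_field g by (rule step_field_barycenter)

text \<open>The weak derivative chosen in the functional agrees almost everywhere with the given velocity.\<close>
lemma Lambda'_h1_path:
  assumes T: "0 < T" and z: "h1_path 0 T z v"
    and z0: "z 0 \<in> {perm_vec P \<sigma> | \<sigma>. \<sigma> permutes UNIV}" and zT: "z T \<in> {perm_vec Q \<sigma> | \<sigma>. \<sigma> permutes UNIV}"
  shows "Lambda' A P Q T z = ennreal (action g 0 T z v)"
proof -
  let ?I = "{0<..<T}"
  define u where "u = weak_deriv ?I z"
  have w: "has_L2_weak_deriv ?I z v" by (rule h1_path_weak_deriv[OF z])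
  then have H1: "H1_on ?I z" unfolding H1_on_def using h1_path_L2_on(1)[OF z] by blast
  have wu: "has_L2_weak_deriv ?I z u" unfolding u_def weak_deriv_def by (rule someI[where P = "has_L2_weak_deriv ?I z", OF w])
  have "h1_path 0 T z (\<lambda>t. indicator ?I t *\<^sub>R u t)"
    by (rule has_L2_weak_deriv_h1_path[OF T h1_path_continuous[OF z] wu])
  from h1_path_velocity_unique[OF z this]
  have AE: "AE t in lborel. t \<in> ?I \<longrightarrow> u t = v t"
    by eventually_elim auto
  let ?l = "\<lambda>t. (norm (v t))\<^sup>2 + (norm (z t - g (z t)))\<^sup>2"
  have si: "set_integrable lborel ?I ?l"
    by (rule set_integrable_subset[OF set_integrable_action[OF z]]) auto
  have "(\<integral>\<^sup>+t\<in>?I. ennreal ((norm (u t))\<^sup>2 + (norm (z t - ext_grad (f_max A) (z t)))\<^sup>2) \<partial>lborel)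
      = (\<integral>\<^sup>+t. ennreal (indicator ?I t *\<^sub>R ?l t) \<partial>lborel)"
    by (rule nn_integral_cong_AE) (use AE in eventually_elim, auto simp: ext_grad_eq indicator_def)
  also have "\<dots> = ennreal (LINT t:?I|lborel. ?l t)"
    unfolding set_lebesgue_integral_def
    by (rule nn_integral_eq_integral[OF si[unfolded set_integrable_def]]) (auto simp: indicator_def)
  also have "(LINT t:?I|lborel. ?l t) = action g 0 T z v"
    unfolding action_def by (rule set_integral_open_eq_integral[OF set_integrable_action[OF z]])
  finally show ?thesis using H1 z0 zT unfolding Lambda'_def u_def by simp
qed

text \<open>The straight line from \<open>P\<close> to \<open>Q\<close> shows that the minimum is finite, so the minimizer is of class \<open>H\<^sup>1\<close> with
  admissible end points. Curves with the same end points are admissible as well.\<close>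
lemma global_minimizer_action_minimizer:
  assumes T: "0 < T" and Z: "global_minimizer A P Q T Z"
  obtains v where "action_minimizer 0 T Z v"
proof -
  have cZ: "continuous_on {0..T} Z"
    and min: "\<And>W. continuous_on {0..T} W \<Longrightarrow> Lambda' A P Q T Z \<le> Lambda' A P Q T W"
    using Z unfolding global_minimizer_def by auto
  have id: "perm_vec X id = X" for X :: "(real, 'n) vec" by (simp add: perm_vec_def vec_eq_iff)
  let ?S = "\<lambda>X. {perm_vec X \<sigma> | \<sigma>. \<sigma> permutes UNIV}"
  have self: "X \<in> ?S X" for X :: "(real, 'n) vec"
    using id[of X, symmetric] permutes_id by blast
  let ?x = "\<lambda>t. P + (t - 0) *\<^sub>R ((Q - P) /\<^sub>R T)"
  have hx: "h1_path 0 T ?x (\<lambda>t. (Q - P) /\<^sub>R T)" by (rule h1_path_affine)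
  have "?x 0 = P" "?x T = Q" using T by simp_all
  then have "?x 0 \<in> ?S P" "?x T \<in> ?S Q" using self[of P] self[of Q] by (simp_all only:)
  then have "Lambda' A P Q T ?x = ennreal (action g 0 T ?x (\<lambda>t. (Q - P) /\<^sub>R T))"
    by (rule Lambda'_h1_path[OF T hx])
  then have "Lambda' A P Q T Z \<noteq> \<infinity>"
    using min[OF h1_path_continuous[OF hx]] by (auto simp: top_unique)
  then have H1: "H1_on {0<..<T} Z" and Z0: "Z 0 \<in> ?S P" and ZT: "Z T \<in> ?S Q"
    unfolding Lambda'_def by (metis (no_types, lifting))+
  obtain u where "has_L2_weak_deriv {0<..<T} Z u" using H1 unfolding H1_on_def by blast
  then have Zv: "h1_path 0 T Z (\<lambda>t. indicator {0<..<T} t *\<^sub>R u t)" (is "h1_path 0 T Z ?v")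
    by (rule has_L2_weak_deriv_h1_path[OF T cZ])
  have "action_minimizer 0 T Z ?v"
    unfolding action_minimizer_def
  proof (intro conjI allI impI Zv)
    fix x \<eta> assume x: "h1_path 0 T x \<eta>" "x 0 = Z 0" "x T = Z T"
    have "Lambda' A P Q T Z \<le> Lambda' A P Q T x" by (rule min[OF h1_path_continuous[OF x(1)]])
    moreover have "Lambda' A P Q T Z = ennreal (action g 0 T Z ?v)" by (rule Lambda'_h1_path[OF T Zv Z0 ZT])
    moreover have "Lambda' A P Q T x = ennreal (action g 0 T x \<eta>)"
      by (rule Lambda'_h1_path[OF T x(1)]) (use x Z0 ZT in \<open>simp_all only:\<close>)
    ultimately show "action g 0 T Z ?v \<le> action g 0 T x \<eta>"
      using action_nonneg[OF x(1)] by (simp add: ennreal_le_iff)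
  qed
  then show ?thesis using that by blast
qed

definition order_constant :: "(real \<Rightarrow> (real, 'n) vec) \<Rightarrow> real \<Rightarrow> real \<Rightarrow> bool" where
  "order_constant Z a b \<longleftrightarrow> a < b \<and> (\<exists>c. \<forall>s. a < s \<longrightarrow> s < b \<longrightarrow> g (Z s) = c)"

text \<open>Intervals that can be cut into finitely many pieces of constant order are closed under concatenation, and the
  one-sided germs show this of all short intervals around any given time. Compactness in the form of Bolzano's
  bisection principle does the rest; the subdivision is obtained as a path of a transitive closure.\<close>
lemma minimizer_subdivision:
  assumes m: "action_minimizer 0 T Z v" and T: "0 < T"
  obtains t p where "t 0 = 0" "t p = T" "\<And>i. i < p \<Longrightarrow> 0 \<le> t i \<and> t (Suc i) \<le> T \<and> order_constant Z (t i) (t (Suc i))"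
proof -
  define R where "R a b \<longleftrightarrow> 0 \<le> a \<and> b \<le> T \<and> order_constant Z a b" for a b
  define S where "S a b \<longleftrightarrow> (0 \<le> a \<longrightarrow> b \<le> T \<longrightarrow> R\<^sup>*\<^sup>* a b)" for a b
  have "S 0 T"
  proof (rule Bolzano)
    show "S a c" if "S a b" "S b c" "a \<le> b" "b \<le> c" for a b c
      using that unfolding S_def by (meson order_trans rtranclp_trans)
    fix x assume x: "0 \<le> x" "x \<le> T"
    have "\<exists>\<delta>>0. \<forall>b. x < b \<longrightarrow> b < x + \<delta> \<longrightarrow> b \<le> T \<longrightarrow> order_constant Z x b"
    proof (cases "x < T")
      case True
      have "action_minimizer x T Z v" by (rule action_minimizer_subinterval[OF m]) (use x in auto)
      from minimizer_germ_right[OF this True] show ?thesis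
        unfolding order_constant_def by (meson order_less_trans)
    qed (auto intro: exI[of _ 1])
    then obtain \<delta> where \<delta>: "\<delta> > 0" "\<And>b. x < b \<Longrightarrow> b < x + \<delta> \<Longrightarrow> b \<le> T \<Longrightarrow> order_constant Z x b" by blast
    have "\<exists>\<delta>>0. \<forall>a. a < x \<longrightarrow> x - \<delta> < a \<longrightarrow> 0 \<le> a \<longrightarrow> order_constant Z a x"
    proof (cases "0 < x")
      case True
      have "action_minimizer 0 x Z v" by (rule action_minimizer_subinterval[OF m]) (use x in auto)
      from minimizer_germ_left[OF this True] show ?thesis
        unfolding order_constant_def by (meson order_less_trans)
    qed (auto intro: exI[of _ 1])
    then obtain \<delta>' where \<delta>': "\<delta>' > 0" "\<And>a. a < x \<Longrightarrow> x - \<delta>' < a \<Longrightarrow> 0 \<le> a \<Longrightarrow> order_constant Z a x" by blast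
    have "S a b" if ab: "a \<le> x" "x \<le> b" "b - a < min \<delta> \<delta>'" for a b
      unfolding S_def
    proof (intro impI)
      assume a: "0 \<le> a" and b: "b \<le> T"
      have "R\<^sup>*\<^sup>* a x"
      proof (cases "a = x")
        case False
        then have "R a x" unfolding R_def using \<delta>'(2)[of a] ab a x by auto
        then show ?thesis by blast
      qed simp
      moreover have "R\<^sup>*\<^sup>* x b"
      proof (cases "x = b")
        case False
        then have "R x b" unfolding R_def using \<delta>(2)[of b] ab b x by auto
        then show ?thesis by blast
      qed simp
      ultimately show "R\<^sup>*\<^sup>* a b" by (rule rtranclp_trans)
    qed
    then show "\<exists>d>0. \<forall>a b. a \<le> x \<and> x \<le> b \<and> b - a < d \<longrightarrow> S a b"
      using \<delta>(1) \<delta>'(1) by (intro exI[of _ "min \<delta> \<delta>'"]) auto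
  qed (use T in simp)
  then have "R\<^sup>*\<^sup>* 0 T" by (simp add: S_def)
  then obtain p where "(R ^^ p) 0 T" using rtranclp_imp_relpowp by metis
  then obtain t where "t 0 = 0" "t p = T" "\<forall>i<p. R (t i) (t (Suc i))" unfolding relpowp_fun_conv by blast
  then show ?thesis using that[of t p] unfolding R_def by blast
qed

end

theorem theorem13:
  fixes A P Q :: "real ^ 'n::{finite,linorder}" and T :: real
    and Z :: "real \<Rightarrow> real ^ 'n::{finite,linorder}"
  assumes "strict_mono (\<lambda>i. A $ i)"
    and "T > 0"
    and "global_minimizer A P Q T Z"
  shows "continuous_on {0..T} Z \<and>
    (\<exists>(p::nat) (t :: nat \<Rightarrow> real).
       t 0 = 0 \<and> t p = T \<and> (\<forall>i\<in>{1..p}. t (i - 1) < t i) \<and>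
       (\<forall>i\<in>{1..p}. smooth_on {t (i - 1)..t i} Z \<and>
          (\<lambda>s. level_partition (Z s)) constant_on {t (i - 1)<..<t i}))"
proof -
  interpret increasing_vector A by unfold_locales (rule assms(1))
  interpret step_field g by (rule step_field_barycenter)
  obtain v where m: "action_minimizer 0 T Z v"
    using global_minimizer_action_minimizer[OF assms(2,3)] by blast
  obtain t p where t: "t 0 = 0" "t p = T"
    "\<And>i. i < p \<Longrightarrow> 0 \<le> t i \<and> t (Suc i) \<le> T \<and> order_constant Z (t i) (t (Suc i))"
    using minimizer_subdivision[OF m assms(2)] by blast
  have piece: "t (i - 1) < t i" "smooth_on {t (i - 1)..t i} Z"
    "(\<lambda>s. level_partition (Z s)) constant_on {t (i - 1)<..<t i}" if i: "i \<in> {1..p}" for i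
  proof -
    have *: "0 \<le> t (i - 1)" "t i \<le> T" "order_constant Z (t (i - 1)) (t i)" using t(3)[of "i - 1"] i by auto
    then obtain c where c: "t (i - 1) < t i" "\<And>s. t (i - 1) < s \<Longrightarrow> s < t i \<Longrightarrow> g (Z s) = c"
      unfolding order_constant_def by blast
    show "t (i - 1) < t i" by (rule c(1))
    have "action_minimizer (t (i - 1)) (t i) Z v"
      by (rule action_minimizer_subinterval[OF m]) (use * c(1) in auto)
    then show "smooth_on {t (i - 1)..t i} Z" by (rule smooth_where_order_constant[OF _ c])
    let ?s = "(t (i - 1) + t i) / 2"
    have "level_partition (Z s) = level_partition (Z ?s)" if "s \<in> {t (i - 1)<..<t i}" for s
      using barycenter_eq_level_partition[of "Z s" "Z ?s"] c(2)[of s] c(2)[of ?s] c(1) that by simp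
    then show "(\<lambda>s. level_partition (Z s)) constant_on {t (i - 1)<..<t i}"
      unfolding constant_on_def by blast
  qed
  have "continuous_on {0..T} Z" using assms(3) unfolding global_minimizer_def by blast
  then show ?thesis using t(1,2) piece by blast
qed

end
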